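(* There exist a real sequence $\{\lambda_n\}_{n=1}^{\infty}$ satisfying $\lambda_n = n + o(1)$ as $n \to \infty$, and a Schwartz function $f$ on $\mathbb{R}$, such that for every positive integer $N$ the system of translates $$\{f(x - \lambda_n)\}, \quad n > N,$$ is complete in the space $L^p(\mathbb{R})$ for every $1 < p < \infty$. (The sequence $\{\lambda_n\}$ and the function $f$ do not depend on $N$ or $p$.)
   Context: Functions are complex-valued. A system of vectors in a topological linear space is called complete if its finite (complex) linear combinations are dense in the space. The Schwartz space $\mathcal{S}(\mathbb{R})$ consists of all infinitely smooth functions $\varphi$ on $\mathbb{R}$ such that $\sup_{x\in\mathbb{R}} (1+|x|)^n |\varphi^{(k)}(x)| < \infty$ for all integers $n,k \ge 0$. *)

theory Defs
  imports "HOL-Analysis.Analysis" "HOL-Library.Landau_Symbols"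
begin

definition nth_derivative :: "nat \<Rightarrow> (real \<Rightarrow> complex) \<Rightarrow> real \<Rightarrow> complex" where
  "nth_derivative k f = ((\<lambda>g x. vector_derivative g (at x)) ^^ k) f"

text \<open>
  Since \<^const>\<open>vector_derivative\<close> is total, differentiability of every iterated derivative
  has to be required explicitly.
\<close>

definition smooth :: "(real \<Rightarrow> complex) \<Rightarrow> bool" where
  "smooth f \<longleftrightarrow> (\<forall>k x. nth_derivative k f differentiable at x)"

definition schwartz_space :: "(real \<Rightarrow> complex) set" where
  "schwartz_space = {f. smooth f \<and>
     (\<forall>n k. bdd_above (range (\<lambda>x. (1 + \<bar>x\<bar>) ^ n * norm (nth_derivative k f x))))}"

text \<open>
  Elements of $L^p$ are represented by functions rather than by classes of functions equal
  almost everywhere, so \<open>Lp_norm\<close> is a seminorm on \<open>Lp_space\<close> (for $1 \le p < \infty$).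
\<close>

definition Lp_space :: "'a measure \<Rightarrow> real \<Rightarrow> ('a \<Rightarrow> complex) set" where
  "Lp_space M p = {g \<in> borel_measurable M. integrable M (\<lambda>x. norm (g x) powr p)}"

definition Lp_norm :: "'a measure \<Rightarrow> real \<Rightarrow> ('a \<Rightarrow> complex) \<Rightarrow> real" where
  "Lp_norm M p g = (\<integral>x. norm (g x) powr p \<partial>M) powr (1 / p)"

definition complete_in_Lp ::
    "'a measure \<Rightarrow> real \<Rightarrow> 'i set \<Rightarrow> ('i \<Rightarrow> 'a \<Rightarrow> complex) \<Rightarrow> bool" where
  "complete_in_Lp M p I v \<longleftrightarrow>
     (\<forall>i\<in>I. v i \<in> Lp_space M p) \<and>
     (\<forall>g\<in>Lp_space M p. \<forall>\<epsilon>>0. \<exists>F c. finite F \<and> F \<subseteq> I \<and>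
        Lp_norm M p (\<lambda>x. g x - (\<Sum>i\<in>F. c i * v i x)) < \<epsilon>)"

end

theory Submission
  imports Defs "HOL-Complex_Analysis.Complex_Analysis" "HOL-Probability.Sinc_Integral"
    "HOL-Real_Asymp.Real_Asymp"
begin

text \<open>
  Let \<open>\<gamma> x = exp (- x\<^sup>2)\<close>, let \<open>T\<close> be the translation \<open>(T h) x = h (x - 1)\<close>, and let
  \<open>f = (\<Sum>j. w j * \<gamma> (x - j))\<close>, where \<open>w\<close> is the sequence of Fourier coefficients of a smooth function
  \<open>W\<close> on the unit circle. A combination \<open>\<Sum>n. p n * f (x - n - \<alpha>)\<close> then has coefficients \<open>p * w\<close> (convolution)
  with respect to the functions \<open>\<gamma> (x - \<alpha> - j)\<close>; on the circle this is the product \<open>P W\<close> with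
  \<open>P = (\<Sum>n. p n * z ^ n)\<close>. A bound on the absolute sum of Fourier coefficients (the Wiener norm) bounds
  the supremum and the integral of the resulting function, hence all its \<open>L\<^sup>p\<close> norms at once.

  The decisive property of \<open>W\<close> is that for every \<open>M\<close> there are polynomials \<open>P\<close> divisible by \<open>z ^ M\<close> such that
  \<open>P W\<close> is as close as desired to \<open>(1 - z) ^ 6\<close> in the Wiener norm
  (\<open>one_minus_cay_power_high_frequencies\<close>). By Szego's theorem this forces the integral of \<open>log \<bar>W\<bar>\<close> to diverge, so
  \<open>W\<close> must have a very deep zero, at \<open>z = 1\<close> here. In the Cayley coordinate \<open>z = (y - \<i>) / (y + \<i>)\<close> with real \<open>y\<close>
  the choice is simply \<open>W = exp (- y\<^sup>2)\<close>. Since \<open>1 / (1 - z) = (1 - \<i> y) / 2\<close>, and since this function is a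
  limit of Cesaro means of the geometric series, \<open>p(y) W\<close> is a limit of functions \<open>P W\<close> for each polynomial \<open>p\<close>,
  and so is \<open>exp (q(y)) W\<close> if \<open>q\<close> has degree at most two and a quadratic coefficient smaller than one in modulus.
  The value \<open>P 0\<close> survives these limits as the value at \<open>y = \<i>\<close>. Now \<open>exp (- \<tau> - \<i> \<tau> y)\<close> equals \<open>1\<close> at
  \<open>y = \<i>\<close> but has modulus \<open>exp (- \<tau>)\<close> on the real line; so \<open>W\<close> is a limit of functions \<open>P W\<close> with \<open>P 0 = 0\<close>, that is,
  with \<open>P\<close> divisible by \<open>z\<close>, and iteration gives divisibility by \<open>z ^ M\<close>. Finally
  \<open>(1 - z) ^ 6 * exp (- \<eta> y\<^sup>2)\<close> with small \<open>\<eta> > 0\<close> is such a limit and is close to \<open>(1 - z) ^ 6\<close>.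

  Consequently, for each \<open>\<alpha>\<close>, a block of translations \<open>n + \<alpha>\<close> with arbitrarily large integers \<open>n\<close> produces
  \<open>(1 - T) ^ 6\<close> applied to \<open>\<gamma> (x - \<alpha>)\<close>. Difference quotients in \<open>\<alpha>\<close>, with all shifts in a tiny interval
  \<open>[0, \<delta>)\<close>, give \<open>(1 - T) ^ 6\<close> applied to \<open>x ^ k * \<gamma> x\<close>. Letting \<open>\<delta>\<close> tend to \<open>0\<close> from block to block and letting
  each \<open>k\<close> occur infinitely often yields the sequence \<open>\<lambda> n = n + o(1)\<close> (\<open>translation_sequence\<close>).

  The exponential series now gives \<open>(1 - T) ^ 6\<close> applied to \<open>\<gamma> (x - s)\<close> for all complex \<open>s\<close>. To remove the factors
  \<open>1 - T\<close>, note that \<open>h - (T h + \<dots> + T ^ n h) / n\<close> is a combination of translates of \<open>(1 - T) h\<close>, and the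
  average has supremum \<open>O(1/n)\<close> and bounded \<open>L\<^sup>1\<close> norm, so it tends to \<open>0\<close> in \<open>L\<^sup>p\<close> exactly because \<open>p > 1\<close>
  (\<open>Lp_near_by_averaging\<close>). Imaginary \<open>s\<close> gives the functions \<open>exp (\<i> \<xi> x) * \<gamma> x\<close>, which span a dense subspace: the
  bounded functions \<open>h\<close> with \<open>h \<gamma>\<close> in their closed span form an algebra closed under bounded pointwise
  limits, which contains first the indicators of half-lines and then all bounded measurable functions.
\<close>

section \<open>Fourier coefficients in the Cayley coordinate\<close>

definition cay :: "complex \<Rightarrow> complex" where
  "cay y = (y - \<i>) / (y + \<i>)"

definition cauchy_weight :: "real \<Rightarrow> real" where
  "cauchy_weight t = 1 / (1 + t\<^sup>2)"

text \<open>
  The map \<open>cay\<close> carries the real line onto the unit circle without the point \<open>1\<close>, and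
  \<open>cauchy_weight t * dt\<close> is half the arc length. So this is \<open>\<pi>\<close> times the usual Fourier coefficient of the function
  on the circle.
\<close>

definition circle_coeff :: "(complex \<Rightarrow> complex) \<Rightarrow> int \<Rightarrow> complex" where
  "circle_coeff \<phi> j = (LINT t|lborel. cauchy_weight t *\<^sub>R (\<phi> (of_real t) * cay (of_real t) powi (- j)))"

definition bounded_cont :: "(complex \<Rightarrow> complex) \<Rightarrow> bool" where
  "bounded_cont \<phi> \<longleftrightarrow> continuous_on UNIV (\<lambda>t::real. \<phi> (of_real t)) \<and>
     (\<exists>B. \<forall>t::real. norm (\<phi> (of_real t)) \<le> B)"

lemma of_real_plus_i_nonzero [simp]:
  "complex_of_real t + \<i> \<noteq> 0" "\<i> + complex_of_real t \<noteq> 0" "complex_of_real t - \<i> \<noteq> 0" "complex_of_real t \<noteq> \<i>"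
  by (auto simp: complex_eq_iff)

lemma cay_nonzero [simp]: "cay (complex_of_real t) \<noteq> 0"
  by (simp add: cay_def)

lemma norm_cay [simp]: "norm (cay (complex_of_real t)) = 1"
proof -
  have "norm (complex_of_real t - \<i>) = norm (complex_of_real t + \<i>)"
    by (simp add: cmod_def)
  thus ?thesis by (simp add: cay_def norm_divide)
qed

lemma norm_cay_powi [simp]: "norm (cay (complex_of_real t) powi n) = 1"
  by (simp add: norm_power_int)

lemma cauchy_weight_pos [simp]: "cauchy_weight t > 0" "cauchy_weight t \<ge> 0"
  by (auto simp: cauchy_weight_def add_pos_nonneg)

lemma continuous_cauchy_weight [continuous_intros]: "continuous_on A cauchy_weight"
  unfolding cauchy_weight_def
  by (intro continuous_intros) (auto simp: add_nonneg_eq_0_iff)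

lemma integrable_cauchy_weight: "integrable lborel cauchy_weight"
  using integrable_inverse_1_plus_square
  by (simp add: set_integrable_def cauchy_weight_def [abs_def] inverse_eq_divide)

lemma integral_cauchy_weight: "(LINT t|lborel. cauchy_weight t) = pi"
  using LBINT_inverse_1_plus_square
  by (simp add: interval_lebesgue_integral_def set_lebesgue_integral_def
      cauchy_weight_def [abs_def] inverse_eq_divide)

lemma integrable_by_cauchy_weight:
  fixes g :: "real \<Rightarrow> complex"
  assumes "continuous_on UNIV g" "\<And>t. norm (g t) \<le> B * cauchy_weight t"
  shows "integrable lborel g" "norm (LINT t|lborel. g t) \<le> B * pi"
proof -
  have i: "integrable lborel (\<lambda>t. B * cauchy_weight t)"
    using integrable_cauchy_weight by simp
  show g: "integrable lborel g"
  proof (rule Bochner_Integration.integrable_bound[OF i])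
    show "g \<in> borel_measurable lborel"
      using assms(1) by (simp add: borel_measurable_continuous_onI)
    show "AE t in lborel. norm (g t) \<le> norm (B * cauchy_weight t)"
      using assms(2) by (intro AE_I2) (metis abs_ge_self order_trans real_norm_def)
  qed
  have "norm (LINT t|lborel. g t) \<le> (LINT t|lborel. B * cauchy_weight t)"
    by (rule order_trans[OF Bochner_Integration.integral_norm_bound integral_mono[OF integrable_norm[OF g] i]])
       (use assms in auto)
  thus "norm (LINT t|lborel. g t) \<le> B * pi"
    by (simp add: integral_cauchy_weight)
qed

lemma continuous_cay_powi [continuous_intros]:
  "continuous_on A (\<lambda>t::real. cay (of_real t) powi n)"
  unfolding cay_def
  by (intro continuous_intros) auto

lemma coeff_integrable:
  assumes "bounded_cont \<phi>"
  shows "integrable lborel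
    (\<lambda>t. cauchy_weight t *\<^sub>R (\<phi> (of_real t) * cay (of_real t) powi n))"
proof -
  from assms obtain B where c: "continuous_on UNIV (\<lambda>t::real. \<phi> (of_real t))"
    and B: "\<And>t::real. norm (\<phi> (of_real t)) \<le> B"
    unfolding bounded_cont_def by auto
  show ?thesis
    by (rule integrable_by_cauchy_weight(1)[where B = B])
      (auto intro!: continuous_intros c mult_right_mono B simp: norm_mult mult.commute[of "cauchy_weight _"])
qed

lemma bounded_cont_add [intro]:
  assumes "bounded_cont \<phi>" "bounded_cont \<psi>"
  shows "bounded_cont (\<lambda>y. \<phi> y + \<psi> y)"
proof -
  obtain B C where "\<And>t::real. norm (\<phi> (of_real t)) \<le> B" "\<And>t::real. norm (\<psi> (of_real t)) \<le> C"
    using assms unfolding bounded_cont_def by auto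
  hence "\<And>t::real. norm (\<phi> (of_real t) + \<psi> (of_real t)) \<le> B + C"
    by (intro norm_triangle_mono)
  thus ?thesis using assms unfolding bounded_cont_def by (auto intro!: continuous_intros)
qed

lemma bounded_cont_mult [intro]:
  assumes "bounded_cont \<phi>" "bounded_cont \<psi>"
  shows "bounded_cont (\<lambda>y. \<phi> y * \<psi> y)"
proof -
  obtain B C where BC: "\<And>t::real. norm (\<phi> (of_real t)) \<le> B" "\<And>t::real. norm (\<psi> (of_real t)) \<le> C"
    using assms unfolding bounded_cont_def by auto
  have "norm (\<phi> (of_real t) * \<psi> (of_real t)) \<le> B * C" for t :: real
    using BC[of t] by (auto simp: norm_mult intro!: mult_mono order_trans[OF norm_ge_zero BC(1)[of t]])
  thus ?thesis using assms unfolding bounded_cont_def by (auto intro!: continuous_intros)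
qed

lemma bounded_cont_const [intro]: "bounded_cont (\<lambda>y. c)"
  unfolding bounded_cont_def by auto

lemma bounded_cont_sum [intro]:
  "(\<And>i. i \<in> I \<Longrightarrow> bounded_cont (\<phi> i)) \<Longrightarrow> bounded_cont (\<lambda>y. \<Sum>i\<in>I. \<phi> i y)"
  by (induction I rule: infinite_finite_induct) auto

lemma bounded_cont_cay [intro]: "bounded_cont cay"
  using continuous_cay_powi[of UNIV 1] unfolding bounded_cont_def by (auto intro!: exI[of _ 1])

lemma bounded_cont_cay_power [intro]: "bounded_cont (\<lambda>y. cay y ^ n)"
  by (induction n) auto

lemma bounded_cont_poly_cay [intro]: "bounded_cont (\<lambda>y. poly P (cay y))"
  by (induction P) (auto intro!: bounded_cont_add bounded_cont_mult)

lemma coeff_add: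
  assumes "bounded_cont \<phi>" "bounded_cont \<psi>"
  shows "circle_coeff (\<lambda>y. \<phi> y + \<psi> y) j = circle_coeff \<phi> j + circle_coeff \<psi> j"
  unfolding circle_coeff_def using coeff_integrable[OF assms(1)] coeff_integrable[OF assms(2)]
  by (simp add: ring_distribs scaleR_right_distrib)

lemma coeff_cmult: "circle_coeff (\<lambda>y. c * \<phi> y) j = c * circle_coeff \<phi> j"
proof -
  have "circle_coeff (\<lambda>y. c * \<phi> y) j =
    (LINT t|lborel. c * (cauchy_weight t *\<^sub>R (\<phi> (of_real t) * cay (of_real t) powi (- j))))"
    unfolding circle_coeff_def by (intro Bochner_Integration.integral_cong) (auto simp: mult_ac)
  thus ?thesis by (simp add: circle_coeff_def del: mult_scaleR_right)
qed

lemma coeff_diff: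
  assumes "bounded_cont \<phi>" "bounded_cont \<psi>"
  shows "circle_coeff (\<lambda>y. \<phi> y - \<psi> y) j = circle_coeff \<phi> j - circle_coeff \<psi> j"
  using coeff_add[OF assms(1) bounded_cont_mult[OF bounded_cont_const[of "-1"] assms(2)]] coeff_cmult[of "-1" \<psi>]
  by simp

lemma coeff_sum:
  "(\<And>i. i \<in> I \<Longrightarrow> bounded_cont (\<phi> i)) \<Longrightarrow>
    circle_coeff (\<lambda>y. \<Sum>i\<in>I. \<phi> i y) j = (\<Sum>i\<in>I. circle_coeff (\<phi> i) j)"
proof (induction I rule: infinite_finite_induct)
  case (insert i I)
  thus ?case by (simp add: coeff_add bounded_cont_sum)
qed (auto simp: circle_coeff_def)

lemma coeff_cay_power_mult: "circle_coeff (\<lambda>y. cay y ^ n * \<phi> y) j = circle_coeff \<phi> (j - int n)"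
proof -
  have "cay (of_real t) ^ n * cay (of_real t) powi (- j) = cay (of_real t) powi (- (j - int n))" for t
    by (simp flip: power_int_of_nat power_int_add)
  thus ?thesis unfolding circle_coeff_def
    by (intro Bochner_Integration.integral_cong) (auto simp: mult_ac)
qed

lemma integral_derivative_eq_0:
  fixes F :: "real \<Rightarrow> complex"
  assumes "\<And>t. (F has_vector_derivative f t) (at t)" "continuous_on UNIV f" "integrable lborel f"
    and "(F \<longlongrightarrow> L) at_top" "(F \<longlongrightarrow> L) at_bot"
  shows "(LINT t|lborel. f t) = 0"
proof -
  have "(LBINT t=-\<infinity>..\<infinity>. f t) = L - L"
  proof (rule interval_integral_FTC_integrable)
    show "set_integrable lborel (einterval (- \<infinity>) \<infinity>) f"
      using assms by (simp add: set_integrable_def)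
  qed (use assms in \<open>auto simp: ereal_tendsto_simps continuous_on_eq_continuous_at\<close>)
  thus ?thesis by (simp add: interval_lebesgue_integral_def set_lebesgue_integral_def)
qed

lemma has_vector_derivative_cay_powi:
  "((\<lambda>t. cay (of_real t) powi n) has_vector_derivative
     (cauchy_weight t *\<^sub>R (2 * \<i> * of_int n * cay (of_real t) powi n))) (at t)"
proof -
  have d: "(cay has_field_derivative (2 * \<i> / (of_real t + \<i>)^2)) (at (of_real t))"
    unfolding cay_def
    by (rule derivative_eq_intros refl of_real_plus_i_nonzero(1))+ (simp add: power2_eq_square)
  have w: "complex_of_real (cauchy_weight t) = 1 / ((of_real t + \<i>) * (of_real t - \<i>))"
    by (simp add: cauchy_weight_def algebra_simps power2_eq_square)
  have eq: "of_int n * cay (of_real t) powi (n - 1) * (2 * \<i> / (of_real t + \<i>)^2) =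
     (cauchy_weight t *\<^sub>R (2 * \<i> * of_int n * cay (of_real t) powi n))"
  proof -
    have aux: "n' * (p / (b / a)) * (2 * \<i> / a^2) = 1 / (a * b) * (2 * \<i> * n' * p)"
      if "a \<noteq> 0" "b \<noteq> 0" for a b n' p :: complex
      using that by (simp add: field_simps power2_eq_square)
    have "cay (of_real t) powi (n - 1) = cay (of_real t) powi n / ((of_real t - \<i>) / (of_real t + \<i>))"
      by (simp add: power_int_diff) (simp add: cay_def)
    thus ?thesis
      unfolding scaleR_conv_of_real w by (simp only:) (rule aux, auto)
  qed
  have "((\<lambda>y. cay y powi n) has_field_derivative (of_int n * cay (of_real t) powi (n - 1) * (2 * \<i> / (of_real t + \<i>)^2)))
      (at (of_real t))"
    by (rule derivative_eq_intros d refl | simp)+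
  from has_vector_derivative_real_field[OF this] show ?thesis
    by (simp only: eq)
qed

text \<open>
  The derivative of \<open>cay (of_real t) powi n\<close> is \<open>2 * \<i> * n\<close> times itself times the weight, so integration by
  parts trades a derivative for a factor \<open>1 / j\<close>; this is where all decay in \<open>j\<close> comes from.
\<close>

lemma coeff_by_parts:
  assumes d: "\<And>t. (g has_vector_derivative g' t) (at t)"
    and c: "continuous_on UNIV g'" and i: "integrable lborel g'"
    and z: "(g \<longlongrightarrow> 0) at_top" "(g \<longlongrightarrow> 0) at_bot" and b: "\<And>t. norm (g t) \<le> B"
  shows "2 * \<i> * of_int j * (LINT t|lborel. cauchy_weight t *\<^sub>R (g t * cay (of_real t) powi (- j)))
       = (LINT t|lborel. g' t * cay (of_real t) powi (- j))"
proof -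
  have cg: "continuous_on UNIV g"
    using d by (meson continuous_at_imp_continuous_on has_vector_derivative_continuous)
  let ?h = "\<lambda>t. cauchy_weight t *\<^sub>R (g t * cay (of_real t) powi (- j))"
  let ?k = "\<lambda>t. g' t * cay (of_real t) powi (- j)"
  have ih: "integrable lborel ?h"
    by (rule integrable_by_cauchy_weight(1)[where B = B])
      (auto intro!: continuous_intros cg mult_right_mono b simp: norm_mult mult.commute[of "cauchy_weight _"])
  have ik: "integrable lborel ?k"
    by (rule Bochner_Integration.integrable_bound[OF i])
       (auto intro!: borel_measurable_continuous_onI continuous_intros c simp: norm_mult)
  have "(LINT t|lborel. ?k t - 2 * \<i> * of_int j * ?h t) = 0"
  proof (rule integral_derivative_eq_0)
    show "((\<lambda>t. g t * cay (of_real t) powi (- j)) has_vector_derivative ?k t - 2 * \<i> * of_int j * ?h t) (at t)" for t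
      by (rule has_vector_derivative_eq_rhs[OF has_vector_derivative_mult[OF d has_vector_derivative_cay_powi]])
         (simp add: scaleR_conv_of_real algebra_simps)
    show "continuous_on UNIV (\<lambda>t. ?k t - 2 * \<i> * of_int j * ?h t)"
      by (intro continuous_intros c cg)
    show "integrable lborel (\<lambda>t. ?k t - 2 * \<i> * of_int j * ?h t)"
      by (intro Bochner_Integration.integrable_diff ik integrable_mult_right ih)
    show "((\<lambda>t. g t * cay (of_real t) powi - j) \<longlongrightarrow> 0) at_top"
      by (rule tendsto_norm_zero_cancel) (simp add: norm_mult tendsto_norm_zero z)
    show "((\<lambda>t. g t * cay (of_real t) powi - j) \<longlongrightarrow> 0) at_bot"
      by (rule tendsto_norm_zero_cancel) (simp add: norm_mult tendsto_norm_zero z)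
  qed
  thus ?thesis
    using ih ik by (simp del: mult_scaleR_right)
qed

text \<open>
  For \<open>j \<noteq> n\<close> the integrand is a multiple of the derivative of a power of \<open>cay\<close>, which has the same limit
  at both ends of the line.
\<close>

lemma coeff_cay_power: "circle_coeff (\<lambda>y. cay y ^ n) j = (if j = int n then of_real pi else 0)"
proof (cases "j = int n")
  case True
  hence "circle_coeff (\<lambda>y. cay y ^ n) j = (LINT t|lborel. complex_of_real (cauchy_weight t))"
    unfolding circle_coeff_def
    by (intro Bochner_Integration.integral_cong) (auto simp: scaleR_conv_of_real power_int_minus)
  thus ?thesis using True by (simp add: integral_cauchy_weight)
next
  case False
  define m where "m = int n - j"
  have m: "m \<noteq> 0" using False by (simp add: m_def)
  have "circle_coeff (\<lambda>y. cay y ^ n) j = (LINT t|lborel. cauchy_weight t *\<^sub>R cay (of_real t) powi m)"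
    unfolding circle_coeff_def m_def
    by (intro Bochner_Integration.integral_cong) (auto simp flip: power_int_of_nat power_int_add)
  also have "2 * \<i> * of_int m * \<dots> = (LINT t|lborel. cauchy_weight t *\<^sub>R (2 * \<i> * of_int m * cay (of_real t) powi m))"
  proof -
    have "(LINT t|lborel. cauchy_weight t *\<^sub>R (2 * \<i> * of_int m * cay (of_real t) powi m)) =
       (LINT t|lborel. 2 * \<i> * of_int m * (cauchy_weight t *\<^sub>R cay (of_real t) powi m))"
      by (intro Bochner_Integration.integral_cong) auto
    thus ?thesis by (simp del: mult_scaleR_right)
  qed
  also have "\<dots> = 0"
  proof (rule integral_derivative_eq_0[OF has_vector_derivative_cay_powi])
    show "integrable lborel (\<lambda>t. cauchy_weight t *\<^sub>R (2 * \<i> * of_int m * cay (of_real t) powi m))"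
      using coeff_integrable[OF bounded_cont_const] .
    have *: "((\<lambda>t. cay (of_real t)) \<longlongrightarrow> 1) F" if "filterlim (\<lambda>t. of_real t + \<i> :: complex) at_infinity F"
      for F :: "real filter"
    proof -
      have "((\<lambda>t. 1 - 2 * \<i> / (of_real t + \<i>)) \<longlongrightarrow> 1 - 0) F"
        by (intro tendsto_intros tendsto_divide_0[OF tendsto_const that])
      moreover have "(\<lambda>t. cay (of_real t)) = (\<lambda>t. 1 - 2 * \<i> / (of_real t + \<i>))"
        by (auto simp: cay_def field_simps)
      ultimately show ?thesis by simp
    qed
    have "filterlim (\<lambda>t::real. of_real t + \<i> :: complex) at_infinity at_top"
      unfolding filterlim_at_infinity_conv_norm_at_top by (simp add: cmod_def) real_asymp
    hence "((\<lambda>t. cay (of_real t) powi m) \<longlongrightarrow> 1 powi m) at_top"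
      by (intro tendsto_intros *) auto
    thus "((\<lambda>t. cay (of_real t) powi m) \<longlongrightarrow> 1) at_top" by simp
    have "filterlim (\<lambda>t::real. of_real t + \<i> :: complex) at_infinity at_bot"
      unfolding filterlim_at_infinity_conv_norm_at_top by (simp add: cmod_def) real_asymp
    hence "((\<lambda>t. cay (of_real t) powi m) \<longlongrightarrow> 1 powi m) at_bot"
      by (intro tendsto_intros *) auto
    thus "((\<lambda>t. cay (of_real t) powi m) \<longlongrightarrow> 1) at_bot" by simp
  qed (intro continuous_intros)
  finally show ?thesis using m False by simp
qed

section \<open>Holomorphic functions in a strip and the Wiener norm\<close>

definition strip :: "complex set" where
  "strip = {y. \<bar>Im y\<bar> < 1/2}"

text \<open>
  Working with holomorphic functions in a strip makes bounds on derivatives automatic through Cauchy's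
  inequality. The width keeps the strip away from the poles \<open>\<plusminus> \<i>\<close> of the powers of \<open>cay\<close>, and \<open>Im y < 1/2\<close> makes
  \<open>exp (- \<tau> - \<i> * \<tau> * y)\<close> small there.
\<close>

definition decays :: "(complex \<Rightarrow> complex) \<Rightarrow> real \<Rightarrow> bool" where
  "decays \<phi> B \<longleftrightarrow> \<phi> holomorphic_on strip \<and> (\<forall>y\<in>strip. norm (\<phi> y) \<le> B / (1 + (norm y)\<^sup>2)\<^sup>2)"

text \<open>
  An upper bound for the absolute sum of the coefficients, expressed through finite sums so that no
  summability has to be carried along.
\<close>

definition wiener_le :: "(complex \<Rightarrow> complex) \<Rightarrow> real \<Rightarrow> bool" where
  "wiener_le \<phi> B \<longleftrightarrow> bounded_cont \<phi> \<and> (\<forall>F. finite F \<longrightarrow> (\<Sum>j\<in>F. norm (circle_coeff \<phi> j)) \<le> B)"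

lemma open_strip: "open strip"
  unfolding strip_def by (intro open_Collect_less continuous_intros)

lemma of_real_in_strip [simp]: "complex_of_real t \<in> strip"
  by (simp add: strip_def)

lemma one_plus_square_pos [simp]: "1 + (t::real)\<^sup>2 > 0" "1 + (t::real)\<^sup>2 \<noteq> 0"
  by (simp_all add: add_pos_nonneg add_nonneg_eq_0_iff)

lemma cauchy_weight_le_1 [simp]: "cauchy_weight t \<le> 1"
  by (simp add: cauchy_weight_def)

lemma cauchy_weight_tendsto_0: "(cauchy_weight \<longlongrightarrow> 0) at_top" "(cauchy_weight \<longlongrightarrow> 0) at_bot"
  unfolding cauchy_weight_def by real_asymp+

lemma tendsto_0_by_cauchy_weight:
  fixes g :: "real \<Rightarrow> complex"
  assumes "\<And>t. norm (g t) \<le> B * cauchy_weight t"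
  shows "(g \<longlongrightarrow> 0) at_top" "(g \<longlongrightarrow> 0) at_bot"
proof -
  have "((\<lambda>t. B * cauchy_weight t) \<longlongrightarrow> 0) at_top" "((\<lambda>t. B * cauchy_weight t) \<longlongrightarrow> 0) at_bot"
    by (auto intro!: tendsto_mult_right_zero cauchy_weight_tendsto_0)
  from Lim_null_comparison[OF always_eventually[OF allI[OF assms]] this(1)]
    Lim_null_comparison[OF always_eventually[OF allI[OF assms]] this(2)]
  show "(g \<longlongrightarrow> 0) at_top" "(g \<longlongrightarrow> 0) at_bot" .
qed

text \<open>
  Each term is at most \<open>3\<close> times the increment of \<open>arctan\<close> over a unit interval, and these
  increments telescope.
\<close>

lemma sum_translated_cauchy_weight:
  assumes "finite F"
  shows "(\<Sum>j\<in>F. cauchy_weight (x - real_of_int j)) \<le> 3 * pi"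
proof -
  define A where "A j = arctan (x - real_of_int j)" for j
  have 1: "cauchy_weight (x - real_of_int j) \<le> 3 * (A (j - 1) - A j)" for j
  proof -
    define u where "u = x - real_of_int j"
    have "\<exists>z. u < z \<and> z < u + 1 \<and> arctan (u + 1) - arctan u = (u + 1 - u) * inverse (1 + z\<^sup>2)"
      by (rule MVT2) (auto intro!: derivative_eq_intros)
    then obtain z where z: "u < z" "z < u + 1" "arctan (u + 1) - arctan u = inverse (1 + z\<^sup>2)"
      by auto
    define s where "s = z - u"
    have s: "0 \<le> s" "s \<le> 1" "z = u + s" using z by (auto simp: s_def)
    have "s\<^sup>2 \<le> 1" using s by (simp add: power_le_one)
    have "2 * u * s \<le> u\<^sup>2 + s\<^sup>2" by (rule sum_squares_bound)
    moreover have "z\<^sup>2 = u\<^sup>2 + s\<^sup>2 + 2 * u * s" unfolding s(3) by (rule power2_sum)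
    ultimately have "1 + z\<^sup>2 \<le> 3 * (1 + u\<^sup>2)"
      using \<open>s\<^sup>2 \<le> 1\<close> zero_le_power2[of u] by argo
    hence "1 / (3 * (1 + u\<^sup>2)) \<le> 1 / (1 + z\<^sup>2)"
      by (intro divide_left_mono mult_pos_pos) (simp_all only: one_plus_square_pos zero_less_numeral zero_le_one)
    hence "3 * (1 / (3 * (1 + u\<^sup>2))) \<le> 3 * inverse (1 + z\<^sup>2)"
      by (simp only: inverse_eq_divide)
    also have "3 * (1 / (3 * (1 + u\<^sup>2))) = cauchy_weight u"
      by (simp add: cauchy_weight_def del: distrib_left_numeral)
    finally have "cauchy_weight u \<le> 3 * inverse (1 + z\<^sup>2)" .
    thus ?thesis using z(3) by (simp add: A_def u_def algebra_simps)
  qed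
  have tele: "(\<Sum>j\<in>{- int n..int n}. A (j - 1) - A j) = A (- int n - 1) - A (int n)" for n
  proof (induction n)
    case (Suc n)
    have "{- int (Suc n)..int (Suc n)} = insert (- int (Suc n)) (insert (int (Suc n)) {- int n..int n})"
      by auto
    moreover have "A (- int n - 1) = A (- 1 - int n)" by (rule arg_cong[of _ _ A]) simp
    ultimately show ?case using Suc by simp
  qed auto
  obtain n where n: "F \<subseteq> {- int n..int n}"
  proof -
    define m where "m = Max (insert 0 (abs ` F))"
    have "\<bar>j\<bar> \<le> m" if "j \<in> F" for j
      unfolding m_def using assms that by (intro Max_ge) auto
    moreover have "0 \<le> m" unfolding m_def using assms by (intro Max_ge) auto
    ultimately have "F \<subseteq> {- int (nat m)..int (nat m)}" by (fastforce simp: abs_le_iff)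
    thus ?thesis by (rule that)
  qed
  have "(\<Sum>j\<in>F. cauchy_weight (x - real_of_int j)) \<le> (\<Sum>j\<in>{- int n..int n}. cauchy_weight (x - real_of_int j))"
    using n by (intro sum_mono2) auto
  also have "\<dots> \<le> (\<Sum>j\<in>{- int n..int n}. 3 * (A (j - 1) - A j))"
    by (intro sum_mono 1)
  also have "\<dots> = 3 * (A (- int n - 1) - A (int n))"
    by (simp only: tele flip: sum_distrib_left)
  also have "\<dots> \<le> 3 * pi"
    using arctan_lbound[of "x - int n"] arctan_ubound[of "x + int n + 1"]
    by (simp add: A_def algebra_simps)
  finally show ?thesis .
qed

lemma decays_imp_nonneg: "decays \<phi> B \<Longrightarrow> B \<ge> 0"
  unfolding decays_def using of_real_in_strip[of 0] norm_ge_zero[of "\<phi> 0"]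
  by (fastforce intro: order_trans[OF norm_ge_zero])

lemma decays_deriv_bound:
  assumes "decays \<phi> B"
  shows "norm ((deriv ^^ n) \<phi> (of_real t)) \<le> fact n * 4 ^ (n + 1) * B / (1 + t\<^sup>2)\<^sup>2"
proof -
  have B: "B \<ge> 0" using assms by (rule decays_imp_nonneg)
  have sub: "cball (complex_of_real t) (1/4) \<subseteq> strip"
  proof
    fix y assume "y \<in> cball (complex_of_real t) (1/4)"
    hence "\<bar>Im (y - of_real t)\<bar> \<le> 1/4"
      by (metis abs_Im_le_cmod dist_commute dist_norm mem_cball order_trans)
    thus "y \<in> strip" by (simp add: strip_def)
  qed
  have "norm ((deriv ^^ n) \<phi> (of_real t)) \<le> fact n * (4 * B / (1 + t\<^sup>2)\<^sup>2) / (1/4) ^ n"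
  proof (rule Cauchy_inequality)
    show "\<phi> holomorphic_on ball (of_real t) (1/4)"
      by (rule holomorphic_on_subset[OF _ order_trans[OF ball_subset_cball sub]])
         (use assms in \<open>simp add: decays_def\<close>)
    show "continuous_on (cball (of_real t) (1/4)) \<phi>"
      by (rule holomorphic_on_imp_continuous_on[OF holomorphic_on_subset[OF _ sub]])
         (use assms in \<open>simp add: decays_def\<close>)
    fix y assume y: "norm (complex_of_real t - y) = 1/4"
    hence "y \<in> strip" using sub by (auto simp: dist_norm)
    hence "norm (\<phi> y) \<le> B / (1 + (norm y)\<^sup>2)\<^sup>2" using assms by (auto simp: decays_def)
    also have "\<dots> \<le> B / ((1 + t\<^sup>2) / 2)\<^sup>2"
    proof -
      have "\<bar>t\<bar> \<le> norm y + 1/4"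
        using y norm_triangle_sub[of "complex_of_real t" y] by simp
      hence "t\<^sup>2 \<le> (norm y + 1/4)\<^sup>2" by (metis abs_ge_zero power2_abs power_mono)
      also have "\<dots> \<le> 2 * (norm y)\<^sup>2 + 1/8"
        using zero_le_power2[of "norm y - 1/4"] by (simp add: power2_eq_square algebra_simps)
      finally have "(1 + t\<^sup>2) / 2 \<le> 1 + (norm y)\<^sup>2" by simp
      moreover have "0 < (1 + t\<^sup>2) / 2" by (simp add: add_pos_nonneg)
      ultimately show ?thesis using B
        by (intro divide_left_mono power_mono) (auto intro!: mult_pos_pos simp: add_pos_nonneg)
    qed
    finally show "norm (\<phi> y) \<le> 4 * B / (1 + t\<^sup>2)\<^sup>2" by (simp add: power_divide mult.commute)
  qed simp
  thus ?thesis by (simp add: power_divide field_simps)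
qed

lemma decays_bound_real:
  assumes "decays \<phi> B"
  shows "norm (\<phi> (of_real t)) \<le> B / (1 + t\<^sup>2)\<^sup>2"
  using assms of_real_in_strip[of t] unfolding decays_def by fastforce

lemma one_plus_square_mult_div:
  "(1 + t\<^sup>2) * (c / (1 + t\<^sup>2)\<^sup>2) = c * cauchy_weight t"
  by (simp add: cauchy_weight_def power2_eq_square[of "1 + t\<^sup>2"])

lemma cauchy_weight_sq_le: "B \<ge> 0 \<Longrightarrow> B / (1 + t\<^sup>2)\<^sup>2 \<le> B * cauchy_weight t"
  using mult_left_mono[OF cauchy_weight_le_1[of t], of "B * cauchy_weight t"]
  by (simp add: cauchy_weight_def power2_eq_square)

lemma continuous_on_of_real_holomorphic:
  assumes "\<phi> holomorphic_on strip"
  shows "continuous_on UNIV (\<lambda>t::real. \<phi> (of_real t))"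
  by (rule continuous_on_compose2[OF holomorphic_on_imp_continuous_on[OF assms]])
     (auto intro!: continuous_intros)

lemma decays_bounded_cont:
  assumes "decays \<phi> B"
  shows "bounded_cont \<phi>"
proof -
  have "norm (\<phi> (of_real t)) \<le> B" for t :: real
  proof -
    have "norm (\<phi> (of_real t)) \<le> B * cauchy_weight t"
      using decays_bound_real[OF assms, of t] cauchy_weight_sq_le[OF decays_imp_nonneg[OF assms], of t]
      by simp
    also have "\<dots> \<le> B * 1"
      using decays_imp_nonneg[OF assms] by (intro mult_left_mono) auto
    finally show ?thesis by simp
  qed
  thus ?thesis
    using assms unfolding bounded_cont_def decays_def
    by (auto intro!: continuous_on_of_real_holomorphic)
qed

text \<open>
  Two integrations by parts, with the derivatives bounded by Cauchy's inequality.
\<close>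

lemma decays_coeff_bound:
  assumes "decays \<phi> B"
  shows "norm (circle_coeff \<phi> j) \<le> 72 * pi * B * cauchy_weight (of_int j)"
proof -
  have B: "B \<ge> 0" using assms by (rule decays_imp_nonneg)
  have hol: "\<phi> holomorphic_on strip" using assms by (simp add: decays_def)
  have hol1: "deriv \<phi> holomorphic_on strip" by (intro holomorphic_deriv hol open_strip)
  have hol2: "deriv (deriv \<phi>) holomorphic_on strip" by (intro holomorphic_deriv hol1 open_strip)
  have d0: "((\<lambda>t. \<phi> (of_real t)) has_vector_derivative deriv \<phi> (of_real t)) (at t)" for t :: real
    by (intro has_vector_derivative_real_field holomorphic_derivI[OF hol open_strip]) simp
  have d1: "((\<lambda>t. deriv \<phi> (of_real t)) has_vector_derivative deriv (deriv \<phi>) (of_real t)) (at t)" for t :: real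
    by (intro has_vector_derivative_real_field holomorphic_derivI[OF hol1 open_strip]) simp
  have b0: "norm (\<phi> (of_real t)) \<le> 4 * B / (1 + t\<^sup>2)\<^sup>2" for t :: real
    using decays_deriv_bound[OF assms, of 0 t] by simp
  have b1: "norm (deriv \<phi> (of_real t)) \<le> 16 * B / (1 + t\<^sup>2)\<^sup>2" for t :: real
    using decays_deriv_bound[OF assms, of 1 t] by simp
  have b2: "norm (deriv (deriv \<phi>) (of_real t)) \<le> 128 * B / (1 + t\<^sup>2)\<^sup>2" for t :: real
    using decays_deriv_bound[OF assms, of 2 t] by (simp add: numeral_2_eq_2)
  have bc: "norm (\<phi> (of_real t)) \<le> B" for t :: real
  proof -
    have "norm (\<phi> (of_real t)) \<le> B * cauchy_weight t"
      using decays_bound_real[OF assms, of t] cauchy_weight_sq_le[OF B, of t] by simp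
    also have "\<dots> \<le> B * 1" using B by (intro mult_left_mono) auto
    finally show ?thesis by simp
  qed
  show ?thesis
  proof (cases "j = 0")
    case True
    have "norm (circle_coeff \<phi> j) \<le> B * pi"
      unfolding circle_coeff_def
      by (rule integrable_by_cauchy_weight)
         (auto intro!: continuous_intros continuous_on_of_real_holomorphic[OF hol] mult_right_mono bc
           simp: norm_mult mult.commute[of "cauchy_weight _"])
    moreover have "B * pi \<le> 72 * (B * pi)" using B by simp
    ultimately show ?thesis using True by (simp add: cauchy_weight_def mult_ac)
  next
    case False
    define g where "g t = (1 + complex_of_real t ^ 2) * deriv \<phi> (of_real t)" for t
    define g' where "g' t = 2 * of_real t * deriv \<phi> (of_real t) + (1 + complex_of_real t ^ 2) * deriv (deriv \<phi>) (of_real t)" for t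
    have n1: "norm (1 + complex_of_real t ^ 2) = 1 + t\<^sup>2" for t
    proof -
      have "1 + complex_of_real t ^ 2 = of_real (1 + t\<^sup>2)" by simp
      thus ?thesis by (simp only: norm_of_real) (simp add: add_nonneg_nonneg)
    qed
    have bg: "norm (g t) \<le> 16 * B * cauchy_weight t" for t
    proof -
      have "norm (g t) \<le> (1 + t\<^sup>2) * (16 * B / (1 + t\<^sup>2)\<^sup>2)"
        unfolding g_def norm_mult n1 by (intro mult_left_mono b1) (simp add: add_nonneg_nonneg)
      thus ?thesis by (simp only: one_plus_square_mult_div)
    qed
    have bg': "norm (g' t) \<le> 144 * B * cauchy_weight t" for t
    proof -
      have pos: "1 + t\<^sup>2 > 0" by (simp add: add_pos_nonneg)
      have "0 \<le> (\<bar>t\<bar> - 1)\<^sup>2" by simp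
      hence t2: "2 * \<bar>t\<bar> \<le> 1 + t\<^sup>2" by (simp add: power2_eq_square algebra_simps flip: abs_mult)
      have "norm (g' t) \<le> 2 * \<bar>t\<bar> * (16 * B / (1 + t\<^sup>2)\<^sup>2) + (1 + t\<^sup>2) * (128 * B / (1 + t\<^sup>2)\<^sup>2)"
        unfolding g'_def
        by (intro norm_triangle_mono; simp only: norm_mult n1 norm_of_real norm_numeral)
           (intro mult_left_mono b1 b2 mult_nonneg_nonneg; simp)+
      also have "\<dots> \<le> (1 + t\<^sup>2) * (16 * B / (1 + t\<^sup>2)\<^sup>2) + (1 + t\<^sup>2) * (128 * B / (1 + t\<^sup>2)\<^sup>2)"
        using t2 B by (intro add_right_mono mult_right_mono) auto
      also have "\<dots> = 144 * B * cauchy_weight t"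
        by (simp only: one_plus_square_mult_div)
      finally show ?thesis .
    qed
    have cg': "continuous_on UNIV g'"
      unfolding g'_def
      by (intro continuous_intros continuous_on_of_real_holomorphic hol1 hol2)
    have 1: "2 * \<i> * of_int j * circle_coeff \<phi> j = (LINT t|lborel. deriv \<phi> (of_real t) * cay (of_real t) powi (- j))"
      unfolding circle_coeff_def
    proof (rule coeff_by_parts[OF d0])
      have bb: "norm (\<phi> (of_real t)) \<le> 4 * B * cauchy_weight t" for t :: real
        using b0[of t] cauchy_weight_sq_le[of "4 * B" t] B by linarith
      show "((\<lambda>t::real. \<phi> (of_real t)) \<longlongrightarrow> 0) at_top" "((\<lambda>t::real. \<phi> (of_real t)) \<longlongrightarrow> 0) at_bot"
        by (rule tendsto_0_by_cauchy_weight[OF bb])+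
      show "continuous_on UNIV (\<lambda>t::real. deriv \<phi> (of_real t))"
        by (intro continuous_on_of_real_holomorphic hol1)
      thus "integrable lborel (\<lambda>t::real. deriv \<phi> (of_real t))"
        by (rule integrable_by_cauchy_weight(1)[OF _ order_trans[OF b1 cauchy_weight_sq_le]])
           (use B in simp)
      show "norm (\<phi> (of_real t)) \<le> B" for t :: real by (rule bc)
    qed
    also have "\<dots> = (LINT t|lborel. cauchy_weight t *\<^sub>R (g t * cay (of_real t) powi (- j)))"
    proof (intro Bochner_Integration.integral_cong refl)
      fix t :: real
      have "1 + complex_of_real t ^ 2 \<noteq> 0"
        using n1[of t] one_plus_square_pos(2)[of t] by (metis norm_zero)
      thus "deriv \<phi> (of_real t) * cay (of_real t) powi (- j) = cauchy_weight t *\<^sub>R (g t * cay (of_real t) powi (- j))"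
        by (simp add: g_def cauchy_weight_def scaleR_conv_of_real)
    qed
    finally have "2 * \<i> * of_int j * (2 * \<i> * of_int j * circle_coeff \<phi> j)
        = 2 * \<i> * of_int j * \<dots>" by simp
    also have "\<dots> = (LINT t|lborel. g' t * cay (of_real t) powi (- j))"
    proof (rule coeff_by_parts)
      show "(g has_vector_derivative g' t) (at t)" for t
      proof -
        have "((\<lambda>t::real. 1 + complex_of_real t ^ 2) has_vector_derivative 2 * of_real t) (at t)"
          by (rule has_vector_derivative_real_field) (auto intro!: derivative_eq_intros)
        thus ?thesis unfolding g_def
          by (intro has_vector_derivative_eq_rhs[OF has_vector_derivative_mult[OF _ d1]]) (auto simp: g'_def)
      qed
      show "integrable lborel g'" by (rule integrable_by_cauchy_weight(1)[OF cg' bg'])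
      show "(g \<longlongrightarrow> 0) at_top" "(g \<longlongrightarrow> 0) at_bot"
        by (rule tendsto_0_by_cauchy_weight[OF bg])+
      show "norm (g t) \<le> 16 * B" for t
      proof -
        have "16 * B * cauchy_weight t \<le> 16 * B * 1"
          using B by (intro mult_left_mono) auto
        thus ?thesis using bg[of t] by simp
      qed
    qed (rule cg')
    finally have eq: "2 * \<i> * of_int j * (2 * \<i> * of_int j * circle_coeff \<phi> j)
        = (LINT t|lborel. g' t * cay (of_real t) powi (- j))" .
    have "norm (2 * \<i> * of_int j * (2 * \<i> * of_int j * circle_coeff \<phi> j)) \<le> 144 * B * pi"
      unfolding eq
      by (rule integrable_by_cauchy_weight(2)) (auto intro!: continuous_intros cg' simp: norm_mult bg')
    hence "4 * of_int j ^ 2 * norm (circle_coeff \<phi> j) \<le> 144 * B * pi"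
      by (simp add: norm_mult power2_eq_square flip: abs_mult)
    hence a: "of_int j ^ 2 * norm (circle_coeff \<phi> j) \<le> 36 * B * pi" by linarith
    have "(1::real) \<le> of_int j ^ 2" using False by (simp add: int_one_le_iff_zero_less flip: of_int_power)
    hence "(1 + of_int j ^ 2) * norm (circle_coeff \<phi> j) \<le> (2 * of_int j ^ 2) * norm (circle_coeff \<phi> j)"
      by (intro mult_right_mono) auto
    also have "\<dots> \<le> 72 * B * pi" using a by linarith
    finally show ?thesis
      unfolding cauchy_weight_def by (simp add: field_simps add_pos_nonneg)
  qed
qed

lemma decays_wiener_le:
  assumes "decays \<phi> B"
  shows "wiener_le \<phi> (216 * pi\<^sup>2 * B)"
  unfolding wiener_le_def
proof (intro conjI allI impI)
  show "bounded_cont \<phi>" using assms by (rule decays_bounded_cont)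
  fix F :: "int set" assume F: "finite F"
  have B: "B \<ge> 0" using assms by (rule decays_imp_nonneg)
  have "(\<Sum>j\<in>F. norm (circle_coeff \<phi> j)) \<le> (\<Sum>j\<in>F. 72 * pi * B * cauchy_weight (0 - of_int j))"
    by (intro sum_mono order_trans[OF decays_coeff_bound[OF assms]]) (simp add: cauchy_weight_def)
  also have "\<dots> \<le> 72 * pi * B * (3 * pi)"
    unfolding sum_distrib_left[symmetric] using sum_translated_cauchy_weight[OF F, of 0] B
    by (intro mult_left_mono) auto
  finally show "(\<Sum>j\<in>F. norm (circle_coeff \<phi> j)) \<le> 216 * pi\<^sup>2 * B"
    by (simp add: power2_eq_square mult_ac)
qed

lemma one_plus_square_le_exp:
  assumes "(r::real) \<ge> 0"
  shows "(1 + r\<^sup>2)\<^sup>2 \<le> exp (4 * r)"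
proof -
  have "(1 + r\<^sup>2)\<^sup>2 \<le> ((1 + r)\<^sup>2)\<^sup>2"
    using assms by (intro power_mono) (auto simp: power2_eq_square algebra_simps)
  also have "\<dots> \<le> (exp r ^ 2) ^ 2"
    using assms by (intro power_mono) auto
  also have "\<dots> = exp (4 * r)" by (simp flip: exp_of_nat_mult power_mult)
  finally show ?thesis .
qed

lemma exp_linear_minus_square_le:
  fixes \<kappa> :: real
  assumes "\<kappa> > 0"
  shows "exp (c * r - \<kappa> * r\<^sup>2) \<le> exp (c\<^sup>2 / (4 * \<kappa>))"
proof -
  have "0 \<le> (c - 2 * \<kappa> * r)\<^sup>2 / (4 * \<kappa>)" using assms by simp
  also have "\<dots> = c\<^sup>2 / (4 * \<kappa>) - c * r + \<kappa> * r\<^sup>2"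
    using assms by (simp add: field_simps power2_eq_square)
  finally show ?thesis by simp
qed

lemma norm_gaussian_strip_le:
  assumes "y \<in> strip"
  shows "norm (exp (- y\<^sup>2)) \<le> 2 * exp (- (norm y)\<^sup>2)"
proof -
  have "\<bar>Im y\<bar> \<le> 1/2" using assms by (simp add: strip_def)
  hence "(Im y)\<^sup>2 \<le> (1/2)\<^sup>2" by (metis abs_le_square_iff abs_of_pos half_gt_zero zero_less_one)
  hence "(Im y)\<^sup>2 \<le> 1/4" by (simp add: power_divide)
  have "norm (exp (- y\<^sup>2)) = exp (2 * (Im y)\<^sup>2 - (norm y)\<^sup>2)"
    unfolding norm_exp_eq_Re by (simp add: cmod_power2) (simp add: power2_eq_square)
  also have "\<dots> \<le> exp (1/2 - (norm y)\<^sup>2)" using \<open>(Im y)\<^sup>2 \<le> 1/4\<close> by simp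
  also have "\<dots> = exp (1/2) * exp (- (norm y)\<^sup>2)" by (simp flip: exp_add)
  also have "exp (1/2::real) \<le> 2" using exp_bound_half[of "1/2::real"] by simp
  finally show ?thesis by (simp add: mult_right_mono)
qed

text \<open>
  The usual source of functions that satisfy \<open>decays\<close>: the Gaussian absorbs any factor whose quadratic
  growth has a constant below one. The \<open>+ 4\<close> pays for the factor \<open>(1 + r\<^sup>2)\<^sup>2 \<le> exp (4 * r)\<close>.
\<close>

lemma decays_gaussian:
  assumes "g holomorphic_on strip" "\<kappa> > 0" "A \<ge> 0"
    "\<And>y. y \<in> strip \<Longrightarrow> norm (g y) \<le> A * exp (c * norm y + (1 - \<kappa>) * (norm y)\<^sup>2)"
  shows "decays (\<lambda>y. g y * exp (- y\<^sup>2)) (2 * A * exp ((c + 4)\<^sup>2 / (4 * \<kappa>)))"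
  unfolding decays_def
proof (intro conjI ballI)
  show "(\<lambda>y. g y * exp (- y\<^sup>2)) holomorphic_on strip"
    by (intro holomorphic_intros assms)
  fix y assume y: "y \<in> strip"
  define r where "r = norm y"
  have r: "r \<ge> 0" by (simp add: r_def)
  have "norm (g y * exp (- y\<^sup>2)) \<le> (A * exp (c * r + (1 - \<kappa>) * r\<^sup>2)) * (2 * exp (- r\<^sup>2))"
    unfolding norm_mult r_def using assms(3)
    by (intro mult_mono assms(4) y norm_gaussian_strip_le) auto
  also have "\<dots> = 2 * A * exp (c * r - \<kappa> * r\<^sup>2)"
    by (simp add: algebra_simps flip: exp_add)
  also have "c * r - \<kappa> * r\<^sup>2 = ((c + 4) * r - \<kappa> * r\<^sup>2) - 4 * r"
    by (simp add: algebra_simps)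
  also have "2 * A * exp \<dots> = 2 * A * exp ((c + 4) * r - \<kappa> * r\<^sup>2) / exp (4 * r)"
    by (simp only: exp_diff times_divide_eq_right)
  also have "\<dots> \<le> 2 * A * exp ((c + 4)\<^sup>2 / (4 * \<kappa>)) / (1 + r\<^sup>2)\<^sup>2"
    using assms(2,3) one_plus_square_le_exp[OF r]
    by (intro frac_le mult_left_mono exp_linear_minus_square_le) (auto simp: add_pos_nonneg)
  finally show "norm (g y * exp (- y\<^sup>2)) \<le> 2 * A * exp ((c + 4)\<^sup>2 / (4 * \<kappa>)) / (1 + (norm y)\<^sup>2)\<^sup>2"
    by (simp add: r_def)
qed

lemma power_le_fact_exp:
  assumes "(x::real) \<ge> 0"
  shows "x ^ n \<le> fact n * exp x"
proof -
  have "sum (\<lambda>n. x ^ n /\<^sub>R fact n) {n} \<le> (\<Sum>n. x ^ n /\<^sub>R fact n)"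
    using assms by (intro sum_le_suminf summable_exp_generic) auto
  thus ?thesis by (simp add: exp_def field_simps)
qed

lemma poly_le_exp:
  fixes p :: "complex poly"
  obtains A where "A \<ge> 0" "\<And>y. norm (poly p y) \<le> A * exp (norm y)"
proof -
  have "\<exists>A\<ge>0. \<forall>y. norm (poly p y) \<le> A * exp (norm y)"
  proof -
    define A where "A = (\<Sum>i\<le>degree p. norm (coeff p i) * fact i)"
    have "norm (poly p y) \<le> A * exp (norm y)" for y
    proof -
      have "norm (poly p y) \<le> (\<Sum>i\<le>degree p. norm (coeff p i * y ^ i))"
        unfolding poly_altdef by (rule norm_sum)
      also have "\<dots> \<le> (\<Sum>i\<le>degree p. norm (coeff p i) * fact i * exp (norm y))"
      proof (intro sum_mono)
        fix i
        have "norm y ^ i / fact i \<le> exp (norm y)"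
          using power_le_fact_exp[of "norm y" i] by (simp add: divide_le_eq mult.commute)
        hence "norm (coeff p i) * norm y ^ i \<le> norm (coeff p i) * (fact i * exp (norm y))"
          by (intro mult_left_mono) (simp_all add: divide_le_eq mult.commute)
        thus "norm (coeff p i * y ^ i) \<le> norm (coeff p i) * fact i * exp (norm y)"
          by (simp add: norm_mult norm_power mult.assoc)
      qed
      finally show ?thesis by (simp add: A_def sum_distrib_right)
    qed
    moreover have "A \<ge> 0" by (auto simp: A_def intro!: sum_nonneg)
    ultimately show ?thesis by blast
  qed
  thus ?thesis using that by blast
qed

lemma decays_poly_gaussian:
  obtains B where "decays (\<lambda>y. poly p y * exp (- y\<^sup>2)) B"
proof -
  obtain A where A: "A \<ge> 0" "\<And>y. norm (poly p y) \<le> A * exp (norm y)"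
    using poly_le_exp by blast
  have "decays (\<lambda>y. poly p y * exp (- y\<^sup>2)) (2 * A * exp ((1 + 4)\<^sup>2 / (4 * 1)))"
    by (rule decays_gaussian) (use A in \<open>auto intro!: holomorphic_intros\<close>)
  thus ?thesis by (rule that)
qed

text \<open>
  Every integration by parts turns a polynomial times the Gaussian into another one, so it can be
  repeated any number of times.
\<close>

lemma poly_gaussian_coeff_rapid:
  "\<exists>C. \<forall>j. \<bar>real_of_int j\<bar> ^ k * norm (circle_coeff (\<lambda>y. poly p y * exp (- y\<^sup>2)) j) \<le> C"
proof (induction k arbitrary: p)
  case 0
  obtain B where B: "decays (\<lambda>y. poly p y * exp (- y\<^sup>2)) B" by (rule decays_poly_gaussian)
  have "norm (circle_coeff (\<lambda>y. poly p y * exp (- y\<^sup>2)) j) \<le> 72 * pi * B * 1" for j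
    by (rule order_trans[OF decays_coeff_bound[OF B] mult_left_mono])
       (use decays_imp_nonneg[OF B] in auto)
  thus ?case by (intro exI[of _ "72 * pi * B * 1"]) simp
next
  case (Suc k)
  define q where "q = pderiv p - [:0, 2:] * p"
  obtain C where C: "\<And>j. \<bar>real_of_int j\<bar> ^ k * norm (circle_coeff (\<lambda>y. poly ([:1, 0, 1:] * q) y * exp (- y\<^sup>2)) j) \<le> C"
    using Suc.IH by blast
  obtain B where B: "decays (\<lambda>y. poly p y * exp (- y\<^sup>2)) B" by (rule decays_poly_gaussian)
  obtain B' where B': "decays (\<lambda>y. poly q y * exp (- y\<^sup>2)) B'" by (rule decays_poly_gaussian)
  have bnd: "norm (\<phi> (of_real t)) \<le> B * cauchy_weight t" if "decays \<phi> B" for \<phi> B and t :: real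
  proof -
    have "norm (\<phi> (of_real t)) \<le> B / (1 + t\<^sup>2)\<^sup>2"
      by (rule decays_bound_real[OF that])
    thus ?thesis using cauchy_weight_sq_le[OF decays_imp_nonneg[OF that], of t] by simp
  qed
  have eq: "2 * \<i> * of_int j * circle_coeff (\<lambda>y. poly p y * exp (- y\<^sup>2)) j =
      circle_coeff (\<lambda>y. poly ([:1, 0, 1:] * q) y * exp (- y\<^sup>2)) j" for j
  proof -
    have "2 * \<i> * of_int j * circle_coeff (\<lambda>y. poly p y * exp (- y\<^sup>2)) j =
      (LINT t|lborel. (poly q (of_real t) * exp (- (of_real t)\<^sup>2)) * cay (of_real t) powi (- j))"
      unfolding circle_coeff_def
    proof (rule coeff_by_parts)
      show "((\<lambda>t. poly p (of_real t) * exp (- (of_real t)\<^sup>2)) has_vector_derivative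
         poly q (of_real t) * exp (- (of_real t)\<^sup>2)) (at t)" for t :: real
        by (rule has_vector_derivative_real_field)
           (auto intro!: derivative_eq_intros poly_DERIV simp: q_def algebra_simps)
      show c: "continuous_on UNIV (\<lambda>t::real. poly q (of_real t) * exp (- (of_real t)\<^sup>2))"
        by (intro continuous_intros)
      show "integrable lborel (\<lambda>t::real. poly q (of_real t) * exp (- (of_real t)\<^sup>2))"
        by (rule integrable_by_cauchy_weight(1)[OF c bnd[OF B']])
      show "((\<lambda>t. poly p (complex_of_real t) * exp (- (of_real t)\<^sup>2)) \<longlongrightarrow> 0) at_top"
        "((\<lambda>t. poly p (complex_of_real t) * exp (- (of_real t)\<^sup>2)) \<longlongrightarrow> 0) at_bot"
        by (rule tendsto_0_by_cauchy_weight[OF bnd[OF B]])+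
      show "norm (poly p (of_real t) * exp (- (of_real t)\<^sup>2)) \<le> B" for t :: real
        by (rule order_trans[OF bnd[OF B]])
           (use decays_imp_nonneg[OF B] in \<open>auto simp: mult_left_le\<close>)
    qed
    also have "\<dots> = circle_coeff (\<lambda>y. poly ([:1, 0, 1:] * q) y * exp (- y\<^sup>2)) j"
      unfolding circle_coeff_def
    proof (intro Bochner_Integration.integral_cong refl)
      fix t :: real
      have "complex_of_real (cauchy_weight t) * (1 + (of_real t)\<^sup>2) = of_real (cauchy_weight t * (1 + t\<^sup>2))"
        by simp
      also have "cauchy_weight t * (1 + t\<^sup>2) = 1" by (simp add: cauchy_weight_def)
      finally have w: "complex_of_real (cauchy_weight t) * (1 + (of_real t)\<^sup>2) = 1" by simp
      have "poly ([:1, 0, 1:] * q) (of_real t) = (1 + (of_real t)\<^sup>2) * poly q (of_real t)"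
        by (simp add: power2_eq_square algebra_simps)
      thus "poly q (of_real t) * exp (- (of_real t)\<^sup>2) * cay (of_real t) powi (- j) = cauchy_weight t *\<^sub>R
          (poly ([:1, 0, 1:] * q) (of_real t) * exp (- (of_real t)\<^sup>2) * cay (of_real t) powi (- j))"
        unfolding scaleR_conv_of_real by (simp only: mult.assoc[symmetric] w mult_1_left)
    qed
    finally show ?thesis .
  qed
  have "\<bar>real_of_int j\<bar> ^ Suc k * norm (circle_coeff (\<lambda>y. poly p y * exp (- y\<^sup>2)) j) \<le> C" for j
  proof -
    have h: "2 * \<bar>real_of_int j\<bar> * norm (circle_coeff (\<lambda>y. poly p y * exp (- y\<^sup>2)) j) =
      norm (circle_coeff (\<lambda>y. poly ([:1, 0, 1:] * q) y * exp (- y\<^sup>2)) j)"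
      unfolding eq[symmetric] by (simp add: norm_mult)
    have "2 * (\<bar>real_of_int j\<bar> ^ Suc k * norm (circle_coeff (\<lambda>y. poly p y * exp (- y\<^sup>2)) j)) =
      \<bar>real_of_int j\<bar> ^ k * norm (circle_coeff (\<lambda>y. poly ([:1, 0, 1:] * q) y * exp (- y\<^sup>2)) j)"
      by (simp only: power_Suc h[symmetric]) (simp only: mult_ac)
    with C[of j] have "2 * (\<bar>real_of_int j\<bar> ^ Suc k * norm (circle_coeff (\<lambda>y. poly p y * exp (- y\<^sup>2)) j)) \<le> C"
      by linarith
    moreover have "0 \<le> \<bar>real_of_int j\<bar> ^ Suc k * norm (circle_coeff (\<lambda>y. poly p y * exp (- y\<^sup>2)) j)" by simp
    ultimately show ?thesis by linarith
  qed
  thus ?case by blast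
qed

section \<open>Approximation by polynomials times the Gaussian on the circle\<close>

definition gauss :: "complex \<Rightarrow> complex" where
  "gauss y = exp (- y\<^sup>2)"

lemma wiener_leI:
  assumes "bounded_cont \<phi>" "\<And>F. finite F \<Longrightarrow> (\<Sum>j\<in>F. norm (circle_coeff \<phi> j)) \<le> B"
  shows "wiener_le \<phi> B"
  unfolding wiener_le_def using assms by (intro conjI allI impI)

lemma wiener_le_bounded_cont: "wiener_le \<phi> B \<Longrightarrow> bounded_cont \<phi>"
  unfolding wiener_le_def by (rule conjunct1)

lemma wiener_leD:
  assumes "wiener_le \<phi> B" "finite F"
  shows "(\<Sum>j\<in>F. norm (circle_coeff \<phi> j)) \<le> B"
proof -
  have "\<forall>F. finite F \<longrightarrow> (\<Sum>j\<in>F. norm (circle_coeff \<phi> j)) \<le> B"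
    using assms(1) unfolding wiener_le_def by (rule conjunct2)
  thus ?thesis using assms(2) by blast
qed

lemma wiener_le_nonneg: "wiener_le \<phi> B \<Longrightarrow> B \<ge> 0"
  using wiener_leD[of \<phi> B "{}"] by simp

lemma wiener_le_mono:
  assumes "wiener_le \<phi> B" "B \<le> C"
  shows "wiener_le \<phi> C"
  by (rule wiener_leI[OF wiener_le_bounded_cont[OF assms(1)] order_trans[OF wiener_leD[OF assms(1)] assms(2)]])

lemma wiener_le_cong:
  assumes "\<And>t::real. \<phi> (of_real t) = \<psi> (of_real t)"
  shows "wiener_le \<phi> B \<longleftrightarrow> wiener_le \<psi> B"
  unfolding wiener_le_def bounded_cont_def circle_coeff_def assms ..

lemma wiener_le_add:
  assumes "wiener_le \<phi> B" "wiener_le \<psi> C"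
  shows "wiener_le (\<lambda>y. \<phi> y + \<psi> y) (B + C)"
proof (rule wiener_leI)
  show "bounded_cont (\<lambda>y. \<phi> y + \<psi> y)"
    by (rule bounded_cont_add[OF assms[THEN wiener_le_bounded_cont]])
  fix F :: "int set" assume F: "finite F"
  have "(\<Sum>j\<in>F. norm (circle_coeff (\<lambda>y. \<phi> y + \<psi> y) j)) \<le> (\<Sum>j\<in>F. norm (circle_coeff \<phi> j) + norm (circle_coeff \<psi> j))"
    by (intro sum_mono) (simp add: coeff_add assms[THEN wiener_le_bounded_cont] norm_triangle_ineq)
  also have "\<dots> \<le> B + C"
    unfolding sum.distrib by (rule add_mono[OF assms[THEN wiener_leD[OF _ F]]])
  finally show "(\<Sum>j\<in>F. norm (circle_coeff (\<lambda>y. \<phi> y + \<psi> y) j)) \<le> B + C" .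
qed

lemma wiener_le_cmult:
  assumes "wiener_le \<phi> B"
  shows "wiener_le (\<lambda>y. c * \<phi> y) (norm c * B)"
proof (rule wiener_leI)
  show "bounded_cont (\<lambda>y. c * \<phi> y)"
    by (rule bounded_cont_mult[OF bounded_cont_const wiener_le_bounded_cont[OF assms]])
  fix F :: "int set" assume F: "finite F"
  show "(\<Sum>j\<in>F. norm (circle_coeff (\<lambda>y. c * \<phi> y) j)) \<le> norm c * B"
    unfolding coeff_cmult norm_mult sum_distrib_left[symmetric]
    by (rule mult_left_mono[OF wiener_leD[OF assms F] norm_ge_zero])
qed

lemma wiener_le_diff:
  assumes "wiener_le \<phi> B" "wiener_le \<psi> C"
  shows "wiener_le (\<lambda>y. \<phi> y - \<psi> y) (B + C)"
  using wiener_le_add[OF assms(1) wiener_le_cmult[OF assms(2), of "-1"]] by simp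

lemma wiener_le_cay_power_mult:
  assumes "wiener_le \<phi> B"
  shows "wiener_le (\<lambda>y. cay y ^ n * \<phi> y) B"
proof (rule wiener_leI)
  show "bounded_cont (\<lambda>y. cay y ^ n * \<phi> y)"
    by (rule bounded_cont_mult[OF bounded_cont_cay_power wiener_le_bounded_cont[OF assms]])
  fix F :: "int set" assume F: "finite F"
  have "(\<Sum>j\<in>F. norm (circle_coeff (\<lambda>y. cay y ^ n * \<phi> y) j)) = (\<Sum>j\<in>(\<lambda>j. j - int n) ` F. norm (circle_coeff \<phi> j))"
    by (subst sum.reindex) (auto simp: inj_on_def coeff_cay_power_mult)
  also have "\<dots> \<le> B" by (rule wiener_leD[OF assms]) (use F in simp)
  finally show "(\<Sum>j\<in>F. norm (circle_coeff (\<lambda>y. cay y ^ n * \<phi> y) j)) \<le> B" .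
qed

lemma wiener_le_zero: "B \<ge> 0 \<Longrightarrow> wiener_le (\<lambda>y. 0) B"
  by (rule wiener_leI[OF bounded_cont_const]) (simp add: circle_coeff_def)

lemma wiener_le_poly_mult:
  obtains C where "C \<ge> 0"
    "\<And>\<phi> B. wiener_le \<phi> B \<Longrightarrow> wiener_le (\<lambda>y. poly Q (cay y) * \<phi> y) (C * B)"
proof -
  have "\<exists>C\<ge>0. \<forall>\<phi> B. wiener_le \<phi> B \<longrightarrow> wiener_le (\<lambda>y. poly Q (cay y) * \<phi> y) (C * B)"
  proof (induction Q)
    case 0
    thus ?case by (intro exI[of _ 0]) (auto simp: wiener_le_zero)
  next
    case (pCons a Q)
    then obtain C where C: "C \<ge> 0" "\<And>\<phi> B. wiener_le \<phi> B \<Longrightarrow> wiener_le (\<lambda>y. poly Q (cay y) * \<phi> y) (C * B)"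
      by blast
    have "wiener_le (\<lambda>y. poly (pCons a Q) (cay y) * \<phi> y) ((norm a + C) * B)" if "wiener_le \<phi> B" for \<phi> B
      using wiener_le_add[OF wiener_le_cmult[OF that, of a] wiener_le_cay_power_mult[OF C(2)[OF that], of 1]]
      by (simp add: algebra_simps)
    thus ?case using C(1) by (intro exI[of _ "norm a + C"]) auto
  qed
  thus ?thesis using that by blast
qed

text \<open>
  Besides the function, the value \<open>P 0\<close> of the approximating polynomials is recorded. It behaves as the
  value of \<open>\<psi> / gauss\<close> at the point \<open>y = \<i>\<close>, where \<open>cay y = 0\<close>.
\<close>

definition approximable :: "(complex \<Rightarrow> complex) \<Rightarrow> complex \<Rightarrow> bool" where
  "approximable \<psi> c \<longleftrightarrow> (\<forall>\<epsilon>>0. \<exists>P. poly P 0 = c \<and>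
      wiener_le (\<lambda>y. \<psi> y - poly P (cay y) * gauss y) \<epsilon>)"

lemma approximable_gauss: "approximable gauss 1"
  unfolding approximable_def by (auto intro!: exI[of _ 1] wiener_le_zero)

lemma approximable_limit:
  assumes "\<And>\<epsilon>. \<epsilon> > 0 \<Longrightarrow> \<exists>\<psi>'. approximable \<psi>' c \<and> wiener_le (\<lambda>y. \<psi> y - \<psi>' y) \<epsilon>"
  shows "approximable \<psi> c"
  unfolding approximable_def
proof (intro allI impI)
  fix \<epsilon> :: real assume "\<epsilon> > 0"
  then obtain \<psi>' where 1: "approximable \<psi>' c" "wiener_le (\<lambda>y. \<psi> y - \<psi>' y) (\<epsilon>/2)"
    using assms[of "\<epsilon>/2"] by auto
  then obtain P where "poly P 0 = c" "wiener_le (\<lambda>y. \<psi>' y - poly P (cay y) * gauss y) (\<epsilon>/2)"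
    using half_gt_zero[OF \<open>\<epsilon> > 0\<close>] unfolding approximable_def by blast
  with wiener_le_add[OF 1(2) this(2)]
  show "\<exists>P. poly P 0 = c \<and> wiener_le (\<lambda>y. \<psi> y - poly P (cay y) * gauss y) \<epsilon>"
    by (intro exI[of _ P]) simp
qed

lemma approximable_add:
  assumes "approximable \<phi> c" "approximable \<psi> d"
  shows "approximable (\<lambda>y. \<phi> y + \<psi> y) (c + d)"
  unfolding approximable_def
proof (intro allI impI)
  fix \<epsilon> :: real assume "\<epsilon> > 0"
  hence "\<epsilon>/2 > 0" by simp
  with assms obtain P Q where
    "poly P 0 = c" "wiener_le (\<lambda>y. \<phi> y - poly P (cay y) * gauss y) (\<epsilon>/2)"
    "poly Q 0 = d" "wiener_le (\<lambda>y. \<psi> y - poly Q (cay y) * gauss y) (\<epsilon>/2)"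
    unfolding approximable_def by blast
  with wiener_le_add[OF this(2,4)]
  show "\<exists>P. poly P 0 = c + d \<and> wiener_le (\<lambda>y. \<phi> y + \<psi> y - poly P (cay y) * gauss y) \<epsilon>"
    by (intro exI[of _ "P + Q"]) (simp add: algebra_simps)
qed

lemma approximable_poly_cay_mult:
  assumes "approximable \<psi> c"
  shows "approximable (\<lambda>y. poly Q (cay y) * \<psi> y) (poly Q 0 * c)"
  unfolding approximable_def
proof (intro allI impI)
  fix \<epsilon> :: real assume "\<epsilon> > 0"
  obtain C where C: "C \<ge> 0" "\<And>\<phi> B. wiener_le \<phi> B \<Longrightarrow> wiener_le (\<lambda>y. poly Q (cay y) * \<phi> y) (C * B)"
    using wiener_le_poly_mult by blast
  have "\<epsilon> / (C + 1) > 0" using \<open>\<epsilon> > 0\<close> C(1) by simp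
  then obtain P where P: "poly P 0 = c" "wiener_le (\<lambda>y. \<psi> y - poly P (cay y) * gauss y) (\<epsilon> / (C + 1))"
    using assms unfolding approximable_def by blast
  have "C * (\<epsilon> / (C + 1)) \<le> \<epsilon>" using \<open>\<epsilon> > 0\<close> C(1) by (simp add: divide_simps algebra_simps)
  from wiener_le_mono[OF C(2)[OF P(2)] this]
  show "\<exists>P. poly P 0 = poly Q 0 * c \<and> wiener_le (\<lambda>y. poly Q (cay y) * \<psi> y - poly P (cay y) * gauss y) \<epsilon>"
    using P(1) by (intro exI[of _ "Q * P"]) (simp add: algebra_simps)
qed

lemma approximable_cmult: "approximable \<psi> c \<Longrightarrow> approximable (\<lambda>y. a * \<psi> y) (a * c)"
  using approximable_poly_cay_mult[of \<psi> c "[:a:]"] by simp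

text \<open>
  Multiplied by \<open>1 / (1 - x)\<^sup>2\<close>, this compares \<open>1 / (1 - x)\<close> with the \<open>n\<close>-th Cesaro mean of its power series. The
  error is \<open>1 / n\<close> times a function that stays bounded in the Wiener norm after multiplication by a
  function with a sufficiently high zero at \<open>1\<close>.
\<close>

lemma cesaro_geometric:
  fixes n :: nat
  assumes "n > 0"
  obtains P :: "complex poly" where "poly P 0 = 1"
    "\<And>x. (1 - x) * ((1 - x) * poly P x) = (1 - x) - (x - x ^ Suc n) / of_nat n"
proof -
  define P :: "complex poly" where "P = smult (1 / of_nat n) (\<Sum>l\<in>{1..n}. \<Sum>k<l. monom 1 k)"
  have P0: "poly P 0 = 1"
  proof -
    have "(\<Sum>k<l. poly (monom 1 k) 0) = (1::complex)" if "l \<ge> 1" for l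
    proof -
      have "(\<Sum>k<l. poly (monom 1 k) (0::complex)) = (\<Sum>k<l. if k = 0 then 1 else 0)"
        by (intro sum.cong) (auto simp: poly_monom)
      thus ?thesis using that by simp
    qed
    thus ?thesis using assms by (simp add: P_def poly_sum)
  qed
  have g: "(1 - x) * (\<Sum>k<l. x ^ k) = 1 - x ^ l" for x :: complex and l :: nat
    by (rule one_diff_power_eq[symmetric])
  have "(1 - x) * ((1 - x) * poly P x) = (1 - x) - (x - x ^ Suc n) / of_nat n" for x
  proof -
    have "(1 - x) * poly P x = (\<Sum>l\<in>{1..n}. (1 - x) * (\<Sum>k<l. x ^ k)) / of_nat n"
      by (simp add: P_def poly_sum poly_monom flip: sum_distrib_left)
    also have "\<dots> = (of_nat n - (\<Sum>l\<in>{1..n}. x ^ l)) / of_nat n"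
      by (simp only: g) (simp add: sum_subtractf)
    finally have "(1 - x) * poly P x = 1 - (\<Sum>l\<in>{1..n}. x ^ l) / of_nat n"
      using assms by (simp add: diff_divide_distrib)
    hence "(1 - x) * ((1 - x) * poly P x) = (1 - x) - ((1 - x) * (\<Sum>l\<in>{1..n}. x ^ l)) / of_nat n"
      by (simp only: right_diff_distrib mult_1_right times_divide_eq_right)
    moreover have "(\<Sum>l\<in>{1..n}. x ^ l) = x * (\<Sum>l<n. x ^ l)"
      unfolding sum_distrib_left
      by (rule sum.reindex_bij_witness[of _ Suc "\<lambda>l. l - 1"]) (auto simp flip: power_Suc)
    hence "(1 - x) * (\<Sum>l\<in>{1..n}. x ^ l) = x * ((1 - x) * (\<Sum>l<n. x ^ l))" by (simp add: mult_ac)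
    hence "(1 - x) * (\<Sum>l\<in>{1..n}. x ^ l) = x - x ^ Suc n" by (simp only: g) (simp add: algebra_simps)
    ultimately show ?thesis by simp
  qed
  thus ?thesis using P0 that by blast
qed

lemma one_minus_cay: "(1 - cay (of_real t)) * ((1 - \<i> * of_real t) / 2) = 1"
proof -
  have "1 - cay (of_real t) = 2 * \<i> / (of_real t + \<i>)"
    by (simp add: cay_def diff_divide_eq_iff)
  moreover have "(1 - \<i> * of_real t) = - \<i> * (of_real t + \<i>)" by (simp add: algebra_simps)
  ultimately have "(1 - cay (of_real t)) * ((1 - \<i> * of_real t) / 2)
      = (2 * \<i> / (of_real t + \<i>)) * (- \<i> * (of_real t + \<i>) / 2)" by (simp only:)
  also have "\<dots> = 1" by simp
  finally show ?thesis .
qed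

text \<open>
  The coordinate \<open>y\<close> is an affine function of \<open>v = (1 - \<i> * y) / 2 = 1 / (1 - cay y)\<close>, so it suffices to multiply by
  \<open>v\<close>. This is done in the limit by the Cesaro means of \<open>1 / (1 - z)\<close>: the error is \<open>(z - z ^ Suc n) / n\<close> times
  \<open>v\<^sup>2 * p * gauss\<close>, whose Wiener norm is finite. All these means take the value \<open>1\<close> at \<open>z = 0\<close>, just as
  \<open>v\<close> does at \<open>y = \<i>\<close>.
\<close>

lemma approximable_poly:
  "approximable (\<lambda>y. poly p y * gauss y) (poly p \<i>)"
proof (induction p)
  case 0
  show ?case using approximable_cmult[OF approximable_gauss, of 0] by simp
next
  case (pCons a p)
  (* v takes the value 1 at \<i> *)
  define v :: "complex poly" where "v = [:1/2, - \<i>/2:]"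
  define c where "c = poly p \<i>"
  have v: "poly v y = (1 - \<i> * y) / 2" for y by (simp add: v_def field_simps)
  have 1: "approximable (\<lambda>y. poly (v * p) y * gauss y) c"
  proof (rule approximable_limit)
    fix \<epsilon> :: real assume \<epsilon>: "\<epsilon> > 0"
    obtain B where B: "decays (\<lambda>y. poly (v\<^sup>2 * p) y * exp (- y\<^sup>2)) B" by (rule decays_poly_gaussian)
    define K where "K = 216 * pi\<^sup>2 * B"
    have K: "wiener_le (\<lambda>y. poly (v\<^sup>2 * p) y * gauss y) K"
      using decays_wiener_le[OF B] by (simp add: K_def gauss_def)
    obtain m :: nat where "2 * K / \<epsilon> < real m" using reals_Archimedean2 by blast
    then obtain n :: nat where n: "real n > 2 * K / \<epsilon>" "n > 0"
      by (intro that[of "Suc m"]) auto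
    obtain P where P: "poly P 0 = (1::complex)"
      "\<And>x. (1 - x) * ((1 - x) * poly P x) = (1 - x) - (x - x ^ Suc n) / of_nat n"
      using cesaro_geometric[OF n(2)] by blast
    have ap: "approximable (\<lambda>y. poly P (cay y) * (poly p y * gauss y)) c"
      using approximable_poly_cay_mult[OF pCons.IH, of P] P(1) by (simp add: c_def)
    have e: "wiener_le (\<lambda>y. 1 / of_nat n * (cay y ^ 1 * (poly (v\<^sup>2 * p) y * gauss y) - cay y ^ Suc n * (poly (v\<^sup>2 * p) y * gauss y)))
       (norm (1 / of_nat n :: complex) * (K + K))"
      by (intro wiener_le_cmult wiener_le_diff wiener_le_cay_power_mult K)
    have "norm (1 / of_nat n :: complex) * (K + K) \<le> \<epsilon>"
      using n \<epsilon> by (simp add: norm_divide field_simps)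
    note e' = wiener_le_mono[OF e this]
    have "wiener_le (\<lambda>y. poly (v * p) y * gauss y - poly P (cay y) * (poly p y * gauss y)) \<epsilon>"
    proof (subst wiener_le_cong)
      show "wiener_le (\<lambda>y. 1 / of_nat n * (cay y ^ 1 * (poly (v\<^sup>2 * p) y * gauss y) - cay y ^ Suc n * (poly (v\<^sup>2 * p) y * gauss y))) \<epsilon>"
        by (rule e')
      fix t :: real
      define z where "z = cay (of_real t)"
      define V where "V = poly v (of_real t)"
      have zv: "(1 - z) * V = 1" unfolding z_def V_def v by (rule one_minus_cay)
      have "V - poly P z = (V * ((1 - z) * V)) - ((1 - z) * V) * ((1 - z) * V) * poly P z" by (simp add: zv)
      also have "\<dots> = V\<^sup>2 * ((1 - z) - (1 - z) * ((1 - z) * poly P z))"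
        by (simp add: algebra_simps power2_eq_square)
      also have "\<dots> = V\<^sup>2 * ((z - z ^ Suc n) / of_nat n)" by (simp only: P(2)) simp
      finally have V: "V - poly P z = V\<^sup>2 * ((z - z ^ Suc n) / of_nat n)" .
      have "poly (v * p) (of_real t) * gauss (of_real t) - poly P (cay (of_real t)) * (poly p (of_real t) * gauss (of_real t))
         = (V - poly P z) * (poly p (of_real t) * gauss (of_real t))"
        by (simp add: V_def z_def algebra_simps)
      also have "\<dots> = 1 / of_nat n * (z ^ 1 * (V\<^sup>2 * poly p (of_real t) * gauss (of_real t)) - z ^ Suc n * (V\<^sup>2 * poly p (of_real t) * gauss (of_real t)))"
        unfolding V by (simp add: diff_divide_distrib algebra_simps)
      finally show "poly (v * p) (of_real t) * gauss (of_real t) - poly P (cay (of_real t)) * (poly p (of_real t) * gauss (of_real t))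
        = 1 / of_nat n * (cay (of_real t) ^ 1 * (poly (v\<^sup>2 * p) (of_real t) * gauss (of_real t)) - cay (of_real t) ^ Suc n * (poly (v\<^sup>2 * p) (of_real t) * gauss (of_real t)))"
        by (simp add: V_def z_def)
    qed
    thus "\<exists>\<psi>'. approximable \<psi>' c \<and> wiener_le (\<lambda>y. poly (v * p) y * gauss y - \<psi>' y) \<epsilon>"
      using ap by blast
  qed
  have "approximable (\<lambda>y. a * gauss y + (2 * \<i> * (poly (v * p) y * gauss y) + (- \<i>) * (poly p y * gauss y)))
     (a * 1 + (2 * \<i> * c + (- \<i>) * c))"
    by (intro approximable_add approximable_cmult approximable_gauss 1) (use pCons.IH in \<open>simp add: c_def\<close>)
  moreover have "(\<lambda>y. a * gauss y + (2 * \<i> * (poly (v * p) y * gauss y) + (- \<i>) * (poly p y * gauss y))) =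
     (\<lambda>y. poly (pCons a p) y * gauss y)"
    by (auto simp: v field_simps)
  ultimately show ?case by (simp add: c_def algebra_simps)
qed

definition exp_remainder :: "nat \<Rightarrow> complex \<Rightarrow> complex" where
  "exp_remainder K t = exp t - (\<Sum>k<K. t ^ k / fact k)"

text \<open>
  In the tail of the series each term gains the factor \<open>\<theta> ^ k / \<theta> ^ K \<ge> 1\<close>.
\<close>

lemma exp_remainder_bound:
  assumes "\<theta> \<ge> 1"
  shows "norm (exp_remainder K t) \<le> exp (\<theta> * norm t) / \<theta> ^ K"
proof -
  have s: "(\<lambda>k. t ^ k / fact k) sums exp t"
    using exp_converges[of t] by (simp add: scaleR_conv_of_real field_simps)
  have s1: "(\<lambda>k. t ^ (k + K) / fact (k + K)) sums exp_remainder K t"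
    using sums_split_initial_segment[OF s, of K] by (simp add: exp_remainder_def)
  have s2: "(\<lambda>k. (\<theta> * norm t) ^ k / fact k) sums exp (\<theta> * norm t)"
    using exp_converges[of "\<theta> * norm t"] by (simp add: field_simps)
  have s3: "(\<lambda>k. (\<theta> * norm t) ^ (k + K) / fact (k + K)) sums (exp (\<theta> * norm t) - (\<Sum>k<K. (\<theta> * norm t) ^ k / fact k))"
    using sums_split_initial_segment[OF s2, of K] by simp
  have s4: "(\<lambda>k. (\<theta> * norm t) ^ (k + K) / fact (k + K) / \<theta> ^ K) sums ((exp (\<theta> * norm t) - (\<Sum>k<K. (\<theta> * norm t) ^ k / fact k)) / \<theta> ^ K)"
    by (rule sums_divide[OF s3])
  have le: "norm (t ^ (k + K) / fact (k + K)) \<le> (\<theta> * norm t) ^ (k + K) / fact (k + K) / \<theta> ^ K" for k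
  proof -
    have "\<theta> ^ K \<le> \<theta> ^ (k + K)" using assms by (intro power_increasing) auto
    hence "norm t ^ (k + K) * \<theta> ^ K \<le> (\<theta> * norm t) ^ (k + K)"
      unfolding power_mult_distrib mult.commute[of "norm t ^ _"] by (intro mult_right_mono) auto
    thus ?thesis using assms by (simp add: norm_divide norm_power field_simps)
  qed
  have sn: "summable (\<lambda>k. norm (t ^ (k + K) / fact (k + K)))"
    by (rule summable_comparison_test'[OF sums_summable[OF s4], of 0]) (use le in auto)
  have "norm (exp_remainder K t) \<le> (\<Sum>k. norm (t ^ (k + K) / fact (k + K)))"
    unfolding sums_unique[OF s1] by (rule summable_norm[OF sn])
  also have "\<dots> \<le> (\<Sum>k. (\<theta> * norm t) ^ (k + K) / fact (k + K) / \<theta> ^ K)"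
    by (intro suminf_le le sn sums_summable[OF s4])
  also have "\<dots> = (exp (\<theta> * norm t) - (\<Sum>k<K. (\<theta> * norm t) ^ k / fact k)) / \<theta> ^ K"
    using sums_unique[OF s4] by simp
  also have "\<dots> \<le> exp (\<theta> * norm t) / \<theta> ^ K"
    using assms by (intro divide_right_mono) (auto intro!: sum_nonneg)
  finally show ?thesis .
qed

text \<open>
  The Taylor polynomials of the exponential converge in the Wiener norm, because \<open>\<theta> * \<sigma> < 1\<close> for some
  \<open>\<theta> > 1\<close>: the Gaussian still dominates \<open>exp (\<theta> * \<bar>q\<bar>)\<close> while the remainder gains the factor \<open>1 / \<theta> ^ K\<close>.
\<close>

lemma approximable_exp:
  assumes q: "\<And>y. norm (poly q y) \<le> a + c * norm y + \<sigma> * (norm y)\<^sup>2" and \<sigma>: "0 \<le> \<sigma>" "\<sigma> < 1"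
  shows "approximable (\<lambda>y. exp (poly q y) * gauss y) (exp (poly q \<i>))"
proof (rule approximable_limit)
  fix \<epsilon> :: real assume \<epsilon>: "\<epsilon> > 0"
  (* this gives theta > 1 and theta * sigma = 2 * sigma / (1 + sigma) < 1 *)
  define \<theta> where "\<theta> = 2 / (1 + \<sigma>)"
  define \<kappa> where "\<kappa> = 1 - \<theta> * \<sigma>"
  have \<theta>: "\<theta> > 1" using \<sigma> by (simp add: \<theta>_def)
  have \<kappa>: "\<kappa> > 0" using \<sigma> by (simp add: \<kappa>_def \<theta>_def field_simps)
  define S where "S K = (\<Sum>k<K. smult (1 / fact k) (q ^ k))" for K
  have S: "exp (poly q y) - poly (S K) y = exp_remainder K (poly q y)" for K y
    by (simp add: S_def exp_remainder_def poly_sum poly_power)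
  obtain Bg where Bg: "decays (\<lambda>y. poly 1 y * exp (- y\<^sup>2)) Bg" by (rule decays_poly_gaussian)
  have wg: "wiener_le gauss (216 * pi\<^sup>2 * Bg)"
    using decays_wiener_le[OF Bg] by (simp add: gauss_def [abs_def])
  define A where "A K = 216 * pi\<^sup>2 * (2 * (exp (\<theta> * a) / \<theta> ^ K) * exp ((\<theta> * c + 4)\<^sup>2 / (4 * \<kappa>)))
      + exp (\<theta> * norm (poly q \<i>)) / \<theta> ^ K * (216 * pi\<^sup>2 * Bg)" for K :: nat
  have "A \<longlonglongrightarrow> 216 * pi\<^sup>2 * (2 * 0 * exp ((\<theta> * c + 4)\<^sup>2 / (4 * \<kappa>))) + 0 * (216 * pi\<^sup>2 * Bg)"
    unfolding A_def using \<theta>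
    by (intro tendsto_intros LIMSEQ_divide_realpow_zero) auto
  hence "eventually (\<lambda>K. A K < \<epsilon>) sequentially"
    using \<epsilon> by (intro order_tendstoD(2)) auto
  then obtain K where K: "A K < \<epsilon>" by (auto simp: eventually_sequentially)
  (* the multiple d of the Gaussian corrects the value at 0 *)
  define d where "d = exp (poly q \<i>) - poly (S K) \<i>"
  have ap: "approximable (\<lambda>y. poly (S K) y * gauss y + d * gauss y) (exp (poly q \<i>))"
    using approximable_add[OF approximable_poly approximable_cmult[OF approximable_gauss], of "S K" d]
    by (simp add: d_def)
  have w1: "wiener_le (\<lambda>y. exp_remainder K (poly q y) * gauss y)
      (216 * pi\<^sup>2 * (2 * (exp (\<theta> * a) / \<theta> ^ K) * exp ((\<theta> * c + 4)\<^sup>2 / (4 * \<kappa>))))"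
    unfolding gauss_def
  proof (intro decays_wiener_le decays_gaussian \<kappa>)
    show "(\<lambda>y. exp_remainder K (poly q y)) holomorphic_on strip"
      unfolding exp_remainder_def by (intro holomorphic_intros) auto
    show "0 \<le> exp (\<theta> * a) / \<theta> ^ K" using \<theta> by simp
    fix y
    have "norm (exp_remainder K (poly q y)) \<le> exp (\<theta> * norm (poly q y)) / \<theta> ^ K"
      by (rule exp_remainder_bound) (use \<theta> in simp)
    also have "\<dots> \<le> exp (\<theta> * (a + c * norm y + \<sigma> * (norm y)\<^sup>2)) / \<theta> ^ K"
      using \<theta> q[of y] by (intro divide_right_mono) auto
    also have "\<theta> * (a + c * norm y + \<sigma> * (norm y)\<^sup>2) = \<theta> * a + (\<theta> * c * norm y + (1 - \<kappa>) * (norm y)\<^sup>2)"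
      by (simp add: \<kappa>_def algebra_simps)
    also have "exp \<dots> / \<theta> ^ K = exp (\<theta> * a) / \<theta> ^ K * exp (\<theta> * c * norm y + (1 - \<kappa>) * (norm y)\<^sup>2)"
      by (simp only: exp_add) simp
    finally show "norm (exp_remainder K (poly q y)) \<le> exp (\<theta> * a) / \<theta> ^ K * exp (\<theta> * c * norm y + (1 - \<kappa>) * (norm y)\<^sup>2)" .
  qed
  have "norm d \<le> exp (\<theta> * norm (poly q \<i>)) / \<theta> ^ K"
    unfolding d_def S by (rule exp_remainder_bound) (use \<theta> in simp)
  hence "norm d * (216 * pi\<^sup>2 * Bg) \<le> exp (\<theta> * norm (poly q \<i>)) / \<theta> ^ K * (216 * pi\<^sup>2 * Bg)"
    using wiener_le_nonneg[OF wg] by (intro mult_right_mono)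
  from wiener_le_diff[OF w1 wiener_le_mono[OF wiener_le_cmult[OF wg] this]]
  have "wiener_le (\<lambda>y. exp_remainder K (poly q y) * gauss y - d * gauss y) (A K)"
    by (simp add: A_def)
  hence "wiener_le (\<lambda>y. exp (poly q y) * gauss y - (poly (S K) y * gauss y + d * gauss y)) (A K)"
    by (simp add: algebra_simps flip: S)
  thus "\<exists>\<psi>'. approximable \<psi>' (exp (poly q \<i>)) \<and> wiener_le (\<lambda>y. exp (poly q y) * gauss y - \<psi>' y) \<epsilon>"
    using ap wiener_le_mono[OF _ less_imp_le[OF K]] by blast
qed

text \<open>
  With \<open>q y = - \<tau> - \<i> * \<tau> * y\<close> the function \<open>(1 - exp (q y)) * gauss y\<close> is approximable with value \<open>0\<close>, as \<open>q \<i> = 0\<close>,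
  and it tends to \<open>gauss\<close> for \<open>\<tau> \<longlonglongrightarrow> \<infinity>\<close>. Together with \<open>approximable_gauss\<close> this says that evaluation of \<open>P\<close> at \<open>0\<close> is
  not continuous in the Wiener norm of \<open>P * gauss\<close>.
\<close>

lemma approximable_gauss_zero: "approximable gauss 0"
proof (rule approximable_limit)
  fix \<epsilon> :: real assume \<epsilon>: "\<epsilon> > 0"
  have "((\<lambda>\<tau>::real. 216 * pi\<^sup>2 * (2 * exp (- \<tau> / 2) * exp ((0 + 4)\<^sup>2 / (4 * 1)))) \<longlongrightarrow> 0) at_top"
    by real_asymp
  hence "eventually (\<lambda>\<tau>::real. 216 * pi\<^sup>2 * (2 * exp (- \<tau> / 2) * exp ((0 + 4)\<^sup>2 / (4 * 1))) < \<epsilon> \<and> \<tau> > 0) at_top"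
    using \<epsilon> by (intro eventually_conj order_tendstoD(2) eventually_gt_at_top) auto
  then obtain \<tau> :: real where \<tau>: "216 * pi\<^sup>2 * (2 * exp (- \<tau> / 2) * exp ((0 + 4)\<^sup>2 / (4 * 1))) < \<epsilon>" "\<tau> > 0"
    by (auto dest!: eventually_happens)
  define q :: "complex poly" where "q = [:- of_real \<tau>, - \<i> * of_real \<tau>:]"
  have ap: "approximable (\<lambda>y. exp (poly q y) * gauss y) (exp (poly q \<i>))"
  proof (rule approximable_exp)
    fix y
    show "norm (poly q y) \<le> \<tau> + \<tau> * norm y + 0 * (norm y)\<^sup>2"
      using norm_triangle_ineq4[of "- of_real \<tau>" "y * (\<i> * of_real \<tau>)"] \<tau>(2)
      by (simp add: q_def norm_mult mult.commute)
  qed auto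
  have ap': "approximable (\<lambda>y. gauss y - exp (poly q y) * gauss y) 0"
    using approximable_add[OF approximable_gauss approximable_cmult[OF ap, of "-1"]]
    by (simp add: q_def)
  have "wiener_le (\<lambda>y. exp (poly q y) * gauss y) (216 * pi\<^sup>2 * (2 * exp (- \<tau> / 2) * exp ((0 + 4)\<^sup>2 / (4 * 1))))"
    unfolding gauss_def
  proof (intro decays_wiener_le decays_gaussian)
    fix y assume "y \<in> strip"
    hence "Im y \<le> 1/2" by (simp add: strip_def)
    hence "\<tau> * Im y \<le> \<tau> * (1/2)" using \<tau>(2) by (intro mult_left_mono) auto
    thus "norm (exp (poly q y)) \<le> exp (- \<tau> / 2) * exp (0 * norm y + (1 - 1) * (norm y)\<^sup>2)"
      by (simp add: q_def mult.commute)
  qed (auto intro!: holomorphic_intros)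
  hence "wiener_le (\<lambda>y. gauss y - (gauss y - exp (poly q y) * gauss y)) \<epsilon>"
    using wiener_le_mono[OF _ less_imp_le[OF \<tau>(1)]] by simp
  with ap' show "\<exists>\<psi>'. approximable \<psi>' 0 \<and> wiener_le (\<lambda>y. gauss y - \<psi>' y) \<epsilon>" by blast
qed

text \<open>
  A polynomial with \<open>P 0 = 0\<close> is divisible by \<open>z\<close>; substituting the approximation into itself \<open>M\<close>
  times collects the factor \<open>z ^ M\<close>.
\<close>

lemma gauss_high_frequencies:
  assumes "\<epsilon> > 0"
  shows "\<exists>P. monom 1 M dvd P \<and> wiener_le (\<lambda>y. gauss y - poly P (cay y) * gauss y) \<epsilon>"
  using assms
proof (induction M arbitrary: \<epsilon>)
  case 0
  show ?case using 0 by (intro exI[of _ 1]) (simp add: wiener_le_zero)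
next
  case (Suc M)
  hence "\<epsilon>/2 > 0" by simp
  then obtain P where P: "monom 1 M dvd P" "wiener_le (\<lambda>y. gauss y - poly P (cay y) * gauss y) (\<epsilon>/2)"
    using Suc.IH by blast
  obtain C where C: "C \<ge> 0" "\<And>\<phi> B. wiener_le \<phi> B \<Longrightarrow> wiener_le (\<lambda>y. poly P (cay y) * \<phi> y) (C * B)"
    using wiener_le_poly_mult by blast
  have "\<epsilon> / (2 * (C + 1)) > 0" using Suc.prems C(1) by simp
  then obtain P1 where P1: "poly P1 0 = 0" "wiener_le (\<lambda>y. gauss y - poly P1 (cay y) * gauss y) (\<epsilon> / (2 * (C + 1)))"
    using approximable_gauss_zero unfolding approximable_def by blast
  have "C * (\<epsilon> / (2 * (C + 1))) \<le> \<epsilon>/2" using Suc.prems C(1) by (simp add: divide_simps)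
  from wiener_le_add[OF P(2) wiener_le_mono[OF C(2)[OF P1(2)] this]]
  have "wiener_le (\<lambda>y. gauss y - poly (P * P1) (cay y) * gauss y) \<epsilon>"
    by (simp add: algebra_simps)
  moreover have "monom 1 (Suc M) dvd P * P1"
  proof -
    have "[:0, 1:] dvd P1" using P1(1) poly_eq_0_iff_dvd[of P1 0] by simp
    hence "monom 1 M * [:0, 1:] dvd P * P1" using P(1) by (rule mult_dvd_mono[rotated])
    moreover have "monom 1 M * [:0, 1:] = (monom 1 (Suc M) :: complex poly)"
      by (simp add: monom_Suc)
    ultimately show ?thesis by simp
  qed
  ultimately show ?case by blast
qed

lemma approximable_high_frequencies:
  assumes "approximable \<psi> c" "\<epsilon> > 0"
  shows "\<exists>P. monom 1 M dvd P \<and> wiener_le (\<lambda>y. \<psi> y - poly P (cay y) * gauss y) \<epsilon>"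
proof -
  obtain P where P: "wiener_le (\<lambda>y. \<psi> y - poly P (cay y) * gauss y) (\<epsilon>/2)"
    using assms(1) half_gt_zero[OF assms(2)] unfolding approximable_def by blast
  obtain C where C: "C \<ge> 0" "\<And>\<phi> B. wiener_le \<phi> B \<Longrightarrow> wiener_le (\<lambda>y. poly P (cay y) * \<phi> y) (C * B)"
    using wiener_le_poly_mult by blast
  have "\<epsilon> / (2 * (C + 1)) > 0" using assms(2) C(1) by simp
  then obtain P1 where P1: "monom 1 M dvd P1" "wiener_le (\<lambda>y. gauss y - poly P1 (cay y) * gauss y) (\<epsilon> / (2 * (C + 1)))"
    using gauss_high_frequencies by blast
  have "C * (\<epsilon> / (2 * (C + 1))) \<le> \<epsilon>/2" using assms(2) C(1) by (simp add: divide_simps)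
  from wiener_le_add[OF P wiener_le_mono[OF C(2)[OF P1(2)] this]]
  have "wiener_le (\<lambda>y. \<psi> y - poly (P * P1) (cay y) * gauss y) \<epsilon>"
    by (simp add: algebra_simps)
  thus ?thesis using P1(1) by (intro exI[of _ "P * P1"]) auto
qed

lemma norm_exp_minus_one_le:
  assumes "Re t \<le> 1"
  shows "norm (exp t - 1) \<le> 3 * norm t"
proof -
  have "norm (exp t - exp 0) \<le> 3 * norm (t - 0)"
  proof (rule field_differentiable_bound)
    show "convex {t. Re t \<le> 1}" by (rule convex_halfspace_Re_le)
    fix z assume "z \<in> {t. Re t \<le> 1}"
    hence "norm (exp z) \<le> exp 1" by simp
    also have "\<dots> \<le> 3" by (rule exp_le)
    finally show "norm (exp z) \<le> 3" .
  qed (use assms in \<open>auto intro!: derivative_eq_intros\<close>)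
  thus ?thesis by simp
qed

text \<open>
  The function \<open>(1 - z) ^ 6 * exp (- \<eta> * y\<^sup>2)\<close> is approximable, being \<open>(1 - z) ^ 6 * exp ((1 - \<eta>) * y\<^sup>2) * gauss y\<close>. The
  sixth power is what makes the difference to \<open>(1 - z) ^ 6\<close> satisfy \<open>decays\<close>: the factor \<open>exp (- \<eta> * y\<^sup>2) - 1\<close> costs
  \<open>\<eta> * \<bar>y\<bar>\<^sup>2\<close>, and \<open>\<bar>1 - z\<bar> ^ 6\<close> is of order \<open>(1 + \<bar>y\<bar>\<^sup>2) ^ (- 3)\<close>.
\<close>

lemma one_minus_cay_power_high_frequencies:
  assumes "\<epsilon> > 0"
  shows "\<exists>P. monom 1 M dvd P \<and> wiener_le (\<lambda>y. (1 - cay y) ^ 6 - poly P (cay y) * gauss y) \<epsilon>"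
proof -
  define K where "K = 216 * pi\<^sup>2 * 24000"
  have K: "K > 0" by (simp add: K_def)
  define \<eta> where "\<eta> = min 1 (\<epsilon> / (2 * K))"
  have \<eta>: "0 < \<eta>" "\<eta> \<le> 1" "K * \<eta> \<le> \<epsilon> / 2"
    using assms K by (auto simp: \<eta>_def min_def field_simps)
  define q :: "complex poly" where "q = [:0, 0, 1 - of_real \<eta>:]"
  have q: "poly q y = (1 - of_real \<eta>) * y\<^sup>2" for y by (simp add: q_def power2_eq_square algebra_simps)
  define \<psi> where "\<psi> = (\<lambda>y. poly ([:1, -1:] ^ 6) (cay y) * (exp (poly q y) * gauss y))"
  have "approximable (\<lambda>y. exp (poly q y) * gauss y) (exp (poly q \<i>))"
  proof (rule approximable_exp)
    have "norm (1 - of_real \<eta> :: complex) = 1 - \<eta>"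
      using \<eta> norm_of_real[of "1 - \<eta>", where 'a = complex] by simp
    thus "norm (poly q y) \<le> 0 + 0 * norm y + (1 - \<eta>) * (norm y)\<^sup>2" for y
      by (simp add: q norm_mult norm_power)
  qed (use \<eta> in auto)
  hence ap: "approximable \<psi> (poly ([:1, -1:] ^ 6) 0 * exp (poly q \<i>))"
    unfolding \<psi>_def by (rule approximable_poly_cay_mult)
  obtain P where P: "monom 1 M dvd P" "wiener_le (\<lambda>y. \<psi> y - poly P (cay y) * gauss y) (\<epsilon>/2)"
    using approximable_high_frequencies[OF ap half_gt_zero[OF assms], of M] by blast
  have \<psi>: "\<psi> y = (1 - cay y) ^ 6 * exp (- of_real \<eta> * y\<^sup>2)" for y
    unfolding \<psi>_def gauss_def q by (simp add: poly_power algebra_simps flip: exp_add)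
  have "decays (\<lambda>y. (1 - cay y) ^ 6 - \<psi> y) (24000 * \<eta>)"
    unfolding decays_def
  proof (intro conjI ballI)
    have ne: "y + \<i> \<noteq> 0" if "y \<in> strip" for y
      using that by (auto simp: strip_def complex_eq_iff)
    thus "(\<lambda>y. (1 - cay y) ^ 6 - \<psi> y) holomorphic_on strip"
      unfolding \<psi> cay_def by (intro holomorphic_intros) auto
    fix y assume y: "y \<in> strip"
    define r where "r = norm y"
    have Im: "\<bar>Im y\<bar> < 1/2" using y by (simp add: strip_def)
    have "\<bar>Im y\<bar>\<^sup>2 \<le> (1/2)\<^sup>2" using Im by (intro power_mono) auto
    hence Im2: "(Im y)\<^sup>2 \<le> 1/4" by (simp add: power_divide)
    have r2: "r\<^sup>2 = (Re y)\<^sup>2 + (Im y)\<^sup>2" by (simp add: r_def cmod_power2)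
    have "1 - cay y = 2 * \<i> / (y + \<i>)" using ne[OF y] by (simp add: cay_def field_simps)
    hence n2: "(norm (1 - cay y))\<^sup>2 = 4 / ((Re y)\<^sup>2 + (Im y + 1)\<^sup>2)"
      by (simp add: norm_divide norm_mult power_divide cmod_power2)
    have "(Im y + 1)\<^sup>2 \<ge> (1/2)\<^sup>2" using Im by (intro power_mono) auto
    hence "(Im y + 1)\<^sup>2 \<ge> 1/4" by (simp add: power_divide)
    hence m: "1 + r\<^sup>2 \<le> 5 * ((Re y)\<^sup>2 + (Im y + 1)\<^sup>2)"
      unfolding r2 using Im2 zero_le_power2[of "Re y"] by argo
    have p: "1 + r\<^sup>2 > 0" by simp
    have "(1 + r\<^sup>2) / 5 \<le> (Re y)\<^sup>2 + (Im y + 1)\<^sup>2" using m by (simp add: divide_le_eq)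
    moreover have p5: "(1 + r\<^sup>2) / 5 > 0" using p by (rule divide_pos_pos) simp
    ultimately have "4 / ((Re y)\<^sup>2 + (Im y + 1)\<^sup>2) \<le> 4 / ((1 + r\<^sup>2) / 5)"
      by (intro divide_left_mono mult_pos_pos) (auto intro: less_le_trans[OF p5])
    hence "(norm (1 - cay y))\<^sup>2 \<le> 20 / (1 + r\<^sup>2)"
      unfolding n2 by simp
    hence "((norm (1 - cay y))\<^sup>2) ^ 3 \<le> (20 / (1 + r\<^sup>2)) ^ 3"
      by (intro power_mono) auto
    hence n6: "norm (1 - cay y) ^ 6 \<le> 8000 / (1 + r\<^sup>2) ^ 3"
      by (simp add: power_divide flip: power_mult)
    have "norm (exp (- of_real \<eta> * y\<^sup>2) - 1) \<le> 3 * norm (- of_real \<eta> * y\<^sup>2)"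
    proof (rule norm_exp_minus_one_le)
      have "\<eta> * (Im y)\<^sup>2 \<le> 1 * 1" using \<eta> Im2 by (intro mult_mono) auto
      moreover have "0 \<le> \<eta> * (Re y)\<^sup>2" using \<eta> by simp
      ultimately show "Re (- of_real \<eta> * y\<^sup>2) \<le> 1" by (simp add: right_diff_distrib power2_eq_square)
    qed
    also have "\<dots> = 3 * \<eta> * r\<^sup>2" using \<eta> by (simp add: norm_mult norm_power r_def)
    finally have e: "norm (exp (- of_real \<eta> * y\<^sup>2) - 1) \<le> 3 * \<eta> * r\<^sup>2" .
    have "(1 - cay y) ^ 6 - \<psi> y = (1 - cay y) ^ 6 * - (exp (- of_real \<eta> * y\<^sup>2) - 1)"
      unfolding \<psi> by (simp only: right_diff_distrib minus_diff_eq mult_1_right)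
    hence "norm ((1 - cay y) ^ 6 - \<psi> y) = norm (1 - cay y) ^ 6 * norm (exp (- of_real \<eta> * y\<^sup>2) - 1)"
      by (simp only: norm_mult norm_power norm_minus_cancel)
    also have "\<dots> \<le> 8000 / (1 + r\<^sup>2) ^ 3 * (3 * \<eta> * r\<^sup>2)"
      using \<eta> by (intro mult_mono n6 e) auto
    also have "\<dots> = 24000 * \<eta> * (r\<^sup>2 / (1 + r\<^sup>2) ^ 3)" by simp
    also have "\<dots> \<le> 24000 * \<eta> * (1 / (1 + r\<^sup>2) ^ 2)"
    proof (intro mult_left_mono)
      have "r\<^sup>2 / (1 + r\<^sup>2) ^ 3 \<le> (1 + r\<^sup>2) / (1 + r\<^sup>2) ^ 3" by (intro divide_right_mono) auto
      also have "\<dots> = 1 / (1 + r\<^sup>2) ^ 2" by (simp only: eval_nat_numeral power_Suc) simp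
      finally show "r\<^sup>2 / (1 + r\<^sup>2) ^ 3 \<le> 1 / (1 + r\<^sup>2) ^ 2" .
    qed (use \<eta> in auto)
    finally show "norm ((1 - cay y) ^ 6 - \<psi> y) \<le> 24000 * \<eta> / (1 + (norm y)\<^sup>2)\<^sup>2"
      by (simp add: r_def)
  qed
  hence "wiener_le (\<lambda>y. (1 - cay y) ^ 6 - \<psi> y) (K * \<eta>)"
    by (auto dest!: decays_wiener_le simp: K_def mult.assoc)
  hence "wiener_le (\<lambda>y. (1 - cay y) ^ 6 - \<psi> y) (\<epsilon>/2)" using \<eta>(3) by (rule wiener_le_mono)
  from wiener_le_add[OF this P(2)] P(1) show ?thesis by auto
qed

section \<open>The generating Schwartz function\<close>

definition generator_coeff :: "int \<Rightarrow> complex" where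
  "generator_coeff = circle_coeff gauss"

text \<open>
  This is the function \<open>f\<close> of the theorem, extended to the complex plane so that its derivatives can be
  handled by complex analysis.
\<close>

definition generator :: "complex \<Rightarrow> complex" where
  "generator \<zeta> = (\<Sum>\<^sub>\<infinity>j. generator_coeff j * gauss (\<zeta> - of_int j))"

lemma norm_gauss: "norm (gauss \<zeta>) = exp ((Im \<zeta>)\<^sup>2 - (Re \<zeta>)\<^sup>2)"
  unfolding gauss_def norm_exp_eq_Re by (simp add: power2_eq_square)

lemma norm_gauss_le_cauchy_weight: "norm (gauss (of_real t)) \<le> cauchy_weight t"
proof -
  have "1 + t\<^sup>2 \<le> exp (t\<^sup>2)" by (rule exp_ge_add_one_self)
  hence "inverse (exp (t\<^sup>2)) \<le> inverse (1 + t\<^sup>2)" by (rule le_imp_inverse_le) simp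
  thus ?thesis by (simp add: norm_gauss cauchy_weight_def exp_minus inverse_eq_divide)
qed

lemma norm_gauss_le_1: "norm (gauss (of_real t)) \<le> 1"
  by (simp add: norm_gauss)

lemma generator_coeff_rapid:
  "\<exists>C. \<forall>j. (1 + \<bar>real_of_int j\<bar>) ^ n * norm (generator_coeff j) \<le> C"
proof -
  obtain C0 where C0: "\<And>j. norm (generator_coeff j) \<le> C0"
    using poly_gaussian_coeff_rapid[of 0 1] by (auto simp: generator_coeff_def gauss_def [abs_def])
  obtain C1 where C1: "\<And>j. \<bar>real_of_int j\<bar> ^ n * norm (generator_coeff j) \<le> C1"
    using poly_gaussian_coeff_rapid[of n 1] by (auto simp: generator_coeff_def gauss_def [abs_def])
  have "(1 + \<bar>real_of_int j\<bar>) ^ n * norm (generator_coeff j) \<le> 2 ^ n * (C0 + C1)" for j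
  proof -
    define a where "a = \<bar>real_of_int j\<bar>"
    have a: "a \<ge> 0" by (simp add: a_def)
    have "(1 + a) ^ n \<le> (2 * max 1 a) ^ n" using a by (intro power_mono) auto
    also have "\<dots> \<le> 2 ^ n * (1 + a ^ n)"
      using a by (auto simp: power_mult_distrib max_def)
    finally have "(1 + a) ^ n * norm (generator_coeff j) \<le> 2 ^ n * (1 + a ^ n) * norm (generator_coeff j)"
      by (rule mult_right_mono) simp
    also have "\<dots> = 2 ^ n * (norm (generator_coeff j) + a ^ n * norm (generator_coeff j))"
      by (simp add: algebra_simps)
    also have "\<dots> \<le> 2 ^ n * (C0 + C1)"
      using C0[of j] C1[of j] by (intro mult_left_mono add_mono) (auto simp: a_def)
    finally show ?thesis by (simp add: a_def)
  qed
  thus ?thesis by blast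
qed

lemma summable_generator_coeff:
  "(\<lambda>j. (1 + \<bar>real_of_int j\<bar>) ^ n * norm (generator_coeff j)) summable_on UNIV"
proof -
  obtain C where C: "\<And>j. (1 + \<bar>real_of_int j\<bar>) ^ (n + 2) * norm (generator_coeff j) \<le> C"
    using generator_coeff_rapid[of "n + 2"] by blast
  have C0: "C \<ge> 0" using C[of 0] by (auto intro: order_trans[OF norm_ge_zero])
  have 1: "(1 + \<bar>real_of_int j\<bar>) ^ n * norm (generator_coeff j) \<le> C * cauchy_weight (of_int j)" for j
  proof -
    have "(1 + (of_int j)\<^sup>2) * ((1 + \<bar>real_of_int j\<bar>) ^ n * norm (generator_coeff j))
      \<le> (1 + \<bar>real_of_int j\<bar>)\<^sup>2 * ((1 + \<bar>real_of_int j\<bar>) ^ n * norm (generator_coeff j))"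
      by (intro mult_right_mono) (auto simp: power2_sum)
    also have "\<dots> \<le> C" using C[of j] by (simp only: power_add mult_ac)
    finally show ?thesis by (simp add: cauchy_weight_def le_divide_eq mult.commute)
  qed
  have "(\<Sum>j\<in>F. (1 + \<bar>real_of_int j\<bar>) ^ n * norm (generator_coeff j)) \<le> C * (3 * pi)" if "finite F" for F
  proof -
    have "(\<Sum>j\<in>F. (1 + \<bar>real_of_int j\<bar>) ^ n * norm (generator_coeff j)) \<le> (\<Sum>j\<in>F. C * cauchy_weight (0 - of_int j))"
      using 1 by (intro sum_mono) (simp add: cauchy_weight_def)
    also have "\<dots> \<le> C * (3 * pi)"
      unfolding sum_distrib_left[symmetric] using C0 sum_translated_cauchy_weight[OF that, of 0]
      by (intro mult_left_mono)
    finally show ?thesis .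
  qed
  thus ?thesis
    by (intro nonneg_bdd_above_summable_on bdd_aboveI2[where M = "C * (3 * pi)"]) auto
qed

lemma one_plus_power_gauss_le:
  fixes u :: real
  shows "(1 + \<bar>u\<bar>) ^ n * exp (1 - u\<^sup>2) \<le> fact n * exp (2 + 1/4)"
proof -
  have "(1 + \<bar>u\<bar>) ^ n * exp (1 - u\<^sup>2) \<le> fact n * exp (1 + \<bar>u\<bar>) * exp (1 - u\<^sup>2)"
    by (intro mult_right_mono power_le_fact_exp) auto
  also have "\<dots> = fact n * (exp 2 * exp (1 * \<bar>u\<bar> - 1 * \<bar>u\<bar>\<^sup>2))"
    by (simp flip: exp_add add: algebra_simps)
  also have "\<dots> \<le> fact n * (exp 2 * exp (1\<^sup>2 / (4 * 1)))"
    by (intro mult_left_mono exp_linear_minus_square_le) auto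
  finally show ?thesis by (simp flip: exp_add)
qed

text \<open>
  The weight is submultiplicative, \<open>1 + \<bar>x\<bar> \<le> (1 + \<bar>j\<bar>) * (1 + \<bar>x - j\<bar>)\<close>: one factor is absorbed by the rapidly
  decreasing coefficients and the other one by the Gaussian.
\<close>

lemma generator_term_bound:
  assumes "\<bar>Im \<zeta>\<bar> \<le> 1"
  shows "(1 + \<bar>Re \<zeta>\<bar>) ^ n * norm (generator_coeff j * gauss (\<zeta> - of_int j))
    \<le> fact n * exp (2 + 1/4) * ((1 + \<bar>real_of_int j\<bar>) ^ n * norm (generator_coeff j))"
proof -
  define u where "u = Re \<zeta> - of_int j"
  have "(Im \<zeta>)\<^sup>2 \<le> 1" using assms by (simp add: abs_square_le_1)
  hence g: "norm (gauss (\<zeta> - of_int j)) \<le> exp (1 - u\<^sup>2)" by (simp add: norm_gauss u_def)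
  have "1 + \<bar>Re \<zeta>\<bar> \<le> 1 + (\<bar>real_of_int j\<bar> + \<bar>u\<bar>)" by (simp add: u_def)
  also have "\<dots> \<le> (1 + \<bar>real_of_int j\<bar>) * (1 + \<bar>u\<bar>)" by (simp add: algebra_simps)
  finally have "(1 + \<bar>Re \<zeta>\<bar>) ^ n \<le> ((1 + \<bar>real_of_int j\<bar>) * (1 + \<bar>u\<bar>)) ^ n"
    by (rule power_mono) simp
  hence "(1 + \<bar>Re \<zeta>\<bar>) ^ n * norm (generator_coeff j * gauss (\<zeta> - of_int j))
     \<le> ((1 + \<bar>real_of_int j\<bar>) * (1 + \<bar>u\<bar>)) ^ n * (norm (generator_coeff j) * exp (1 - u\<^sup>2))"
    unfolding norm_mult by (intro mult_mono g) auto
  also have "\<dots> = ((1 + \<bar>real_of_int j\<bar>) ^ n * norm (generator_coeff j)) * ((1 + \<bar>u\<bar>) ^ n * exp (1 - u\<^sup>2))"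
    by (simp add: power_mult_distrib mult_ac)
  also have "\<dots> \<le> ((1 + \<bar>real_of_int j\<bar>) ^ n * norm (generator_coeff j)) * (fact n * exp (2 + 1/4))"
    by (intro mult_left_mono one_plus_power_gauss_le) auto
  finally show ?thesis by (simp add: mult_ac)
qed

lemma generator_term_bound0:
  assumes "\<bar>Im \<zeta>\<bar> \<le> 1"
  shows "norm (generator_coeff j * gauss (\<zeta> - of_int j)) \<le> exp (2 + 1/4) * norm (generator_coeff j)"
  using generator_term_bound[OF assms, of 0 j] by simp

lemma summable_generator_term:
  assumes "\<bar>Im \<zeta>\<bar> \<le> 1"
  shows "(\<lambda>j. norm (generator_coeff j * gauss (\<zeta> - of_int j))) summable_on UNIV"
proof (rule Infinite_Sum.abs_summable_on_comparison_test')
  show "(\<lambda>j. exp (2 + 1/4) * norm (generator_coeff j)) summable_on UNIV"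
    using summable_generator_coeff[of 0] by (intro summable_on_cmult_right) simp
qed (rule generator_term_bound0[OF assms])

lemma generator_has_sum:
  assumes "\<bar>Im \<zeta>\<bar> \<le> 1"
  shows "((\<lambda>j. generator_coeff j * gauss (\<zeta> - of_int j)) has_sum generator \<zeta>) UNIV"
  unfolding generator_def
  using abs_summable_summable[OF summable_generator_term[OF assms]] by (rule has_sum_infsum)

lemma generator_decay:
  "\<exists>C. \<forall>\<zeta>. \<bar>Im \<zeta>\<bar> \<le> 1 \<longrightarrow> (1 + \<bar>Re \<zeta>\<bar>) ^ n * norm (generator \<zeta>) \<le> C"
proof -
  define C where "C = (\<Sum>\<^sub>\<infinity>j. fact n * exp (2 + 1/4) * ((1 + \<bar>real_of_int j\<bar>) ^ n * norm (generator_coeff j)))"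
  have "(1 + \<bar>Re \<zeta>\<bar>) ^ n * norm (generator \<zeta>) \<le> C" if "\<bar>Im \<zeta>\<bar> \<le> 1" for \<zeta>
  proof -
    define c where "c = (1 + \<bar>Re \<zeta>\<bar>) ^ n"
    have c: "c \<ge> 0" by (simp add: c_def)
    have "((\<lambda>j. of_real c * (generator_coeff j * gauss (\<zeta> - of_int j))) has_sum (of_real c * generator \<zeta>)) UNIV"
      by (intro has_sum_cmult_right generator_has_sum that)
    moreover have "((\<lambda>j. fact n * exp (2 + 1/4) * ((1 + \<bar>real_of_int j\<bar>) ^ n * norm (generator_coeff j)))
        has_sum C) UNIV"
      unfolding C_def by (intro has_sum_infsum summable_on_cmult_right summable_generator_coeff)
    moreover have "norm (of_real c * (generator_coeff j * gauss (\<zeta> - of_int j)))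
       \<le> fact n * exp (2 + 1/4) * ((1 + \<bar>real_of_int j\<bar>) ^ n * norm (generator_coeff j))" for j
      using generator_term_bound[OF that, of n j] c unfolding c_def[symmetric] norm_mult[of "of_real c"] by simp
    ultimately have "norm (of_real c * generator \<zeta>) \<le> C"
      by (rule norm_infsum_le)
    thus ?thesis using c by (simp add: norm_mult c_def[symmetric])
  qed
  thus ?thesis by blast
qed

lemma generator_holomorphic: "generator holomorphic_on {\<zeta>. \<bar>Im \<zeta>\<bar> < 1}"
proof (rule holomorphic_on_subset)
  have o: "open {\<zeta>::complex. \<bar>Im \<zeta>\<bar> < 1}"
    by (intro open_Collect_less continuous_intros)
  show "generator holomorphic_on {\<zeta>. \<bar>Im \<zeta>\<bar> < 1}"
    unfolding holomorphic_on_open[OF o]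
  proof (intro ballI)
    fix z :: complex assume "z \<in> {\<zeta>. \<bar>Im \<zeta>\<bar> < 1}"
    then obtain r where r: "r > 0" "cball z r \<subseteq> {\<zeta>. \<bar>Im \<zeta>\<bar> < 1}"
      using o open_contains_cball by blast
    have "uniform_limit (cball z r) (\<lambda>X \<zeta>. \<Sum>j\<in>X. generator_coeff j * gauss (\<zeta> - of_int j)) generator (finite_subsets_at_top UNIV)"
      unfolding generator_def
    proof (rule Weierstrass_m_test_general)
      show "(\<lambda>j. exp (2 + 1/4) * norm (generator_coeff j)) summable_on UNIV"
        using summable_generator_coeff[of 0] by (intro summable_on_cmult_right) simp
      fix j \<zeta> assume "\<zeta> \<in> cball z r"
      hence "\<bar>Im \<zeta>\<bar> \<le> 1" using r(2) by force
      thus "norm (generator_coeff j * gauss (\<zeta> - of_int j)) \<le> exp (2 + 1/4) * norm (generator_coeff j)"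
        by (rule generator_term_bound0)
    qed
    moreover have "continuous_on (cball z r) (\<lambda>\<zeta>. \<Sum>j\<in>X. generator_coeff j * gauss (\<zeta> - of_int j)) \<and>
       (\<lambda>\<zeta>. \<Sum>j\<in>X. generator_coeff j * gauss (\<zeta> - of_int j)) holomorphic_on ball z r" for X
      unfolding gauss_def by (intro conjI continuous_intros holomorphic_intros)
    ultimately obtain "generator holomorphic_on ball z r"
      using holomorphic_uniform_limit[of z r "\<lambda>X \<zeta>. \<Sum>j\<in>X. generator_coeff j * gauss (\<zeta> - of_int j)" "finite_subsets_at_top UNIV" generator]
      by (auto simp: always_eventually)
    thus "\<exists>f'. (generator has_field_derivative f') (at z)"
      using r(1) holomorphic_on_open[OF open_ball, of generator z r] by simp
  qed
qed auto

lemma generator_higher_deriv_holomorphic: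
  "(deriv ^^ k) generator holomorphic_on {\<zeta>. \<bar>Im \<zeta>\<bar> < 1}"
  by (intro holomorphic_higher_deriv generator_holomorphic open_Collect_less continuous_intros)

lemma generator_vector_derivative:
  "((\<lambda>x. (deriv ^^ k) generator (of_real x)) has_vector_derivative (deriv ^^ Suc k) generator (of_real x)) (at x)"
proof -
  have "((deriv ^^ k) generator has_field_derivative deriv ((deriv ^^ k) generator) (of_real x)) (at (of_real x))"
    by (rule holomorphic_derivI[OF generator_higher_deriv_holomorphic])
       (auto intro!: open_Collect_less continuous_intros)
  from has_vector_derivative_real_field[OF this] show ?thesis by simp
qed

lemma nth_derivative_generator:
  "nth_derivative k (\<lambda>x. generator (of_real x)) = (\<lambda>x. (deriv ^^ k) generator (of_real x))"
proof (induction k)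
  case (Suc k)
  have "nth_derivative (Suc k) (\<lambda>x. generator (of_real x)) =
     (\<lambda>x. vector_derivative (nth_derivative k (\<lambda>x. generator (of_real x))) (at x))"
    by (simp add: nth_derivative_def)
  also have "\<dots> = (\<lambda>x. (deriv ^^ Suc k) generator (of_real x))"
    unfolding Suc by (intro ext vector_derivative_at generator_vector_derivative)
  finally show ?case .
qed (simp add: nth_derivative_def)

text \<open>
  The real derivatives are the complex ones, and Cauchy's inequality on discs of radius \<open>1/2\<close> transfers
  the decay of the function to them.
\<close>

lemma generator_schwartz: "(\<lambda>x. generator (of_real x)) \<in> schwartz_space"
  unfolding schwartz_space_def mem_Collect_eq smooth_def nth_derivative_generator
proof (intro conjI allI)
  fix k and x :: real
  show "(\<lambda>x. (deriv ^^ k) generator (of_real x)) differentiable at x"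
    using generator_vector_derivative by (rule differentiableI_vector)
next
  fix n k :: nat
  obtain C where C: "\<And>\<zeta>. \<bar>Im \<zeta>\<bar> \<le> 1 \<Longrightarrow> (1 + \<bar>Re \<zeta>\<bar>) ^ n * norm (generator \<zeta>) \<le> C"
    using generator_decay[of n] by blast
  have "(1 + \<bar>x\<bar>) ^ n * norm ((deriv ^^ k) generator (of_real x)) \<le> fact k * (2 ^ n * C) / (1/2) ^ k" for x :: real
  proof -
    have sub: "cball (complex_of_real x) (1/2) \<subseteq> {\<zeta>. \<bar>Im \<zeta>\<bar> < 1}"
    proof
      fix y assume "y \<in> cball (complex_of_real x) (1/2)"
      hence "norm (y - of_real x) \<le> 1/2" by (simp add: dist_norm norm_minus_commute)
      hence "\<bar>Im (y - of_real x)\<bar> \<le> 1/2" using abs_Im_le_cmod[of "y - of_real x"] by linarith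
      thus "y \<in> {\<zeta>. \<bar>Im \<zeta>\<bar> < 1}" by simp
    qed
    have "norm ((deriv ^^ k) generator (of_real x)) \<le> fact k * (2 ^ n * C / (1 + \<bar>x\<bar>) ^ n) / (1/2) ^ k"
    proof (rule Cauchy_inequality)
      show "generator holomorphic_on ball (of_real x) (1/2)"
        by (rule holomorphic_on_subset[OF generator_holomorphic order_trans[OF ball_subset_cball sub]])
      show "continuous_on (cball (of_real x) (1/2)) generator"
        by (rule holomorphic_on_imp_continuous_on[OF holomorphic_on_subset[OF generator_holomorphic sub]])
      fix y assume y: "norm (complex_of_real x - y) = 1/2"
      hence "y \<in> {\<zeta>. \<bar>Im \<zeta>\<bar> < 1}" by (intro subsetD[OF sub]) (simp add: dist_norm)
      hence Cy: "(1 + \<bar>Re y\<bar>) ^ n * norm (generator y) \<le> C" by (intro C) simp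
      have "\<bar>Re (complex_of_real x - y)\<bar> \<le> 1/2" using y abs_Re_le_cmod[of "complex_of_real x - y"] by simp
      hence "\<bar>x - Re y\<bar> \<le> 1/2" by simp
      hence "1 + \<bar>x\<bar> \<le> 2 * (1 + \<bar>Re y\<bar>)" by (auto simp: abs_if split: if_splits)
      hence "(1 + \<bar>x\<bar>) ^ n \<le> (2 * (1 + \<bar>Re y\<bar>)) ^ n" by (rule power_mono) simp
      hence "(1 + \<bar>x\<bar>) ^ n * norm (generator y) \<le> (2 * (1 + \<bar>Re y\<bar>)) ^ n * norm (generator y)"
        by (rule mult_right_mono) simp
      also have "\<dots> = 2 ^ n * ((1 + \<bar>Re y\<bar>) ^ n * norm (generator y))"
        by (simp only: power_mult_distrib mult.assoc)
      also have "\<dots> \<le> 2 ^ n * C" using Cy by (intro mult_left_mono) auto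
      finally show "norm (generator y) \<le> 2 ^ n * C / (1 + \<bar>x\<bar>) ^ n"
        by (subst pos_le_divide_eq) (simp_all add: mult.commute add_pos_nonneg)
    qed simp
    hence "(1 + \<bar>x\<bar>) ^ n * norm ((deriv ^^ k) generator (of_real x))
       \<le> (1 + \<bar>x\<bar>) ^ n * (fact k * (2 ^ n * C / (1 + \<bar>x\<bar>) ^ n) / (1/2) ^ k)"
      by (intro mult_left_mono) auto
    also have "\<dots> = fact k * (2 ^ n * C) / (1/2) ^ k"
    proof -
      have "(1 + \<bar>x\<bar>) ^ n \<noteq> 0" by (simp add: add_nonneg_eq_0_iff)
      thus ?thesis by simp
    qed
    finally show ?thesis .
  qed
  thus "bdd_above (range (\<lambda>x. (1 + \<bar>x\<bar>) ^ n * norm ((deriv ^^ k) generator (of_real x))))"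
    by (intro bdd_aboveI2)
qed

section \<open>A translation invariant norm that dominates all $L^p$ norms\<close>

text \<open>
  A common bound for the supremum and the integral of \<open>\<bar>h\<bar>\<close>. It is invariant under translations and, by
  \<open>\<bar>h\<bar> powr p \<le> B powr (p - 1) * \<bar>h\<bar>\<close>, bounds every \<open>L\<^sup>p\<close> norm with \<open>p \<ge> 1\<close> simultaneously, so that one
  approximation serves all exponents.
\<close>

definition sup_L1_le :: "(real \<Rightarrow> complex) \<Rightarrow> real \<Rightarrow> bool" where
  "sup_L1_le h B \<longleftrightarrow> h \<in> borel_measurable borel \<and> (\<forall>x. norm (h x) \<le> B) \<and>
     (\<integral>\<^sup>+x. ennreal (norm (h x)) \<partial>lborel) \<le> ennreal B"

lemma sup_L1_leI:
  assumes "h \<in> borel_measurable borel" "\<And>x. norm (h x) \<le> B"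
    "(\<integral>\<^sup>+x. ennreal (norm (h x)) \<partial>lborel) \<le> ennreal B"
  shows "sup_L1_le h B"
  unfolding sup_L1_le_def by (intro conjI allI assms)

lemma sup_L1_leD:
  assumes "sup_L1_le h B"
  shows "h \<in> borel_measurable borel" "norm (h x) \<le> B"
    "(\<integral>\<^sup>+x. ennreal (norm (h x)) \<partial>lborel) \<le> ennreal B"
  using assms unfolding sup_L1_le_def by blast+

lemma sup_L1_le_nonneg: "sup_L1_le h B \<Longrightarrow> B \<ge> 0"
  using sup_L1_leD(2)[of h B 0] order_trans[OF norm_ge_zero] by blast

lemma sup_L1_le_mono:
  assumes "sup_L1_le h B" "B \<le> C"
  shows "sup_L1_le h C"
proof (rule sup_L1_leI)
  show "norm (h x) \<le> C" for x using sup_L1_leD(2)[OF assms(1), of x] assms(2) by linarith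
  show "(\<integral>\<^sup>+x. ennreal (norm (h x)) \<partial>lborel) \<le> ennreal C"
    by (rule order_trans[OF sup_L1_leD(3)[OF assms(1)] ennreal_leI[OF assms(2)]])
qed (rule sup_L1_leD(1)[OF assms(1)])

lemma sup_L1_le_add:
  assumes "sup_L1_le h B" "sup_L1_le k C"
  shows "sup_L1_le (\<lambda>x. h x + k x) (B + C)"
proof (rule sup_L1_leI)
  note [measurable] = sup_L1_leD(1)[OF assms(1)] sup_L1_leD(1)[OF assms(2)]
  show "(\<lambda>x. h x + k x) \<in> borel_measurable borel" by measurable
  show "norm (h x + k x) \<le> B + C" for x
    by (intro norm_triangle_mono sup_L1_leD(2)[OF assms(1)] sup_L1_leD(2)[OF assms(2)])
  have "(\<integral>\<^sup>+x. ennreal (norm (h x + k x)) \<partial>lborel) \<le> (\<integral>\<^sup>+x. ennreal (norm (h x)) + ennreal (norm (k x)) \<partial>lborel)"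
    by (intro nn_integral_mono) (simp add: norm_triangle_ineq flip: ennreal_plus)
  also have "\<dots> = (\<integral>\<^sup>+x. ennreal (norm (h x)) \<partial>lborel) + (\<integral>\<^sup>+x. ennreal (norm (k x)) \<partial>lborel)"
    by (rule nn_integral_add) auto
  also have "\<dots> \<le> ennreal B + ennreal C"
    by (intro add_mono sup_L1_leD(3) assms)
  also have "\<dots> = ennreal (B + C)"
    using assms[THEN sup_L1_le_nonneg] by simp
  finally show "(\<integral>\<^sup>+x. ennreal (norm (h x + k x)) \<partial>lborel) \<le> ennreal (B + C)" .
qed

lemma sup_L1_le_cmult:
  assumes "sup_L1_le h B"
  shows "sup_L1_le (\<lambda>x. c * h x) (norm c * B)"
proof (rule sup_L1_leI)
  note [measurable] = sup_L1_leD(1)[OF assms(1)]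
  show "(\<lambda>x. c * h x) \<in> borel_measurable borel" by measurable
  show "norm (c * h x) \<le> norm c * B" for x
    unfolding norm_mult by (intro mult_left_mono sup_L1_leD(2)[OF assms]) simp
  have "(\<integral>\<^sup>+x. ennreal (norm (c * h x)) \<partial>lborel) = ennreal (norm c) * (\<integral>\<^sup>+x. ennreal (norm (h x)) \<partial>lborel)"
    by (subst nn_integral_cmult[symmetric]) (auto simp: norm_mult ennreal_mult)
  also have "\<dots> \<le> ennreal (norm c) * ennreal B"
    by (intro mult_left_mono sup_L1_leD(3)[OF assms]) simp
  also have "\<dots> = ennreal (norm c * B)"
    using sup_L1_le_nonneg[OF assms] by (simp add: ennreal_mult)
  finally show "(\<integral>\<^sup>+x. ennreal (norm (c * h x)) \<partial>lborel) \<le> ennreal (norm c * B)" .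
qed

lemma sup_L1_le_diff:
  assumes "sup_L1_le h B" "sup_L1_le k C"
  shows "sup_L1_le (\<lambda>x. h x - k x) (B + C)"
  using sup_L1_le_add[OF assms(1) sup_L1_le_cmult[OF assms(2), of "-1"]] by simp

lemma nn_integral_translate:
  fixes g :: "real \<Rightarrow> ennreal"
  assumes "g \<in> borel_measurable borel"
  shows "(\<integral>\<^sup>+x. g (x - t) \<partial>lborel) = (\<integral>\<^sup>+x. g x \<partial>lborel)"
  using nn_integral_real_affine[of g 1 "- t"] assms by simp

lemma sup_L1_le_translate:
  assumes "sup_L1_le h B"
  shows "sup_L1_le (\<lambda>x. h (x - t)) B"
proof (rule sup_L1_leI)
  note [measurable] = sup_L1_leD(1)[OF assms(1)]
  show "(\<lambda>x. h (x - t)) \<in> borel_measurable borel" by measurable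
  show "norm (h (x - t)) \<le> B" for x by (rule sup_L1_leD(2)[OF assms])
  show "(\<integral>\<^sup>+x. ennreal (norm (h (x - t))) \<partial>lborel) \<le> ennreal B"
    by (subst nn_integral_translate) (auto intro: sup_L1_leD(3)[OF assms])
qed

lemma sup_L1_le_zero: "B \<ge> 0 \<Longrightarrow> sup_L1_le (\<lambda>x. 0) B"
  by (rule sup_L1_leI) auto

lemma sup_L1_le_sum:
  "(\<And>i. i \<in> I \<Longrightarrow> sup_L1_le (h i) (B i)) \<Longrightarrow> sup_L1_le (\<lambda>x. \<Sum>i\<in>I. h i x) (\<Sum>i\<in>I. B i)"
proof (induction I rule: infinite_finite_induct)
  case (insert i I)
  show ?case using insert.hyps sup_L1_le_add[OF insert.prems insert.IH, of i] insert.prems by simp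
qed (auto intro: sup_L1_le_zero)

lemma nn_integral_cauchy_weight: "(\<integral>\<^sup>+x. ennreal (cauchy_weight x) \<partial>lborel) = ennreal pi"
  using nn_integral_eq_integral[OF integrable_cauchy_weight] by (simp add: integral_cauchy_weight)

lemma sup_L1_le_by_cauchy_weight:
  assumes "h \<in> borel_measurable borel" "\<And>x. norm (h x) \<le> B * cauchy_weight x" "B \<ge> 0"
  shows "sup_L1_le h (pi * B)"
proof (rule sup_L1_leI[OF assms(1)])
  fix x
  have "B * cauchy_weight x \<le> B * 1" using assms(3) by (intro mult_left_mono) auto
  moreover have "1 * B \<le> pi * B" using assms(3) pi_gt3 by (intro mult_right_mono) auto
  ultimately show "norm (h x) \<le> pi * B" using assms(2)[of x] by linarith
next
  have [measurable]: "cauchy_weight \<in> borel_measurable borel"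
    by (intro borel_measurable_continuous_onI continuous_intros)
  have "(\<integral>\<^sup>+x. ennreal (norm (h x)) \<partial>lborel) \<le> (\<integral>\<^sup>+x. ennreal B * ennreal (cauchy_weight x) \<partial>lborel)"
    using assms(2,3) by (intro nn_integral_mono) (simp flip: ennreal_mult)
  also have "\<dots> = ennreal B * ennreal pi"
    by (subst nn_integral_cmult) (auto simp: nn_integral_cauchy_weight)
  also have "\<dots> = ennreal (pi * B)" using assms(3) by (simp add: ennreal_mult mult.commute)
  finally show "(\<integral>\<^sup>+x. ennreal (norm (h x)) \<partial>lborel) \<le> ennreal (pi * B)" .
qed

lemma measurable_gauss [measurable]: "(\<lambda>x. gauss (of_real x)) \<in> borel_measurable borel"
  unfolding gauss_def by (intro borel_measurable_continuous_onI continuous_intros)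

lemma sup_L1_le_gauss: "sup_L1_le (\<lambda>x. gauss (of_real x)) pi"
  using sup_L1_le_by_cauchy_weight[of "\<lambda>x. gauss (of_real x)" 1] norm_gauss_le_cauchy_weight by simp

lemma filterlim_symmetric_int_intervals:
  "filterlim (\<lambda>n. {- int n..int n}) (finite_subsets_at_top UNIV) sequentially"
  unfolding filterlim_finite_subsets_at_top
proof (intro allI impI)
  fix X :: "int set" assume X: "finite X \<and> X \<subseteq> UNIV"
  define m where "m = Max (insert 0 (abs ` X))"
  have m: "\<bar>j\<bar> \<le> m" if "j \<in> X" for j
    unfolding m_def using X that by (intro Max_ge) auto
  show "\<forall>\<^sub>F n in sequentially. finite {- int n..int n} \<and> X \<subseteq> {- int n..int n} \<and> {- int n..int n} \<subseteq> UNIV"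
  proof (rule eventually_sequentiallyI[of "nat m"])
    fix n assume "nat m \<le> n"
    hence "j \<in> {- int n..int n}" if "j \<in> X" for j using m[OF that] by auto
    thus "finite {- int n..int n} \<and> X \<subseteq> {- int n..int n} \<and> {- int n..int n} \<subseteq> UNIV" by auto
  qed
qed

text \<open>
  For finite sums this is the triangle inequality; the supremum passes to the limit pointwise and the
  integral by Fatou's lemma.
\<close>

lemma gauss_superposition_bound:
  assumes a: "\<And>F. finite F \<Longrightarrow> (\<Sum>j\<in>F. norm (a j)) \<le> B"
    and G: "\<And>x. ((\<lambda>j. a j * gauss (of_real (x - of_int j))) has_sum G x) UNIV"
  shows "sup_L1_le G (pi * B)"
proof -
  define S where "S n x = (\<Sum>j\<in>{- int n..int n}. a j * gauss (of_real (x - of_int j)))" for n x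
  have B0: "B \<ge> 0" using a[of "{}"] by simp
  have S: "sup_L1_le (S n) (pi * B)" for n
  proof -
    have "sup_L1_le (S n) (\<Sum>j\<in>{- int n..int n}. norm (a j) * pi)"
      unfolding S_def
      by (intro sup_L1_le_sum sup_L1_le_cmult sup_L1_le_translate[of "\<lambda>x. gauss (of_real x)"] sup_L1_le_gauss)
    moreover have "(\<Sum>j\<in>{- int n..int n}. norm (a j) * pi) \<le> pi * B"
      unfolding sum_distrib_right[symmetric] using a[of "{- int n..int n}"] by simp
    ultimately show ?thesis by (rule sup_L1_le_mono)
  qed
  have lim: "(\<lambda>n. S n x) \<longlonglongrightarrow> G x" for x
    using G[of x] unfolding has_sum_def S_def
    by (rule filterlim_compose[OF _ filterlim_symmetric_int_intervals])
  note [measurable] = sup_L1_leD(1)[OF S]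
  show ?thesis
  proof (rule sup_L1_leI)
    show "G \<in> borel_measurable borel"
      by (rule borel_measurable_LIMSEQ_metric[OF sup_L1_leD(1)[OF S] lim])
    show "norm (G x) \<le> pi * B" for x
      by (rule tendsto_upperbound[OF tendsto_norm[OF lim]])
         (auto intro!: always_eventually sup_L1_leD(2)[OF S])
    have "(\<integral>\<^sup>+x. ennreal (norm (G x)) \<partial>lborel) = (\<integral>\<^sup>+x. liminf (\<lambda>n. ennreal (norm (S n x))) \<partial>lborel)"
    proof (intro nn_integral_cong)
      fix x
      have "(\<lambda>n. ennreal (norm (S n x))) \<longlonglongrightarrow> ennreal (norm (G x))"
        by (intro tendsto_ennrealI tendsto_norm lim)
      thus "ennreal (norm (G x)) = liminf (\<lambda>n. ennreal (norm (S n x)))"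
        using lim_imp_Liminf[OF sequentially_bot] by metis
    qed
    also have "\<dots> \<le> liminf (\<lambda>n. \<integral>\<^sup>+x. ennreal (norm (S n x)) \<partial>lborel)"
      by (rule nn_integral_liminf) measurable
    also have "\<dots> \<le> ennreal (pi * B)"
      by (rule order_trans[OF Liminf_le_Limsup[OF sequentially_bot] Limsup_bounded])
         (auto intro!: always_eventually sup_L1_leD(3)[OF S])
    finally show "(\<integral>\<^sup>+x. ennreal (norm (G x)) \<partial>lborel) \<le> ennreal (pi * B)" .
  qed
qed

text \<open>
  The polynomial \<open>P(T)\<close> in the translation \<open>T\<close> by \<open>1\<close>, applied to \<open>h\<close>.
\<close>

definition shift_poly :: "complex poly \<Rightarrow> (real \<Rightarrow> complex) \<Rightarrow> real \<Rightarrow> complex" where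
  "shift_poly P h x = (\<Sum>n\<le>degree P. coeff P n * h (x - real n))"

lemma coeff_poly_cay_mult:
  assumes "bounded_cont \<phi>"
  shows "circle_coeff (\<lambda>y. poly P (cay y) * \<phi> y) j = (\<Sum>n\<le>degree P. coeff P n * circle_coeff \<phi> (j - int n))"
proof -
  have "circle_coeff (\<lambda>y. poly P (cay y) * \<phi> y) j = circle_coeff (\<lambda>y. \<Sum>n\<le>degree P. coeff P n * (cay y ^ n * \<phi> y)) j"
    by (simp add: poly_altdef sum_distrib_right mult.assoc)
  also have "\<dots> = (\<Sum>n\<le>degree P. circle_coeff (\<lambda>y. coeff P n * (cay y ^ n * \<phi> y)) j)"
    using assms by (intro coeff_sum bounded_cont_mult bounded_cont_const bounded_cont_cay_power)
  finally show ?thesis by (simp only: coeff_cmult coeff_cay_power_mult)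
qed

lemma bounded_cont_gauss: "bounded_cont gauss"
  unfolding bounded_cont_def
proof
  show "continuous_on UNIV (\<lambda>t::real. gauss (of_real t))" unfolding gauss_def by (intro continuous_intros)
  show "\<exists>B. \<forall>t::real. norm (gauss (of_real t)) \<le> B" using norm_gauss_le_1 by blast
qed

lemma has_sum_finite_sum:
  fixes f :: "'i \<Rightarrow> 'a \<Rightarrow> complex"
  shows "(\<And>i. i \<in> I \<Longrightarrow> (f i has_sum S i) A) \<Longrightarrow> ((\<lambda>x. \<Sum>i\<in>I. f i x) has_sum (\<Sum>i\<in>I. S i)) A"
  by (induction I rule: infinite_finite_induct) (auto intro!: has_sum_add)

lemma has_sum_minus:
  fixes f g :: "'a \<Rightarrow> complex"
  assumes "(f has_sum S) A" "(g has_sum T) A"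
  shows "((\<lambda>x. f x - g x) has_sum (S - T)) A"
  using has_sum_add[OF assms(1) has_sum_uminusI[OF assms(2)]] by simp

text \<open>
  The symbol of \<open>(1 - T) ^ 6\<close>.
\<close>

definition diff6 :: "complex poly" where
  "diff6 = [:1, -1:] ^ 6"

text \<open>
  The difference is the superposition of Gaussians whose coefficients are those of
  \<open>P * gauss - (1 - z) ^ 6\<close> on the circle; the factor \<open>pi\<close> is the normalisation of \<open>circle_coeff\<close>.
\<close>

lemma generator_shift_approx:
  assumes "\<epsilon> > 0"
  shows "\<exists>P. (\<forall>n<M. coeff P n = 0) \<and>
    sup_L1_le (\<lambda>x. shift_poly P (\<lambda>x. generator (of_real x)) x
       - pi * shift_poly diff6 (\<lambda>x. gauss (of_real x)) x) \<epsilon>"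
proof -
  define Q where "Q = diff6"
  have "\<epsilon> / pi > 0" using assms by simp
  then obtain P where P: "monom 1 M dvd P"
    and w: "wiener_le (\<lambda>y. (1 - cay y) ^ 6 - poly P (cay y) * gauss y) (\<epsilon> / pi)"
    using one_minus_cay_power_high_frequencies[of "\<epsilon> / pi" M] by blast
  define a where "a j = - circle_coeff (\<lambda>y. (1 - cay y) ^ 6 - poly P (cay y) * gauss y) j" for j
  have Q: "(1 - cay y) ^ 6 = poly Q (cay y) * 1" for y by (simp add: Q_def diff6_def poly_power)
  have a_eq: "a j = (\<Sum>n\<le>degree P. coeff P n * generator_coeff (j - int n)) -
       (\<Sum>n\<le>degree Q. coeff Q n * (if j = int n then of_real pi else 0))" for j
  proof -
    have "circle_coeff (\<lambda>y. 1) (j - int n) = (if j = int n then of_real pi else 0)" for n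
      using coeff_cay_power[of 0 "j - int n"] by simp
    hence "circle_coeff (\<lambda>y. poly Q (cay y) * 1) j = (\<Sum>n\<le>degree Q. coeff Q n * (if j = int n then of_real pi else 0))"
      by (subst coeff_poly_cay_mult[OF bounded_cont_const]) simp
    moreover have "circle_coeff (\<lambda>y. poly P (cay y) * gauss y) j = (\<Sum>n\<le>degree P. coeff P n * generator_coeff (j - int n))"
      by (subst coeff_poly_cay_mult[OF bounded_cont_gauss]) (simp add: generator_coeff_def)
    moreover have "a j = circle_coeff (\<lambda>y. poly P (cay y) * gauss y) j - circle_coeff (\<lambda>y. poly Q (cay y) * 1) j"
      unfolding a_def Q
      by (subst coeff_diff) (auto intro!: bounded_cont_mult bounded_cont_poly_cay bounded_cont_gauss)
    ultimately show ?thesis by simp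
  qed
  have "((\<lambda>j. a j * gauss (of_real (x - of_int j))) has_sum
      (shift_poly P (\<lambda>x. generator (of_real x)) x - pi * shift_poly Q (\<lambda>x. gauss (of_real x)) x)) UNIV" for x
  proof -
    have 1: "((\<lambda>j. generator_coeff (j - int n) * gauss (of_real (x - of_int j))) has_sum generator (of_real (x - real n))) UNIV" for n
    proof -
      have "((\<lambda>j. generator_coeff j * gauss (of_real (x - real n) - of_int j)) has_sum generator (of_real (x - real n))) UNIV"
        by (rule generator_has_sum) simp
      moreover have "((\<lambda>j. generator_coeff (j - int n) * gauss (of_real (x - of_int j))) has_sum generator (of_real (x - real n))) UNIV
         \<longleftrightarrow> ((\<lambda>j. generator_coeff j * gauss (of_real (x - real n) - of_int j)) has_sum generator (of_real (x - real n))) UNIV"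
        by (rule has_sum_reindex_bij_witness[of _ "\<lambda>j. j + int n" "\<lambda>j. j - int n"]) (auto simp: algebra_simps)
      ultimately show ?thesis by simp
    qed
    have 2: "((\<lambda>j. (if j = int n then of_real pi else 0) * gauss (of_real (x - of_int j))) has_sum of_real pi * gauss (of_real (x - real n))) UNIV" for n
      by (rule has_sum_finite_neutralI[of "{int n}"]) auto
    have "((\<lambda>j. (\<Sum>n\<le>degree P. coeff P n * (generator_coeff (j - int n) * gauss (of_real (x - of_int j)))) -
        (\<Sum>n\<le>degree Q. coeff Q n * ((if j = int n then of_real pi else 0) * gauss (of_real (x - of_int j))))) has_sum
      ((\<Sum>n\<le>degree P. coeff P n * generator (of_real (x - real n))) - (\<Sum>n\<le>degree Q. coeff Q n * (of_real pi * gauss (of_real (x - real n)))))) UNIV"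
      by (intro has_sum_minus has_sum_finite_sum has_sum_cmult_right 1 2)
    moreover have "(\<Sum>n\<le>degree P. coeff P n * (generator_coeff (j - int n) * gauss (of_real (x - of_int j)))) -
        (\<Sum>n\<le>degree Q. coeff Q n * ((if j = int n then of_real pi else 0) * gauss (of_real (x - of_int j))))
       = a j * gauss (of_real (x - of_int j))" for j
      unfolding a_eq left_diff_distrib sum_distrib_right mult.assoc ..
    moreover have "((\<Sum>n\<le>degree P. coeff P n * generator (of_real (x - real n))) - (\<Sum>n\<le>degree Q. coeff Q n * (of_real pi * gauss (of_real (x - real n)))))
       = shift_poly P (\<lambda>x. generator (of_real x)) x - pi * shift_poly Q (\<lambda>x. gauss (of_real x)) x"
      by (simp add: shift_poly_def sum_distrib_left mult_ac)
    ultimately show ?thesis by simp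
  qed
  hence "sup_L1_le (\<lambda>x. shift_poly P (\<lambda>x. generator (of_real x)) x - pi * shift_poly Q (\<lambda>x. gauss (of_real x)) x) (pi * (\<epsilon> / pi))"
    by (intro gauss_superposition_bound[of a]) (use wiener_leD[OF w] in \<open>auto simp: a_def\<close>)
  moreover have "\<forall>n<M. coeff P n = 0" using P by (simp add: monom_1_dvd_iff')
  ultimately show ?thesis by (auto simp: Q_def)
qed

section \<open>Linear combinations and their closure\<close>

text \<open>
  The linear span of \<open>B\<close>, built up one summand at a time, so that properties can be proved by adding a
  single element of \<open>B\<close>.
\<close>

inductive_set combos :: "(real \<Rightarrow> complex) set \<Rightarrow> (real \<Rightarrow> complex) set" for B where
  zero: "(\<lambda>x. 0) \<in> combos B"
| step: "b \<in> B \<Longrightarrow> v \<in> combos B \<Longrightarrow> (\<lambda>x. c * b x + v x) \<in> combos B"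

lemma combos_add: "u \<in> combos B \<Longrightarrow> v \<in> combos B \<Longrightarrow> (\<lambda>x. u x + v x) \<in> combos B"
proof (induction u rule: combos.induct)
  case (step b u c)
  from combos.step[OF step.hyps(1) step.IH[OF step.prems], of c]
  show ?case by (simp add: add.assoc)
qed simp

lemma combos_cmult: "u \<in> combos B \<Longrightarrow> (\<lambda>x. a * u x) \<in> combos B"
proof (induction u rule: combos.induct)
  case (step b u c)
  from combos.step[OF step.hyps(1) step.IH, of "a * c"]
  show ?case by (simp add: algebra_simps)
qed (auto intro: combos.zero)

lemma combos_base: "b \<in> B \<Longrightarrow> b \<in> combos B"
  using combos.step[OF _ combos.zero, of b B 1] by simp

lemma combos_sum: "(\<And>i. i \<in> I \<Longrightarrow> b i \<in> combos B) \<Longrightarrow> (\<lambda>x. \<Sum>i\<in>I. c i * b i x) \<in> combos B"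
proof (induction I rule: infinite_finite_induct)
  case (insert i I)
  from combos_add[OF combos_cmult[OF insert.prems, of i "c i"] insert.IH] insert.hyps insert.prems
  show ?case by simp
qed (simp_all add: combos.zero)

lemma scaled_eps:
  assumes "(\<epsilon>::real) > 0" "c \<ge> 0"
  shows "\<epsilon> / (c + 1) > 0" "c * (\<epsilon> / (c + 1)) \<le> \<epsilon>"
proof -
  have c: "c + 1 > 0" using assms(2) by simp
  show "\<epsilon> / (c + 1) > 0" using assms(1) c by (rule divide_pos_pos)
  have "c * \<epsilon> \<le> (c + 1) * \<epsilon>" using assms(1) by (intro mult_right_mono) auto
  thus "c * (\<epsilon> / (c + 1)) \<le> \<epsilon>" using c by (simp add: pos_divide_le_eq mult.commute)
qed

definition nearby :: "(real \<Rightarrow> complex) set \<Rightarrow> (real \<Rightarrow> complex) \<Rightarrow> bool" where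
  "nearby B h \<longleftrightarrow> (\<forall>\<epsilon>>0. \<exists>v\<in>combos B. sup_L1_le (\<lambda>x. h x - v x) \<epsilon>)"

lemma nearbyD: "nearby B h \<Longrightarrow> \<epsilon> > 0 \<Longrightarrow> \<exists>v\<in>combos B. sup_L1_le (\<lambda>x. h x - v x) \<epsilon>"
  unfolding nearby_def by blast

lemma nearby_combos: "v \<in> combos B \<Longrightarrow> nearby B v"
  unfolding nearby_def by (intro allI impI bexI[of _ v]) (auto intro: sup_L1_le_zero)

lemma nearby_add:
  assumes "nearby B h" "nearby B k"
  shows "nearby B (\<lambda>x. h x + k x)"
  unfolding nearby_def
proof (intro allI impI)
  fix \<epsilon> :: real assume "\<epsilon> > 0"
  hence e: "\<epsilon>/2 > 0" by simp
  obtain u where u: "u \<in> combos B" "sup_L1_le (\<lambda>x. h x - u x) (\<epsilon>/2)" using nearbyD[OF assms(1) e] by blast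
  obtain v where v: "v \<in> combos B" "sup_L1_le (\<lambda>x. k x - v x) (\<epsilon>/2)" using nearbyD[OF assms(2) e] by blast
  show "\<exists>v\<in>combos B. sup_L1_le (\<lambda>x. h x + k x - v x) \<epsilon>"
    using sup_L1_le_add[OF u(2) v(2)] by (intro bexI[OF _ combos_add[OF u(1) v(1)]]) (simp add: algebra_simps)
qed

lemma nearby_cmult:
  assumes "nearby B h"
  shows "nearby B (\<lambda>x. a * h x)"
  unfolding nearby_def
proof (intro allI impI)
  fix \<epsilon> :: real assume e: "\<epsilon> > 0"
  obtain u where u: "u \<in> combos B" "sup_L1_le (\<lambda>x. h x - u x) (\<epsilon> / (norm a + 1))"
    using nearbyD[OF assms scaled_eps(1)[OF e norm_ge_zero]] by blast
  from sup_L1_le_mono[OF sup_L1_le_cmult[OF u(2), of a] scaled_eps(2)[OF e norm_ge_zero]]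
  show "\<exists>v\<in>combos B. sup_L1_le (\<lambda>x. a * h x - v x) \<epsilon>"
    by (intro bexI[OF _ combos_cmult[OF u(1)]]) (simp add: algebra_simps)
qed

lemma nearby_limit:
  assumes "\<And>\<epsilon>. \<epsilon> > 0 \<Longrightarrow> \<exists>k. nearby B k \<and> sup_L1_le (\<lambda>x. h x - k x) \<epsilon>"
  shows "nearby B h"
  unfolding nearby_def
proof (intro allI impI)
  fix \<epsilon> :: real assume "\<epsilon> > 0"
  hence e: "\<epsilon>/2 > 0" by simp
  obtain k where k: "nearby B k" "sup_L1_le (\<lambda>x. h x - k x) (\<epsilon>/2)" using assms[OF e] by blast
  obtain v where v: "v \<in> combos B" "sup_L1_le (\<lambda>x. k x - v x) (\<epsilon>/2)" using nearbyD[OF k(1) e] by blast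
  show "\<exists>v\<in>combos B. sup_L1_le (\<lambda>x. h x - v x) \<epsilon>"
    using sup_L1_le_add[OF k(2) v(2)] by (intro bexI[OF _ v(1)]) simp
qed

lemma nearby_sum: "(\<And>i. i \<in> I \<Longrightarrow> nearby B (b i)) \<Longrightarrow> nearby B (\<lambda>x. \<Sum>i\<in>I. c i * b i x)"
proof (induction I rule: infinite_finite_induct)
  case (insert i I)
  from nearby_add[OF nearby_cmult[OF insert.prems, of i "c i"] insert.IH] insert.hyps insert.prems
  show ?case by simp
qed (simp_all add: nearby_combos combos.zero)

text \<open>
  In \<open>c + 5\<close>, one unit bounds \<open>\<bar>x\<bar> ^ k / fact k\<close> by \<open>exp \<bar>x\<bar>\<close>, and four units bound \<open>1 + x\<^sup>2\<close>.
\<close>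

lemma gauss_weighted_bound:
  assumes "h \<in> borel_measurable borel" "A \<ge> 0"
    "\<And>x. norm (h x) \<le> A * (\<bar>x\<bar> ^ k * exp (c * \<bar>x\<bar>) * exp (- x\<^sup>2))"
  shows "sup_L1_le h (pi * (A * (fact k * exp ((c + 5)\<^sup>2 / 4))))"
proof (rule sup_L1_le_by_cauchy_weight)
  show "A * (fact k * exp ((c + 5)\<^sup>2 / 4)) \<ge> 0" using assms(2) by simp
  fix x :: real
  define r where "r = \<bar>x\<bar>"
  have r: "r \<ge> 0" "r\<^sup>2 = x\<^sup>2" by (auto simp: r_def)
  have "1 + r\<^sup>2 \<le> (1 + r\<^sup>2)\<^sup>2" by (rule self_le_power) auto
  also have "\<dots> \<le> exp (4 * r)" by (rule one_plus_square_le_exp[OF r(1)])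
  finally have 1: "1 + r\<^sup>2 \<le> exp (4 * r)" .
  have "(1 + r\<^sup>2) * (r ^ k * exp (c * r) * exp (- r\<^sup>2)) \<le> exp (4 * r) * (fact k * exp r * exp (c * r) * exp (- r\<^sup>2))"
    using 1 power_le_fact_exp[OF r(1), of k] r(1) by (intro mult_mono) auto
  also have "\<dots> = fact k * exp ((c + 5) * r - 1 * r\<^sup>2)"
    by (simp add: algebra_simps flip: exp_add)
  also have "\<dots> \<le> fact k * exp ((c + 5)\<^sup>2 / (4 * 1))"
    by (intro mult_left_mono exp_linear_minus_square_le) auto
  finally have "r ^ k * exp (c * r) * exp (- r\<^sup>2) \<le> fact k * exp ((c + 5)\<^sup>2 / 4) * cauchy_weight r"
    by (simp add: cauchy_weight_def le_divide_eq mult.commute)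
  hence "A * (r ^ k * exp (c * r) * exp (- r\<^sup>2)) \<le> A * (fact k * exp ((c + 5)\<^sup>2 / 4) * cauchy_weight r)"
    using assms(2) by (rule mult_left_mono)
  thus "norm (h x) \<le> A * (fact k * exp ((c + 5)\<^sup>2 / 4)) * cauchy_weight x"
    using assms(3)[of x] by (simp add: r_def cauchy_weight_def mult.assoc)
qed (rule assms(1))

section \<open>Blocks of translations and the sequence\<close>

definition gauss_moment :: "nat \<Rightarrow> real \<Rightarrow> complex" where
  "gauss_moment k x = of_real x ^ k * gauss (of_real x)"

text \<open>
  The translate by \<open>a\<close> is a multiple of \<open>exp (2 * a * x) * gauss x\<close>, and each differentiation with respect to the
  exponent brings down a factor \<open>x\<close>. Only nonnegative shifts are available, so one-sided difference quotients
  are used.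
\<close>

lemma gauss_translates_nearby_exp_moments:
  assumes "0 \<le> \<alpha>" "\<alpha> < 2 * \<delta>"
  shows "nearby {\<lambda>x. gauss (of_real (x - a)) | a. 0 \<le> a \<and> a < \<delta>}
    (\<lambda>x. of_real x ^ k * exp (of_real (\<alpha> * x)) * gauss (of_real x))"
  using assms
proof (induction k arbitrary: \<alpha>)
  case 0
  have "exp (of_real (\<alpha> * x)) * gauss (of_real x) = exp (of_real (\<alpha>\<^sup>2 / 4)) * gauss (of_real (x - \<alpha>/2))" for x
  proof -
    have "of_real (\<alpha> * x) + - (complex_of_real x)\<^sup>2 = of_real (\<alpha>\<^sup>2 / 4) + - (of_real (x - \<alpha>/2))\<^sup>2"
      by (simp add: power2_eq_square algebra_simps)
    thus ?thesis unfolding gauss_def by (simp only: flip: exp_add)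
  qed
  moreover have "nearby {\<lambda>x. gauss (of_real (x - a)) | a. 0 \<le> a \<and> a < \<delta>}
     (\<lambda>x. exp (of_real (\<alpha>\<^sup>2 / 4)) * gauss (of_real (x - \<alpha>/2)))"
    using 0 by (intro nearby_cmult nearby_combos combos_base CollectI exI[of _ "\<alpha>/2"]) auto
  ultimately show ?case by simp
next
  case (Suc k)
  let ?B = "{\<lambda>x. gauss (of_real (x - a)) | a. 0 \<le> a \<and> a < \<delta>}"
  let ?e = "\<lambda>k \<alpha> x. complex_of_real x ^ k * exp (of_real (\<alpha> * x)) * gauss (of_real x)"
  show ?case
  proof (rule nearby_limit)
    fix \<epsilon> :: real assume \<epsilon>: "\<epsilon> > 0"
    define C where "C = pi * (fact (k + 2) * exp ((1 + \<alpha> + 5)\<^sup>2 / 4))"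
    have C: "C > 0" by (simp add: C_def)
    define \<eta> where "\<eta> = min 1 (min (\<epsilon> / C) ((2 * \<delta> - \<alpha>) / 2))"
    have \<eta>: "\<eta> > 0" "\<eta> \<le> 1" "\<eta> * C \<le> \<epsilon>" "\<alpha> + \<eta> < 2 * \<delta>"
    proof -
      show "\<eta> > 0" "\<eta> \<le> 1" using \<epsilon> C Suc.prems by (auto simp: \<eta>_def)
      have "\<eta> \<le> \<epsilon> / C" by (simp add: \<eta>_def)
      thus "\<eta> * C \<le> \<epsilon>" using C by (simp add: pos_le_divide_eq)
      have "\<eta> \<le> (2 * \<delta> - \<alpha>) / 2" unfolding \<eta>_def by (rule order_trans[OF min.cobounded2 min.cobounded2])
      thus "\<alpha> + \<eta> < 2 * \<delta>" using Suc.prems by (simp add: field_simps)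
    qed
    have n: "nearby ?B (\<lambda>x. (1 / of_real \<eta>) * ?e k (\<alpha> + \<eta>) x + (- 1 / of_real \<eta>) * ?e k \<alpha> x)"
      using \<eta> Suc.prems by (intro nearby_add nearby_cmult Suc.IH) auto
    have "sup_L1_le (\<lambda>x. ?e (Suc k) \<alpha> x - ((1 / of_real \<eta>) * ?e k (\<alpha> + \<eta>) x + (- 1 / of_real \<eta>) * ?e k \<alpha> x))
        (pi * (\<eta> * (fact (k + 2) * exp ((1 + \<alpha> + 5)\<^sup>2 / 4))))"
    proof (rule gauss_weighted_bound)
      show "(\<lambda>x. ?e (Suc k) \<alpha> x - ((1 / of_real \<eta>) * ?e k (\<alpha> + \<eta>) x + (- 1 / of_real \<eta>) * ?e k \<alpha> x)) \<in> borel_measurable borel"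
        unfolding gauss_def by (intro borel_measurable_continuous_onI continuous_intros)
      show "\<eta> \<ge> 0" using \<eta> by simp
      fix x :: real
      define t where "t = complex_of_real (\<eta> * x)"
      have "exp (of_real ((\<alpha> + \<eta>) * x)) = exp (of_real (\<alpha> * x)) * exp t"
        by (simp add: t_def ring_distribs flip: exp_add)
      hence "?e (Suc k) \<alpha> x - ((1 / of_real \<eta>) * ?e k (\<alpha> + \<eta>) x + (- 1 / of_real \<eta>) * ?e k \<alpha> x)
        = - (?e k \<alpha> x * (exp t - (\<Sum>i\<le>1. t ^ i / fact i)) / of_real \<eta>)"
        using \<eta>(1) by (simp add: t_def field_simps)
      hence "norm (?e (Suc k) \<alpha> x - ((1 / of_real \<eta>) * ?e k (\<alpha> + \<eta>) x + (- 1 / of_real \<eta>) * ?e k \<alpha> x))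
        = norm (?e k \<alpha> x) * norm (exp t - (\<Sum>i\<le>1. t ^ i / fact i)) / \<eta>"
        using \<eta>(1) by (simp only: norm_minus_cancel norm_divide norm_mult norm_of_real abs_of_pos)
      also have "\<dots> \<le> norm (?e k \<alpha> x) * (exp (norm t) * norm t ^ Suc 1 / fact 1) / \<eta>"
        using \<eta>(1) by (intro divide_right_mono mult_left_mono Taylor_exp_field) auto
      also have "norm t = \<eta> * \<bar>x\<bar>" unfolding t_def norm_of_real using \<eta>(1) by (simp only: abs_mult abs_of_pos)
      also have "norm (?e k \<alpha> x) = \<bar>x\<bar> ^ k * exp (\<alpha> * x) * exp (- x\<^sup>2)"
        by (simp add: norm_mult norm_power norm_gauss norm_exp_eq_Re)
      also have "\<bar>x\<bar> ^ k * exp (\<alpha> * x) * exp (- x\<^sup>2) * (exp (\<eta> * \<bar>x\<bar>) * (\<eta> * \<bar>x\<bar>) ^ Suc 1 / fact 1) / \<eta>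
        = \<eta> * (\<bar>x\<bar> ^ (k + 2) * (exp (\<alpha> * x) * exp (\<eta> * \<bar>x\<bar>)) * exp (- x\<^sup>2))"
        using \<eta>(1) by (simp add: field_simps power_add power2_eq_square)
      also have "\<dots> \<le> \<eta> * (\<bar>x\<bar> ^ (k + 2) * exp ((1 + \<alpha>) * \<bar>x\<bar>) * exp (- x\<^sup>2))"
      proof (intro mult_left_mono mult_right_mono)
        have "\<alpha> * x \<le> \<alpha> * \<bar>x\<bar>" using Suc.prems by (intro mult_left_mono) auto
        moreover have "\<eta> * \<bar>x\<bar> \<le> 1 * \<bar>x\<bar>" using \<eta> by (intro mult_right_mono) auto
        ultimately show "exp (\<alpha> * x) * exp (\<eta> * \<bar>x\<bar>) \<le> exp ((1 + \<alpha>) * \<bar>x\<bar>)"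
          by (simp add: ring_distribs flip: exp_add)
      qed (use \<eta>(1) in auto)
      finally show "norm (?e (Suc k) \<alpha> x - ((1 / of_real \<eta>) * ?e k (\<alpha> + \<eta>) x + (- 1 / of_real \<eta>) * ?e k \<alpha> x))
         \<le> \<eta> * (\<bar>x\<bar> ^ (k + 2) * exp ((1 + \<alpha>) * \<bar>x\<bar>) * exp (- x\<^sup>2))" .
    qed
    moreover have "pi * (\<eta> * (fact (k + 2) * exp ((1 + \<alpha> + 5)\<^sup>2 / 4))) \<le> \<epsilon>"
      using \<eta>(3) by (simp add: C_def mult_ac)
    ultimately have "sup_L1_le (\<lambda>x. ?e (Suc k) \<alpha> x - ((1 / of_real \<eta>) * ?e k (\<alpha> + \<eta>) x + (- 1 / of_real \<eta>) * ?e k \<alpha> x)) \<epsilon>"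
      by (rule sup_L1_le_mono)
    with n show "\<exists>h. nearby ?B h \<and> sup_L1_le (\<lambda>x. ?e (Suc k) \<alpha> x - h x) \<epsilon>" by blast
  qed
qed

lemma gauss_translates_nearby_moments:
  assumes "\<delta> > 0"
  shows "nearby {\<lambda>x. gauss (of_real (x - a)) | a. 0 \<le> a \<and> a < \<delta>} (gauss_moment k)"
  using gauss_translates_nearby_exp_moments[of 0 \<delta> k] assms by (simp add: gauss_moment_def [abs_def])

lemma sup_L1_le_triangle:
  assumes "sup_L1_le (\<lambda>x. f x - g x) a" "sup_L1_le (\<lambda>x. h x - g x) b"
  shows "sup_L1_le (\<lambda>x. f x - h x) (a + b)"
  using sup_L1_le_diff[OF assms] by simp

lemma shift_poly_bound:
  "\<exists>C>0. \<forall>h B. sup_L1_le h B \<longrightarrow> sup_L1_le (shift_poly P h) (C * B)"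
proof -
  define C where "C = (\<Sum>n\<le>degree P. norm (coeff P n)) + 1"
  have "sup_L1_le (shift_poly P h) (C * B)" if "sup_L1_le h B" for h B
  proof -
    have "sup_L1_le (\<lambda>x. \<Sum>n\<le>degree P. coeff P n * h (x - real n)) (\<Sum>n\<le>degree P. norm (coeff P n) * B)"
      by (intro sup_L1_le_sum sup_L1_le_cmult sup_L1_le_translate that)
    moreover have "(\<Sum>n\<le>degree P. norm (coeff P n) * B) \<le> C * B"
      using sup_L1_le_nonneg[OF that] by (simp add: C_def ring_distribs flip: sum_distrib_right)
    ultimately show ?thesis unfolding shift_poly_def[abs_def] by (rule sup_L1_le_mono)
  qed
  moreover have "C > 0" unfolding C_def by (intro add_nonneg_pos sum_nonneg) auto
  ultimately show ?thesis by (intro exI[of _ C] conjI allI impI)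
qed

lemma shift_poly_linear:
  "shift_poly P (\<lambda>x. a * h x + b * k x) x = a * shift_poly P h x + b * shift_poly P k x"
  unfolding shift_poly_def sum_distrib_left sum.distrib[symmetric] by (simp add: algebra_simps)

lemma shift_poly_diff:
  "shift_poly P (\<lambda>x. h x - k x) = (\<lambda>x. shift_poly P h x - shift_poly P k x)"
  by (rule ext) (simp add: shift_poly_def right_diff_distrib sum_subtractf)

definition generator_block :: "(nat \<Rightarrow> real) \<Rightarrow> (nat \<Rightarrow> complex) \<Rightarrow> nat \<Rightarrow> nat \<Rightarrow> real \<Rightarrow> complex" where
  "generator_block l c M M' x = (\<Sum>n\<in>{M..<M'}. c n * generator (of_real (x - l n)))"

text \<open>
  The translates of the Gaussian in \<open>v\<close> are treated one after the other: each gets its own block of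
  integers, beyond all earlier ones, all moved by the same amount \<open>a\<close>.
\<close>

lemma generator_block_approx:
  assumes "v \<in> combos {\<lambda>x. gauss (of_real (x - a)) | a. 0 \<le> a \<and> a < \<delta>}" "\<epsilon> > 0" "\<delta> > 0"
  shows "\<exists>M' l c. M < M' \<and> (\<forall>n. \<bar>l n - real n\<bar> < \<delta>) \<and>
    sup_L1_le (\<lambda>x. generator_block l c M M' x - shift_poly diff6 v x) \<epsilon>"
  using assms
proof (induction v arbitrary: \<epsilon> M rule: combos.induct)
  case zero
  (* one integer with coefficient 0, since blocks are required to be nonempty *)
  have "sup_L1_le (\<lambda>x. generator_block real (\<lambda>_. 0) M (Suc M) x - shift_poly diff6 (\<lambda>x. 0) x) \<epsilon>"
    using zero by (simp add: generator_block_def shift_poly_def sup_L1_le_zero)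
  thus ?case using zero by (intro exI[of _ "Suc M"] exI[of _ real] exI[of _ "\<lambda>_. 0"]) auto
next
  case (step b v c0)
  have e2: "\<epsilon>/2 > 0" using step.prems by simp
  obtain M1 l1 c1 where 1: "M < M1" "\<And>n. \<bar>l1 n - real n\<bar> < \<delta>"
    "sup_L1_le (\<lambda>x. generator_block l1 c1 M M1 x - shift_poly diff6 v x) (\<epsilon>/2)"
    using step.IH[OF e2 step.prems(2)] by blast
  obtain a where a: "b = (\<lambda>x. gauss (of_real (x - a)))" "0 \<le> a" "a < \<delta>" using step.hyps(1) by blast
  define d where "d = c0 / of_real pi"
  obtain P where P: "\<forall>n<M1. coeff P n = 0"
    "sup_L1_le (\<lambda>x. shift_poly P (\<lambda>x. generator (of_real x)) x
       - pi * shift_poly diff6 (\<lambda>x. gauss (of_real x)) x) ((\<epsilon>/2) / (norm d + 1))"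
    using generator_shift_approx[OF scaled_eps(1)[OF e2 norm_ge_zero], of M1 d] by blast
  (* the coefficients of P live in {M1..<M2} *)
  define M2 where "M2 = M1 + Suc (degree P)"
  define l where "l n = (if n < M1 then l1 n else real n + a)" for n
  define c where "c n = (if n < M1 then c1 n else d * coeff P n)" for n
  have blk: "generator_block l c M M2 x = generator_block l1 c1 M M1 x + d * shift_poly P (\<lambda>x. generator (of_real x)) (x - a)" for x
  proof -
    have "generator_block l c M M2 x = (\<Sum>n\<in>{M..<M1}. c n * generator (of_real (x - l n))) + (\<Sum>n\<in>{M1..<M2}. c n * generator (of_real (x - l n)))"
      unfolding generator_block_def using 1(1) by (subst sum.atLeastLessThan_concat) (auto simp: M2_def)
    also have "(\<Sum>n\<in>{M..<M1}. c n * generator (of_real (x - l n))) = generator_block l1 c1 M M1 x"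
      unfolding generator_block_def by (intro sum.cong) (auto simp: l_def c_def)
    also have "(\<Sum>n\<in>{M1..<M2}. c n * generator (of_real (x - l n))) = (\<Sum>n\<in>{M1..<M2}. d * (coeff P n * generator (of_real (x - a - real n))))"
      by (intro sum.cong) (auto simp: l_def c_def algebra_simps)
    also have "\<dots> = (\<Sum>n<M2. d * (coeff P n * generator (of_real (x - a - real n))))"
      using P(1) by (intro sum.mono_neutral_left) auto
    also have "\<dots> = (\<Sum>n\<le>degree P. d * (coeff P n * generator (of_real (x - a - real n))))"
      by (intro sum.mono_neutral_right) (auto simp: M2_def coeff_eq_0)
    finally show ?thesis by (simp add: shift_poly_def sum_distrib_left)
  qed
  note 2 = sup_L1_le_mono[OF sup_L1_le_translate[OF sup_L1_le_cmult[OF P(2), of d], of a]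
      scaled_eps(2)[OF e2 norm_ge_zero]]
  have eq: "generator_block l1 c1 M M1 x - shift_poly diff6 v x +
      d * (shift_poly P (\<lambda>x. generator (of_real x)) (x - a) - pi * shift_poly diff6 (\<lambda>x. gauss (of_real x)) (x - a))
     = generator_block l c M M2 x - shift_poly diff6 (\<lambda>x. c0 * b x + v x) x" for x
  proof -
    have "shift_poly diff6 (\<lambda>x. c0 * b x + v x) x = c0 * shift_poly diff6 b x + shift_poly diff6 v x"
      using shift_poly_linear[of diff6 c0 b 1 v x] by simp
    moreover have "shift_poly diff6 b x = shift_poly diff6 (\<lambda>x. gauss (of_real x)) (x - a)"
      unfolding shift_poly_def a(1) by (intro sum.cong) (auto simp: algebra_simps)
    moreover have "d * (u - pi * w) = d * u - c0 * w" for u w :: complex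
    proof -
      have dpi: "d * pi = c0" by (simp add: d_def)
      show ?thesis by (simp only: right_diff_distrib mult.assoc[symmetric] dpi)
    qed
    ultimately show ?thesis by (simp only: blk) simp
  qed
  have "sup_L1_le (\<lambda>x. generator_block l c M M2 x - shift_poly diff6 (\<lambda>x. c0 * b x + v x) x) \<epsilon>"
    using sup_L1_le_add[OF 1(3) 2] by (simp add: eq)
  moreover have "M < M2" using 1(1) by (simp add: M2_def)
  moreover have "\<bar>l n - real n\<bar> < \<delta>" for n using 1(2)[of n] a by (simp add: l_def)
  ultimately show ?case by blast
qed

lemma generator_block_approx_moment:
  assumes "\<epsilon> > 0" "\<delta> > 0"
  shows "\<exists>M' l c. M < M' \<and> (\<forall>n. \<bar>l n - real n\<bar> < \<delta>) \<and>
    sup_L1_le (\<lambda>x. generator_block l c M M' x - shift_poly diff6 (gauss_moment k) x) \<epsilon>"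
proof -
  obtain C where C: "C > 0" "\<forall>h B. sup_L1_le h B \<longrightarrow> sup_L1_le (shift_poly diff6 h) (C * B)"
    using shift_poly_bound[of diff6] by (elim exE conjE)
  have e: "\<epsilon> / (2 * C) > 0" using assms(1) C(1) by simp
  obtain v where v: "v \<in> combos {\<lambda>x. gauss (of_real (x - a)) | a. 0 \<le> a \<and> a < \<delta>}"
    "sup_L1_le (\<lambda>x. gauss_moment k x - v x) (\<epsilon> / (2 * C))"
    using nearbyD[OF gauss_translates_nearby_moments[OF assms(2), of k] e] by (elim bexE)
  obtain M' l c where 1: "M < M'" "\<forall>n. \<bar>l n - real n\<bar> < \<delta>"
    "sup_L1_le (\<lambda>x. generator_block l c M M' x - shift_poly diff6 v x) (\<epsilon>/2)"
    using generator_block_approx[OF v(1) half_gt_zero[OF assms(1)] assms(2), of M] by (elim exE conjE)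
  have "sup_L1_le (\<lambda>x. shift_poly diff6 (gauss_moment k) x - shift_poly diff6 v x) (C * (\<epsilon> / (2 * C)))"
    using C(2)[rule_format, OF v(2)] unfolding shift_poly_diff .
  hence 2: "sup_L1_le (\<lambda>x. shift_poly diff6 (gauss_moment k) x - shift_poly diff6 v x) (\<epsilon>/2)"
    by (rule sup_L1_le_mono) (use C(1) in simp)
  have "sup_L1_le (\<lambda>x. generator_block l c M M' x - shift_poly diff6 (gauss_moment k) x) (\<epsilon>/2 + \<epsilon>/2)"
    by (rule sup_L1_le_triangle[OF 1(3) 2])
  hence 3: "sup_L1_le (\<lambda>x. generator_block l c M M' x - shift_poly diff6 (gauss_moment k) x) \<epsilon>"
    by (simp only: field_sum_of_halves)
  show ?thesis
    by (rule exI[of _ M'], rule exI[of _ l], rule exI[of _ c]) (intro conjI 1(1,2) 3)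
qed

text \<open>
  The \<open>i\<close>-th block of integers \<open>{M i..<M (Suc i)}\<close> has shifts below \<open>1 / (i + 1)\<close> and produces the target
  number \<open>fst (prod_decode i)\<close> up to \<open>1 / (i + 1)\<close>. Every \<open>k\<close> is the number of infinitely many blocks, so omitting the first
  \<open>N\<close> translations does no harm.
\<close>

lemma translation_sequence:
  "\<exists>l. (\<lambda>n. l n - real n) \<longlonglongrightarrow> 0 \<and>
     (\<forall>k N. nearby {\<lambda>x. generator (of_real (x - l n)) | n. N < n} (shift_poly diff6 (gauss_moment k)))"
proof -
  let ?T = "\<lambda>k. shift_poly diff6 (gauss_moment k)"
  define good where "good i M M' l c \<longleftrightarrow> M < M' \<and> (\<forall>n. \<bar>l n - real n\<bar> < 1 / real (Suc i)) \<and>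
    sup_L1_le (\<lambda>x. generator_block l c M M' x - ?T (fst (prod_decode i)) x) (1 / real (Suc i))" for i M M' l c
  have "\<forall>i M. \<exists>M' l c. good i M M' l c"
    unfolding good_def by (intro allI generator_block_approx_moment) auto
  then obtain nxt ll cc where good: "\<And>i M. good i M (nxt i M) (ll i M) (cc i M)" by metis
  define M where "M = rec_nat 0 (\<lambda>i m. nxt i m)"
  have M_Suc: "M (Suc i) = nxt i (M i)" for i by (simp add: M_def)
  have M0: "M 0 = 0" by (simp add: M_def)
  have mono: "strict_mono M"
    unfolding strict_mono_Suc_iff using good[unfolded good_def] by (simp add: M_Suc)
  define idx where "idx n = (LEAST i. n < M (Suc i))" for n
  have idx: "idx n = i" if "M i \<le> n" "n < M (Suc i)" for n i
    unfolding idx_def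
  proof (rule Least_equality)
    show "n < M (Suc i)" by (rule that(2))
    fix j assume "n < M (Suc j)"
    hence "M i < M (Suc j)" using that(1) by simp
    thus "i \<le> j" using strict_mono_less[OF mono, of i "Suc j"] by simp
  qed
  have ex: "\<exists>i. M i \<le> n \<and> n < M (Suc i)" for n
  proof -
    have "n < M (Suc n)" using strict_mono_imp_increasing[OF mono, of "Suc n"] by simp
    hence "n < M (Suc (idx n))" unfolding idx_def by (rule LeastI)
    moreover have "M (idx n) \<le> n"
    proof (cases "idx n")
      case (Suc j)
      hence "\<not> n < M (Suc j)" using not_less_Least[of j "\<lambda>i. n < M (Suc i)"] by (simp add: idx_def)
      thus ?thesis using Suc by simp
    qed (simp add: M0)
    ultimately show ?thesis by blast
  qed
  define l where "l n = ll (idx n) (M (idx n)) n" for n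
  have l: "l n = ll i (M i) n" if "M i \<le> n" "n < M (Suc i)" for n i
    using idx[OF that] by (simp add: l_def)
  have "(\<lambda>n. l n - real n) \<longlonglongrightarrow> 0"
  proof (rule LIMSEQ_I)
    fix \<epsilon> :: real assume "\<epsilon> > 0"
    then obtain i0 where i0: "1 / real (Suc i0) < \<epsilon>" by (rule nat_approx_posE)
    have "norm (l n - real n - 0) < \<epsilon>" if n: "n \<ge> M i0" for n
    proof -
      obtain i where i: "M i \<le> n" "n < M (Suc i)" using ex by blast
      have "M i0 < M (Suc i)" using n i(2) by simp
      hence "i0 \<le> i" using strict_mono_less[OF mono, of i0 "Suc i"] by simp
      hence "1 / real (Suc i) \<le> 1 / real (Suc i0)" by (intro divide_left_mono) auto
      moreover have "\<bar>l n - real n\<bar> < 1 / real (Suc i)"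
        using good[of i "M i"] unfolding good_def by (simp add: l[OF i])
      ultimately show ?thesis using i0 by simp
    qed
    thus "\<exists>no. \<forall>n\<ge>no. norm (l n - real n - 0) < \<epsilon>" by blast
  qed
  moreover have "nearby {\<lambda>x. generator (of_real (x - l n)) | n. N < n} (?T k)" for k N
    unfolding nearby_def
  proof (intro allI impI)
    fix \<epsilon> :: real assume "\<epsilon> > 0"
    then obtain i0 where i0: "1 / real (Suc i0) < \<epsilon>" by (rule nat_approx_posE)
    (* a block with target k, with tolerance below \<epsilon>, and beyond N *)
    define i where "i = prod_encode (k, max i0 (Suc N))"
    have ii: "max i0 (Suc N) \<le> i" unfolding i_def by (rule le_prod_encode_2)
    have k: "fst (prod_decode i) = k" by (simp add: i_def)
    have "Suc N \<le> i" by (rule order_trans[OF max.cobounded2 ii])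
    hence Mi: "N < M i" using strict_mono_imp_increasing[OF mono, of i] by linarith
    have g: "sup_L1_le (\<lambda>x. generator_block (ll i (M i)) (cc i (M i)) (M i) (M (Suc i)) x - ?T k x) (1 / real (Suc i))"
      using good[of i "M i", unfolded good_def, THEN conjunct2, THEN conjunct2] unfolding k M_Suc .
    define v where "v x = (\<Sum>n\<in>{M i..<M (Suc i)}. cc i (M i) n * generator (of_real (x - l n)))" for x
    have v: "v x = generator_block (ll i (M i)) (cc i (M i)) (M i) (M (Suc i)) x" for x
      unfolding v_def generator_block_def by (intro sum.cong) (auto simp: l)
    have "v \<in> combos {\<lambda>x. generator (of_real (x - l n)) | n. N < n}"
      unfolding v_def[abs_def]
    proof (rule combos_sum[OF combos_base])
      fix n assume "n \<in> {M i..<M (Suc i)}"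
      hence "N < n" using Mi by simp
      thus "(\<lambda>x. generator (of_real (x - l n))) \<in> {\<lambda>x. generator (of_real (x - l n)) | n. N < n}" by blast
    qed
    moreover have "sup_L1_le (\<lambda>x. ?T k x - v x) \<epsilon>"
    proof (rule sup_L1_le_mono)
      show "sup_L1_le (\<lambda>x. ?T k x - v x) (1 / real (Suc i))"
        using sup_L1_le_cmult[OF g, of "-1"] by (simp add: v)
      have "i0 \<le> i" by (rule order_trans[OF max.cobounded1 ii])
      hence "1 / real (Suc i) \<le> 1 / real (Suc i0)" by (intro divide_left_mono) auto
      thus "1 / real (Suc i) \<le> \<epsilon>" using i0 by simp
    qed
    ultimately show "\<exists>v\<in>combos {\<lambda>x. generator (of_real (x - l n)) | n. N < n}. sup_L1_le (\<lambda>x. ?T k x - v x) \<epsilon>"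
      by blast
  qed
  ultimately show ?thesis by blast
qed

section \<open>Complex translates of the Gaussian\<close>

definition diff1 :: "(real \<Rightarrow> complex) \<Rightarrow> real \<Rightarrow> complex" where
  "diff1 h x = h x - h (x - 1)"

lemma shift_poly_extend:
  assumes "degree P \<le> d"
  shows "shift_poly P h x = (\<Sum>n\<le>d. coeff P n * h (x - real n))"
  unfolding shift_poly_def using assms
  by (intro sum.mono_neutral_left) (auto simp: coeff_eq_0)

lemma shift_poly_difference_mult:
  "shift_poly ([:1, -1:] * P) h = diff1 (shift_poly P h)"
proof
  fix x
  define d where "d = degree P"
  have c0: "coeff ([:1, -1:] * P) 0 = coeff P 0" by simp
  have cS: "coeff ([:1, -1:] * P) (Suc n) = coeff P (Suc n) - coeff P n" for n by simp
  have "degree ([:1, -1:] * P) \<le> Suc d"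
    using degree_mult_le[of "[:1, -1:]" P] by (simp add: d_def)
  hence "shift_poly ([:1, -1:] * P) h x = (\<Sum>n\<le>Suc d. coeff ([:1, -1:] * P) n * h (x - real n))"
    by (rule shift_poly_extend)
  also have "\<dots> = (coeff P 0 * h (x - real 0) + (\<Sum>n\<le>d. coeff P (Suc n) * h (x - real (Suc n)))) - (\<Sum>n\<le>d. coeff P n * h (x - real (Suc n)))"
    unfolding sum.atMost_Suc_shift c0 cS by (simp only: left_diff_distrib sum_subtractf add_diff_eq)
  also have "coeff P 0 * h (x - real 0) + (\<Sum>n\<le>d. coeff P (Suc n) * h (x - real (Suc n))) = (\<Sum>n\<le>Suc d. coeff P n * h (x - real n))"
    by (rule sum.atMost_Suc_shift[symmetric])
  also have "\<dots> = shift_poly P h x"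
    by (rule shift_poly_extend[symmetric]) (simp add: d_def)
  also have "(\<Sum>n\<le>d. coeff P n * h (x - real (Suc n))) = shift_poly P h (x - 1)"
    unfolding shift_poly_def d_def by (intro sum.cong) (auto simp: algebra_simps)
  finally show "shift_poly ([:1, -1:] * P) h x = diff1 (shift_poly P h) x" by (simp add: diff1_def)
qed

lemma shift_poly_difference_power: "shift_poly ([:1, -1:] ^ m) h = (diff1 ^^ m) h"
proof (induction m)
  case 0
  show ?case by (simp add: shift_poly_def fun_eq_iff)
next
  case (Suc m)
  show ?case by (simp only: power_Suc shift_poly_difference_mult Suc.IH funpow.simps o_apply)
qed

lemma diff1_power_Suc: "(diff1 ^^ Suc m) h x = (diff1 ^^ m) h x - (diff1 ^^ m) h (x - 1)"
  by (simp only: funpow.simps o_apply diff1_def)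

lemma diff1_power_translate: "(diff1 ^^ m) (\<lambda>x. h (x - t)) x = (diff1 ^^ m) h (x - t)"
proof (induction m arbitrary: x)
  case (Suc m)
  have "x - 1 - t = x - t - 1" by simp
  thus ?case by (simp only: diff1_power_Suc Suc.IH)
qed simp

text \<open>
  The Gaussian translated by a complex number. For \<open>s = \<i> * \<xi> / 2\<close> it is a multiple of
  \<open>exp (\<i> * \<xi> * x) * gauss x\<close>.
\<close>

definition cgauss :: "complex \<Rightarrow> real \<Rightarrow> complex" where
  "cgauss s x = gauss (of_real x - s)"

lemma cgauss_eq_exp: "cgauss s x = exp (- s\<^sup>2) * (exp (2 * s * of_real x) * gauss (of_real x))"
proof -
  have "- (of_real x - s)\<^sup>2 = - s\<^sup>2 + (2 * s * of_real x + - (of_real x)\<^sup>2)"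
    by (simp add: power2_eq_square algebra_simps)
  thus ?thesis unfolding cgauss_def gauss_def by (simp only: exp_add)
qed

lemma shift_poly_sum:
  "shift_poly P (\<lambda>x. \<Sum>i\<in>I. c i * h i x) x = (\<Sum>i\<in>I. c i * shift_poly P (h i) x)"
proof (induction I rule: infinite_finite_induct)
  case (insert i I)
  have "shift_poly P (\<lambda>x. \<Sum>i\<in>insert i I. c i * h i x) x = shift_poly P (\<lambda>x. c i * h i x + 1 * (\<Sum>i\<in>I. c i * h i x)) x"
    using insert.hyps by simp
  also have "\<dots> = c i * shift_poly P (h i) x + 1 * shift_poly P (\<lambda>x. \<Sum>i\<in>I. c i * h i x) x"
    by (rule shift_poly_linear)
  finally show ?case using insert by simp
qed (auto simp: shift_poly_def)

text \<open>
  Up to a constant factor \<open>cgauss s\<close> is \<open>exp (2 * s * x) * gauss x\<close>, whose exponential series converges in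
  the norm at hand.
\<close>

lemma nearby_cgauss:
  assumes "\<And>k. nearby B (shift_poly diff6 (gauss_moment k))"
  shows "nearby B (shift_poly diff6 (cgauss s))"
proof -
  define e where "e x = exp (2 * s * of_real x) * gauss (of_real x)" for x :: real
  obtain C where C: "C > 0" "\<forall>h B. sup_L1_le h B \<longrightarrow> sup_L1_le (shift_poly diff6 h) (C * B)"
    using shift_poly_bound[of diff6] by (elim exE conjE)
  have "nearby B (shift_poly diff6 e)"
  proof (rule nearby_limit)
    fix \<epsilon> :: real assume e: "\<epsilon> > 0"
    define L where "L = C * (pi * exp ((4 * norm s + 5)\<^sup>2 / 4))"
    have "(\<lambda>K. L / 2 ^ K) \<longlonglongrightarrow> 0" by (rule LIMSEQ_divide_realpow_zero) simp
    hence "eventually (\<lambda>K. L / 2 ^ K < \<epsilon>) sequentially" using e by (rule order_tendstoD(2))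
    then obtain K where K: "L / 2 ^ K < \<epsilon>" by (auto simp: eventually_sequentially)
    define hK where "hK x = (\<Sum>k<K. ((2 * s) ^ k / fact k) * gauss_moment k x)" for x
    have n: "nearby B (shift_poly diff6 hK)"
    proof -
      have "shift_poly diff6 hK = (\<lambda>x. \<Sum>k<K. ((2 * s) ^ k / fact k) * shift_poly diff6 (gauss_moment k) x)"
        unfolding hK_def[abs_def] by (rule ext) (rule shift_poly_sum)
      thus ?thesis using nearby_sum[of "{..<K}" B "\<lambda>k. shift_poly diff6 (gauss_moment k)" "\<lambda>k. (2 * s) ^ k / fact k"] assms
        by (simp only:)
    qed
    have "hK x = (\<Sum>k<K. (2 * s * of_real x) ^ k / fact k) * gauss (of_real x)" for x
      unfolding hK_def gauss_moment_def sum_distrib_right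
      by (intro sum.cong) (simp_all add: power_mult_distrib)
    hence r: "e x - hK x = exp_remainder K (2 * s * of_real x) * gauss (of_real x)" for x
      by (simp only: e_def exp_remainder_def left_diff_distrib)
    have "sup_L1_le (\<lambda>x. e x - hK x) (pi * (1 / 2 ^ K * (fact 0 * exp ((4 * norm s + 5)\<^sup>2 / 4))))"
    proof (rule gauss_weighted_bound)
      show "(\<lambda>x. e x - hK x) \<in> borel_measurable borel"
        unfolding r exp_remainder_def gauss_def by (intro borel_measurable_continuous_onI continuous_intros) auto
      fix x :: real
      have "norm (e x - hK x) \<le> exp (2 * norm (2 * s * of_real x)) / 2 ^ K * exp (- x\<^sup>2)"
        unfolding r norm_mult[of "exp_remainder _ _"] by (intro mult_mono exp_remainder_bound) (auto simp: norm_gauss)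
      also have "2 * norm (2 * s * of_real x) = 4 * norm s * \<bar>x\<bar>" by (simp add: norm_mult)
      finally show "norm (e x - hK x) \<le> 1 / 2 ^ K * (\<bar>x\<bar> ^ 0 * exp (4 * norm s * \<bar>x\<bar>) * exp (- x\<^sup>2))" by simp
    qed simp
    hence "sup_L1_le (\<lambda>x. shift_poly diff6 e x - shift_poly diff6 hK x) (C * (pi * (1 / 2 ^ K * (fact 0 * exp ((4 * norm s + 5)\<^sup>2 / 4)))))"
      using C(2) unfolding shift_poly_diff[symmetric] by blast
    hence "sup_L1_le (\<lambda>x. shift_poly diff6 e x - shift_poly diff6 hK x) \<epsilon>"
      by (rule sup_L1_le_mono) (use K in \<open>simp add: L_def\<close>)
    with n show "\<exists>k. nearby B k \<and> sup_L1_le (\<lambda>x. shift_poly diff6 e x - k x) \<epsilon>"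
      by (intro exI[of _ "shift_poly diff6 hK"] conjI)
  qed
  hence "nearby B (\<lambda>x. exp (- s\<^sup>2) * shift_poly diff6 e x)" by (rule nearby_cmult)
  moreover have "(\<lambda>x. exp (- s\<^sup>2) * shift_poly diff6 e x) = shift_poly diff6 (cgauss s)"
    unfolding cgauss_eq_exp[abs_def] e_def[symmetric]
    using shift_poly_linear[of diff6 "exp (- s\<^sup>2)" e 0 e] by (intro ext) simp
  ultimately show ?thesis by simp
qed

section \<open>Approximation in $L^p$ and removal of differences\<close>

definition Lp_err :: "real \<Rightarrow> (real \<Rightarrow> complex) \<Rightarrow> ennreal" where
  "Lp_err p h = (\<integral>\<^sup>+x. ennreal (norm (h x) powr p) \<partial>lebesgue)"

text \<open>
  Membership in the closure of the span of \<open>B\<close> in \<open>L\<^sup>p\<close>, measured by the \<open>p\<close>-th power of the norm.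
\<close>

definition Lp_near :: "real \<Rightarrow> (real \<Rightarrow> complex) set \<Rightarrow> (real \<Rightarrow> complex) \<Rightarrow> bool" where
  "Lp_near p B g \<longleftrightarrow> g \<in> borel_measurable lebesgue \<and>
     (\<forall>\<epsilon>>0. \<exists>v\<in>combos B. v \<in> borel_measurable lebesgue \<and> Lp_err p (\<lambda>x. g x - v x) \<le> ennreal \<epsilon>)"

text \<open>
  A substitute for Minkowski's inequality that suffices for qualitative approximation.
\<close>

lemma norm_add_powr_le:
  fixes a b :: complex
  assumes "p \<ge> 0"
  shows "norm (a + b) powr p \<le> 2 powr p * (norm a powr p + norm b powr p)"
proof -
  define m where "m = max (norm a) (norm b)"
  have "norm (a + b) powr p \<le> (2 * m) powr p"
    using norm_triangle_ineq[of a b] assms by (intro powr_mono2) (auto simp: m_def)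
  also have "\<dots> = 2 powr p * m powr p" by (simp add: powr_mult m_def)
  also have "m powr p \<le> norm a powr p + norm b powr p" by (simp add: m_def max_def)
  finally show ?thesis by simp
qed

lemma Lp_err_add:
  assumes "p \<ge> 0" and [measurable]: "h \<in> borel_measurable lebesgue" "k \<in> borel_measurable lebesgue"
    and "Lp_err p h \<le> ennreal a" "Lp_err p k \<le> ennreal b" "a \<ge> 0" "b \<ge> 0"
  shows "Lp_err p (\<lambda>x. h x + k x) \<le> ennreal (2 powr p * (a + b))"
proof -
  have "Lp_err p (\<lambda>x. h x + k x) \<le> (\<integral>\<^sup>+x. ennreal (2 powr p) * (ennreal (norm (h x) powr p) + ennreal (norm (k x) powr p)) \<partial>lebesgue)"
    unfolding Lp_err_def using norm_add_powr_le[OF assms(1)]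
    by (intro nn_integral_mono) (simp flip: ennreal_plus ennreal_mult add: ennreal_leI)
  also have "\<dots> = ennreal (2 powr p) * (Lp_err p h + Lp_err p k)"
    unfolding Lp_err_def by (subst nn_integral_cmult) (auto simp: nn_integral_add)
  also have "\<dots> \<le> ennreal (2 powr p) * (ennreal a + ennreal b)"
    by (intro mult_left_mono add_mono assms) simp
  also have "\<dots> = ennreal (2 powr p * (a + b))"
    using assms(6,7) by (simp add: ennreal_mult ennreal_plus)
  finally show ?thesis .
qed

lemma Lp_err_mult_bound:
  assumes "p \<ge> 0" "\<And>x. norm (h x) \<le> M" and [measurable]: "k \<in> borel_measurable lebesgue"
    and "Lp_err p k \<le> ennreal a" "a \<ge> 0"
  shows "Lp_err p (\<lambda>x. h x * k x) \<le> ennreal (M powr p * a)"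
proof -
  have "Lp_err p (\<lambda>x. h x * k x) \<le> (\<integral>\<^sup>+x. ennreal (M powr p) * ennreal (norm (k x) powr p) \<partial>lebesgue)"
    unfolding Lp_err_def
  proof (intro nn_integral_mono)
    fix x
    have "norm (h x * k x) powr p = norm (h x) powr p * norm (k x) powr p"
      by (simp add: norm_mult powr_mult)
    also have "\<dots> \<le> M powr p * norm (k x) powr p"
      by (intro mult_right_mono powr_mono2 assms) auto
    finally show "ennreal (norm (h x * k x) powr p) \<le> ennreal (M powr p) * ennreal (norm (k x) powr p)"
      by (simp flip: ennreal_mult add: ennreal_leI)
  qed
  also have "\<dots> = ennreal (M powr p) * Lp_err p k"
    unfolding Lp_err_def by (rule nn_integral_cmult) measurable
  also have "\<dots> \<le> ennreal (M powr p) * ennreal a" by (intro mult_left_mono assms) simp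
  finally show ?thesis using assms(5) by (simp add: ennreal_mult)
qed

lemma Lp_err_by_sup_L1:
  assumes "h \<in> borel_measurable borel" "\<And>x. norm (h x) \<le> S"
    "(\<integral>\<^sup>+x. ennreal (norm (h x)) \<partial>lborel) \<le> ennreal L" "p \<ge> 1" "L \<ge> 0"
  shows "Lp_err p h \<le> ennreal (S powr (p - 1) * L)"
proof -
  note [measurable] = assms(1)
  have "Lp_err p h = (\<integral>\<^sup>+x. ennreal (norm (h x) powr p) \<partial>lborel)"
    unfolding Lp_err_def by (rule nn_integral_completion)
  also have "\<dots> \<le> (\<integral>\<^sup>+x. ennreal (S powr (p - 1)) * ennreal (norm (h x)) \<partial>lborel)"
  proof (intro nn_integral_mono)
    fix x
    have "norm (h x) powr p = norm (h x) powr (p - 1) * norm (h x)"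
      using powr_add[of "norm (h x)" "p - 1" 1] by (cases "h x = 0") auto
    also have "\<dots> \<le> S powr (p - 1) * norm (h x)"
      using assms by (intro mult_right_mono powr_mono2) auto
    finally show "ennreal (norm (h x) powr p) \<le> ennreal (S powr (p - 1)) * ennreal (norm (h x))"
      by (simp flip: ennreal_mult add: ennreal_leI)
  qed
  also have "\<dots> = ennreal (S powr (p - 1)) * (\<integral>\<^sup>+x. ennreal (norm (h x)) \<partial>lborel)"
    by (rule nn_integral_cmult) measurable
  also have "\<dots> \<le> ennreal (S powr (p - 1)) * ennreal L" by (intro mult_left_mono assms) simp
  finally show ?thesis using assms(5) by (simp add: ennreal_mult)
qed

lemma borel_imp_lebesgue_measurable:
  "h \<in> borel_measurable borel \<Longrightarrow> h \<in> borel_measurable lebesgue" for h :: "real \<Rightarrow> complex"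
  by (rule measurable_completion) simp

lemma Lp_nearI:
  assumes "g \<in> borel_measurable lebesgue"
    "\<And>\<epsilon>. \<epsilon> > 0 \<Longrightarrow> \<exists>v\<in>combos B. v \<in> borel_measurable lebesgue \<and> Lp_err p (\<lambda>x. g x - v x) \<le> ennreal \<epsilon>"
  shows "Lp_near p B g"
  unfolding Lp_near_def using assms(1) by (intro conjI allI impI assms(2))

lemma Lp_nearD:
  assumes "Lp_near p B g" "\<epsilon> > 0"
  shows "\<exists>v\<in>combos B. v \<in> borel_measurable lebesgue \<and> Lp_err p (\<lambda>x. g x - v x) \<le> ennreal \<epsilon>"
  using assms(1)[unfolded Lp_near_def, THEN conjunct2, rule_format, OF assms(2)] .

lemma Lp_near_measurable: "Lp_near p B g \<Longrightarrow> g \<in> borel_measurable lebesgue"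
  unfolding Lp_near_def by (rule conjunct1)

lemma Lp_near_limit:
  assumes "p \<ge> 0" and [measurable]: "g \<in> borel_measurable lebesgue"
    and lim: "\<And>\<epsilon>. \<epsilon> > 0 \<Longrightarrow> \<exists>k. Lp_near p B k \<and> Lp_err p (\<lambda>x. g x - k x) \<le> ennreal \<epsilon>"
  shows "Lp_near p B g"
proof (rule Lp_nearI)
  fix \<epsilon> :: real assume "\<epsilon> > 0"
  define \<delta> where "\<delta> = \<epsilon> / (2 * 2 powr p)"
  have \<delta>: "\<delta> > 0" using \<open>\<epsilon> > 0\<close> by (simp add: \<delta>_def)
  obtain k where k: "Lp_near p B k" "Lp_err p (\<lambda>x. g x - k x) \<le> ennreal \<delta>" using lim[OF \<delta>] by (elim exE conjE)
  obtain v where v: "v \<in> combos B" "v \<in> borel_measurable lebesgue" "Lp_err p (\<lambda>x. k x - v x) \<le> ennreal \<delta>"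
    using Lp_nearD[OF k(1) \<delta>] by (elim bexE conjE)
  note [measurable] = Lp_near_measurable[OF k(1)] v(2)
  have "Lp_err p (\<lambda>x. (g x - k x) + (k x - v x)) \<le> ennreal (2 powr p * (\<delta> + \<delta>))"
    using \<delta> by (intro Lp_err_add assms k v) auto
  also have "2 powr p * (\<delta> + \<delta>) = \<epsilon>" by (simp add: \<delta>_def)
  finally have "Lp_err p (\<lambda>x. g x - v x) \<le> ennreal \<epsilon>" by simp
  thus "\<exists>v\<in>combos B. v \<in> borel_measurable lebesgue \<and> Lp_err p (\<lambda>x. g x - v x) \<le> ennreal \<epsilon>"
    using v(1,2) by (intro bexI[of _ v] conjI)
qed (rule assms(2))

lemma Lp_near_combos: "v \<in> combos B \<Longrightarrow> v \<in> borel_measurable lebesgue \<Longrightarrow> Lp_near p B v"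
  by (rule Lp_nearI) (auto intro!: bexI[of _ v] simp: Lp_err_def)

lemma Lp_near_zero: "Lp_near p B (\<lambda>x. 0)"
  by (rule Lp_near_combos[OF combos.zero]) simp

lemma Lp_near_add:
  assumes "p \<ge> 0" "Lp_near p B g" "Lp_near p B h"
  shows "Lp_near p B (\<lambda>x. g x + h x)"
proof (rule Lp_nearI)
  note [measurable] = assms(2,3)[THEN Lp_near_measurable]
  show "(\<lambda>x. g x + h x) \<in> borel_measurable lebesgue" by measurable
  fix \<epsilon> :: real assume "\<epsilon> > 0"
  define \<delta> where "\<delta> = \<epsilon> / (2 * 2 powr p)"
  have \<delta>: "\<delta> > 0" using \<open>\<epsilon> > 0\<close> by (simp add: \<delta>_def)
  obtain u where u: "u \<in> combos B" "u \<in> borel_measurable lebesgue" "Lp_err p (\<lambda>x. g x - u x) \<le> ennreal \<delta>"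
    using Lp_nearD[OF assms(2) \<delta>] by (elim bexE conjE)
  obtain v where v: "v \<in> combos B" "v \<in> borel_measurable lebesgue" "Lp_err p (\<lambda>x. h x - v x) \<le> ennreal \<delta>"
    using Lp_nearD[OF assms(3) \<delta>] by (elim bexE conjE)
  note [measurable] = u(2) v(2)
  have "Lp_err p (\<lambda>x. (g x - u x) + (h x - v x)) \<le> ennreal (2 powr p * (\<delta> + \<delta>))"
    using \<delta> by (intro Lp_err_add assms u v) auto
  also have "2 powr p * (\<delta> + \<delta>) = \<epsilon>" by (simp add: \<delta>_def)
  also have "(\<lambda>x. (g x - u x) + (h x - v x)) = (\<lambda>x. g x + h x - (u x + v x))" by (simp add: fun_eq_iff)
  finally show "\<exists>v\<in>combos B. v \<in> borel_measurable lebesgue \<and> Lp_err p (\<lambda>x. g x + h x - v x) \<le> ennreal \<epsilon>"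
    by (intro bexI[OF _ combos_add[OF u(1) v(1)]] conjI) measurable
qed

lemma Lp_near_cmult:
  assumes "p \<ge> 0" "Lp_near p B g"
  shows "Lp_near p B (\<lambda>x. c * g x)"
proof (rule Lp_nearI)
  note [measurable] = Lp_near_measurable[OF assms(2)]
  show "(\<lambda>x. c * g x) \<in> borel_measurable lebesgue" by measurable
  fix \<epsilon> :: real assume e: "\<epsilon> > 0"
  obtain u where u: "u \<in> combos B" "u \<in> borel_measurable lebesgue"
    "Lp_err p (\<lambda>x. g x - u x) \<le> ennreal (\<epsilon> / (norm c powr p + 1))"
    using Lp_nearD[OF assms(2) scaled_eps(1)[OF e powr_ge_zero[of "norm c" p]]] by (elim bexE conjE)
  note [measurable] = u(2)
  have "Lp_err p (\<lambda>x. c * (g x - u x)) \<le> ennreal (norm c powr p * (\<epsilon> / (norm c powr p + 1)))"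
    using less_imp_le[OF scaled_eps(1)[OF e powr_ge_zero[of "norm c" p]]] by (intro Lp_err_mult_bound assms u) auto
  also have "\<dots> \<le> ennreal \<epsilon>" by (intro ennreal_leI scaled_eps(2)[OF e powr_ge_zero[of "norm c" p]])
  finally have "Lp_err p (\<lambda>x. c * g x - c * u x) \<le> ennreal \<epsilon>" by (simp only: right_diff_distrib)
  thus "\<exists>v\<in>combos B. v \<in> borel_measurable lebesgue \<and> Lp_err p (\<lambda>x. c * g x - v x) \<le> ennreal \<epsilon>"
    by (intro bexI[OF _ combos_cmult[OF u(1)]] conjI) measurable
qed

lemma Lp_near_sum:
  assumes "p \<ge> 0"
  shows "(\<And>i. i \<in> I \<Longrightarrow> Lp_near p B (h i)) \<Longrightarrow> Lp_near p B (\<lambda>x. \<Sum>i\<in>I. h i x)"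
proof (induction I rule: infinite_finite_induct)
  case (insert i I)
  from Lp_near_add[OF assms insert.prems[of i] insert.IH] insert.hyps insert.prems show ?case by simp
qed (simp_all add: Lp_near_zero)

lemma Lp_near_trans:
  assumes p: "p \<ge> 0" and "Lp_near p E g" "\<And>e. e \<in> E \<Longrightarrow> Lp_near p B e"
  shows "Lp_near p B g"
proof (rule Lp_near_limit[OF p Lp_near_measurable[OF assms(2)]])
  fix \<epsilon> :: real assume "\<epsilon> > 0"
  then obtain v where v: "v \<in> combos E" "Lp_err p (\<lambda>x. g x - v x) \<le> ennreal \<epsilon>"
    using Lp_nearD[OF assms(2)] by blast
  have "Lp_near p B v" using v(1)
  proof (induction v rule: combos.induct)
    case (step b v c)
    show ?case by (rule Lp_near_add[OF p Lp_near_cmult[OF p assms(3)[OF step.hyps(1)]] step.IH])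
  qed (rule Lp_near_zero)
  thus "\<exists>k. Lp_near p B k \<and> Lp_err p (\<lambda>x. g x - k x) \<le> ennreal \<epsilon>" using v(2) by blast
qed

lemma nearby_imp_Lp_near:
  assumes "p \<ge> 1" "nearby B h" "h \<in> borel_measurable borel" "\<And>b. b \<in> B \<Longrightarrow> b \<in> borel_measurable borel"
  shows "Lp_near p B h"
proof (rule Lp_nearI)
  show "h \<in> borel_measurable lebesgue" by (rule borel_imp_lebesgue_measurable[OF assms(3)])
  fix \<epsilon> :: real assume e: "\<epsilon> > 0"
  (* then \<delta> powr (p - 1) * \<delta> is at most \<epsilon> *)
  define \<delta> where "\<delta> = min 1 \<epsilon>"
  have \<delta>: "\<delta> > 0" "\<delta> \<le> 1" "\<delta> \<le> \<epsilon>" using e by (auto simp: \<delta>_def)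
  obtain v where v: "v \<in> combos B" "sup_L1_le (\<lambda>x. h x - v x) \<delta>" using nearbyD[OF assms(2) \<delta>(1)] by (elim bexE)
  have "v \<in> borel_measurable borel" using v(1)
  proof (induction v rule: combos.induct)
    case (step b v c)
    show ?case
      by (rule borel_measurable_add[OF borel_measurable_times[OF borel_measurable_const assms(4)[OF step.hyps(1)]] step.IH])
  qed simp
  hence m: "v \<in> borel_measurable lebesgue" by (rule borel_imp_lebesgue_measurable)
  have "Lp_err p (\<lambda>x. h x - v x) \<le> ennreal (\<delta> powr (p - 1) * \<delta>)"
    using sup_L1_leD[OF v(2)] assms(1) \<delta>(1) by (intro Lp_err_by_sup_L1) auto
  also have "\<dots> \<le> ennreal \<epsilon>"
  proof (rule ennreal_leI)
    have "\<delta> powr (p - 1) \<le> 1" using \<delta> assms(1) by (intro powr_le1) auto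
    hence "\<delta> powr (p - 1) * \<delta> \<le> 1 * \<delta>" using \<delta>(1) by (intro mult_right_mono) auto
    thus "\<delta> powr (p - 1) * \<delta> \<le> \<epsilon>" using \<delta>(3) by simp
  qed
  finally show "\<exists>v\<in>combos B. v \<in> borel_measurable lebesgue \<and> Lp_err p (\<lambda>x. h x - v x) \<le> ennreal \<epsilon>"
    using v(1) m by (intro bexI[of _ v] conjI)
qed

text \<open>
  By assumption \<open>h\<close> minus the average of \<open>h (x - 1), \<dots>, h (x - n)\<close> lies in the closure. The average is at most
  \<open>3 * pi * A / n\<close> because the translated weights have a bounded sum, and its integral stays bounded; so its \<open>L\<^sup>p\<close>
  norm is \<open>O(n powr (1 / p - 1))\<close>. This is the only step that requires \<open>p > 1\<close>.
\<close>

lemma Lp_near_by_averaging: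
  assumes p: "p > 1" and [measurable]: "h \<in> borel_measurable borel" and "A \<ge> 0"
    and bound: "\<And>x. norm (h x) \<le> A * cauchy_weight x"
    and near: "\<And>j::nat. Lp_near p B (\<lambda>x. h x - h (x - real j))"
  shows "Lp_near p B h"
proof (rule Lp_near_limit)
  show "p \<ge> 0" using p by simp
  show "h \<in> borel_measurable lebesgue" by (rule borel_imp_lebesgue_measurable) measurable
  fix \<epsilon> :: real assume e: "\<epsilon> > 0"
  define avg where "avg n x = (1 / of_nat n) * (\<Sum>j\<in>{1..n}. h (x - real j))" for n :: nat and x
  have "(\<lambda>n. 3 * pi * A / real n) \<longlonglongrightarrow> 0" by (rule lim_const_over_n)
  hence "(\<lambda>n. (3 * pi * A / real n) powr (p - 1)) \<longlonglongrightarrow> 0"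
    by (rule tendsto_zero_powrI[OF _ tendsto_const]) (use p assms(3) in auto)
  hence "(\<lambda>n. (3 * pi * A / real n) powr (p - 1) * (pi * A)) \<longlonglongrightarrow> 0"
    by (rule tendsto_mult_left_zero)
  hence "eventually (\<lambda>n. (3 * pi * A / real n) powr (p - 1) * (pi * A) < \<epsilon> \<and> n > 0) sequentially"
    using e by (intro eventually_conj order_tendstoD(2) eventually_gt_at_top)
  then obtain n where n: "(3 * pi * A / real n) powr (p - 1) * (pi * A) < \<epsilon>" "n > 0"
    by (auto simp: eventually_sequentially)
  have near': "Lp_near p B (\<lambda>x. (1 / of_nat n) * (\<Sum>j\<in>{1..n}. h x - h (x - real j)))"
    using p by (intro Lp_near_cmult Lp_near_sum near) auto
  have "h x - (1 / of_nat n) * (\<Sum>j\<in>{1..n}. h x - h (x - real j)) = avg n x" for x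
    using n(2) by (simp add: avg_def sum_subtractf field_simps)
  moreover have "Lp_err p (avg n) \<le> ennreal ((3 * pi * A / real n) powr (p - 1) * (pi * A))"
  proof (rule Lp_err_by_sup_L1)
    show "avg n \<in> borel_measurable borel" unfolding avg_def[abs_def] by measurable
    show "norm (avg n x) \<le> 3 * pi * A / real n" for x
    proof -
      have "norm (\<Sum>j\<in>{1..n}. h (x - real j)) \<le> (\<Sum>j\<in>{1..n}. A * cauchy_weight (x - real j))"
        by (rule sum_norm_le[OF bound])
      also have "\<dots> = A * (\<Sum>j\<in>int ` {1..n}. cauchy_weight (x - of_int j))"
        by (subst sum.reindex) (auto simp: sum_distrib_left)
      also have "\<dots> \<le> A * (3 * pi)"
        using assms(3) by (intro mult_left_mono sum_translated_cauchy_weight) auto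
      finally have "norm (\<Sum>j\<in>{1..n}. h (x - real j)) / real n \<le> A * (3 * pi) / real n"
        by (rule divide_right_mono) simp
      thus ?thesis by (simp add: avg_def norm_mult norm_divide mult_ac)
    qed
    have h: "sup_L1_le h (pi * A)" by (rule sup_L1_le_by_cauchy_weight[OF _ bound assms(3)]) measurable
    have "sup_L1_le (avg n) (norm (1 / of_nat n :: complex) * (\<Sum>j\<in>{1..n}. pi * A))"
      unfolding avg_def[abs_def] by (intro sup_L1_le_cmult sup_L1_le_sum sup_L1_le_translate h)
    moreover have "norm (1 / of_nat n :: complex) * (\<Sum>j\<in>{1..n}. pi * A) = pi * A"
      using n(2) by (simp add: norm_divide)
    ultimately have "sup_L1_le (avg n) (pi * A)" by (simp only:)
    thus "(\<integral>\<^sup>+x. ennreal (norm (avg n x)) \<partial>lborel) \<le> ennreal (pi * A)"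
      by (rule sup_L1_leD(3))
  qed (use p assms(3) in auto)
  ultimately have "Lp_err p (\<lambda>x. h x - (1 / of_nat n) * (\<Sum>j\<in>{1..n}. h x - h (x - real j))) \<le> ennreal ((3 * pi * A / real n) powr (p - 1) * (pi * A))"
    by simp
  also have "\<dots> \<le> ennreal \<epsilon>" using n(1) by (intro ennreal_leI) simp
  finally show "\<exists>k. Lp_near p B k \<and> Lp_err p (\<lambda>x. h x - k x) \<le> ennreal \<epsilon>" using near' by blast
qed

lemma cauchy_weight_translate: "cauchy_weight (x - t) \<le> 2 * (1 + t\<^sup>2) * cauchy_weight x"
proof -
  have "x\<^sup>2 = (x - t)\<^sup>2 + t\<^sup>2 + 2 * (x - t) * t" by (simp add: power2_eq_square algebra_simps)
  moreover have "2 * (x - t) * t \<le> (x - t)\<^sup>2 + t\<^sup>2" by (rule sum_squares_bound)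
  ultimately have "1 + x\<^sup>2 \<le> 2 * (1 + t\<^sup>2) + 2 * (x - t)\<^sup>2" by argo
  also have "\<dots> \<le> 2 * (1 + t\<^sup>2) * (1 + (x - t)\<^sup>2)" by (simp add: algebra_simps)
  finally have "(1 + x\<^sup>2) / (1 + (x - t)\<^sup>2) \<le> 2 * (1 + t\<^sup>2)" by (simp only: pos_divide_le_eq one_plus_square_pos)
  hence "(1 + x\<^sup>2) / (1 + (x - t)\<^sup>2) / (1 + x\<^sup>2) \<le> 2 * (1 + t\<^sup>2) / (1 + x\<^sup>2)"
    by (rule divide_right_mono) simp
  thus ?thesis by (simp add: cauchy_weight_def)
qed

lemma cgauss_difference_bound:
  "\<exists>A\<ge>0. \<forall>x. norm ((diff1 ^^ m) (cgauss s) x) \<le> A * cauchy_weight x"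
proof (induction m)
  case 0
  have "norm (cgauss s x) \<le> exp ((Im s)\<^sup>2) * (2 * (1 + (Re s)\<^sup>2)) * cauchy_weight x" for x
  proof -
    have "norm (cgauss s x) = exp ((Im s)\<^sup>2) * norm (gauss (of_real (x - Re s)))"
      by (simp add: cgauss_def norm_gauss flip: exp_add)
    also have "\<dots> \<le> exp ((Im s)\<^sup>2) * (2 * (1 + (Re s)\<^sup>2) * cauchy_weight x)"
      by (intro mult_left_mono order_trans[OF norm_gauss_le_cauchy_weight cauchy_weight_translate]) simp
    finally show ?thesis by (simp only: mult.assoc)
  qed
  thus ?case by (intro exI[of _ "exp ((Im s)\<^sup>2) * (2 * (1 + (Re s)\<^sup>2))"]) simp
next
  case (Suc m)
  then obtain A where A: "A \<ge> 0" "\<And>x. norm ((diff1 ^^ m) (cgauss s) x) \<le> A * cauchy_weight x" by blast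
  have "norm ((diff1 ^^ Suc m) (cgauss s) x) \<le> (5 * A) * cauchy_weight x" for x
  proof -
    have "norm ((diff1 ^^ Suc m) (cgauss s) x) \<le> norm ((diff1 ^^ m) (cgauss s) x) + norm ((diff1 ^^ m) (cgauss s) (x - 1))"
      unfolding diff1_power_Suc by (rule norm_triangle_ineq4)
    also have "\<dots> \<le> A * cauchy_weight x + A * (2 * (1 + 1\<^sup>2) * cauchy_weight x)"
      by (intro add_mono A(2) order_trans[OF A(2)] mult_left_mono cauchy_weight_translate A(1))
    finally show ?thesis by simp
  qed
  thus ?case using A(1) by (intro exI[of _ "5 * A"]) simp
qed

lemma measurable_cgauss_difference: "(diff1 ^^ m) (cgauss s) \<in> borel_measurable borel"
proof (induction m)
  case 0
  have "cgauss s \<in> borel_measurable borel"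
    unfolding cgauss_def[abs_def] gauss_def by (intro borel_measurable_continuous_onI continuous_intros)
  thus ?case by simp
next
  case (Suc m)
  note [measurable] = Suc.IH
  have "(\<lambda>x. (diff1 ^^ m) (cgauss s) x - (diff1 ^^ m) (cgauss s) (x - 1)) \<in> borel_measurable borel" by measurable
  thus ?case by (simp only: diff1_power_Suc[symmetric])
qed

text \<open>
  The differences \<open>1 - T\<close> are removed one at a time: if \<open>h = (1 - T) ^ m\<close> applied to \<open>cgauss s\<close>, then \<open>h x - h (x - j)\<close>
  is a telescoping sum of \<open>(1 - T) ^ (m + 1)\<close> applied to translates \<open>cgauss (s + i)\<close>.
\<close>

lemma Lp_near_cgauss_difference:
  assumes p: "p > 1" and near: "\<And>s. Lp_near p B ((diff1 ^^ m) (cgauss s))"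
  shows "Lp_near p B (cgauss s)"
proof -
  have step: "\<And>s. Lp_near p B ((diff1 ^^ m) (cgauss s))" if "\<And>s. Lp_near p B ((diff1 ^^ Suc m) (cgauss s))" for m
  proof -
    fix s
    define h where "h = (diff1 ^^ m) (cgauss s)"
    obtain A where A: "A \<ge> 0" "\<And>x. norm (h x) \<le> A * cauchy_weight x"
      using cgauss_difference_bound[of m s] unfolding h_def by blast
    have tr: "h (x - real j) = (diff1 ^^ m) (cgauss (s + of_nat j)) x" for x j
    proof -
      have "(\<lambda>x. cgauss s (x - real j)) = cgauss (s + of_nat j)" by (simp add: fun_eq_iff cgauss_def algebra_simps)
      thus ?thesis using diff1_power_translate[of m "cgauss s" "real j" x] by (simp add: h_def)
    qed
    have d: "Lp_near p B (\<lambda>x. h (x - real j) - h (x - real (Suc j)))" for j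
    proof -
      have "(diff1 ^^ Suc m) (cgauss (s + of_nat j)) x = h (x - real j) - h (x - real (Suc j))" for x
      proof -
        have "(diff1 ^^ m) (cgauss (s + of_nat j)) (x - 1) = h (x - 1 - real j)" by (rule tr[symmetric])
        moreover have "x - 1 - real j = x - real (Suc j)" by simp
        ultimately show ?thesis by (simp only: diff1_power_Suc tr)
      qed
      hence "(diff1 ^^ Suc m) (cgauss (s + of_nat j)) = (\<lambda>x. h (x - real j) - h (x - real (Suc j)))" by (rule ext)
      thus ?thesis using that[of "s + of_nat j"] by (simp only:)
    qed
    have "Lp_near p B (\<lambda>x. h x - h (x - real j))" for j
    proof (induction j)
      case (Suc j)
      have "Lp_near p B (\<lambda>x. (h x - h (x - real j)) + (h (x - real j) - h (x - real (Suc j))))"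
        using p by (intro Lp_near_add Suc d) simp
      thus ?case by simp
    qed (simp add: Lp_near_zero)
    with A show "Lp_near p B ((diff1 ^^ m) (cgauss s))"
      unfolding h_def[symmetric]
      by (intro Lp_near_by_averaging[OF p _ A]) (auto simp: h_def measurable_cgauss_difference)
  qed
  have "(\<And>s. Lp_near p B ((diff1 ^^ m) (cgauss s))) \<Longrightarrow> (\<And>s. Lp_near p B (cgauss s))" for m
  proof (induction m)
    case (Suc m)
    show ?case by (rule Suc.IH[OF step[OF Suc.prems]])
  qed simp
  thus ?thesis using near by blast
qed

section \<open>Density of the modulated Gaussians\<close>

definition modulated_gauss :: "(real \<Rightarrow> complex) set" where
  "modulated_gauss = {\<lambda>x. exp (\<i> * of_real (\<xi> * x)) * gauss (of_real x) | \<xi>. True}"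

lemma Lp_near_modulated_gauss:
  assumes p: "p > 1" and near: "\<And>k. nearby B (shift_poly diff6 (gauss_moment k))"
    and meas: "\<And>b. b \<in> B \<Longrightarrow> b \<in> borel_measurable borel" and e: "e \<in> modulated_gauss"
  shows "Lp_near p B e"
proof -
  obtain \<xi> where \<xi>: "e = (\<lambda>x. exp (\<i> * of_real (\<xi> * x)) * gauss (of_real x))"
    using e by (auto simp: modulated_gauss_def)
  define s where "s = \<i> * of_real (\<xi> / 2)"
  have "Lp_near p B ((diff1 ^^ 6) (cgauss s))" for s
    unfolding shift_poly_difference_power[symmetric] diff6_def[symmetric]
  proof (rule nearby_imp_Lp_near)
    show "nearby B (shift_poly diff6 (cgauss s))" by (rule nearby_cgauss[OF near])
    show "shift_poly diff6 (cgauss s) \<in> borel_measurable borel"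
      unfolding diff6_def shift_poly_difference_power by (rule measurable_cgauss_difference)
  qed (use p meas in auto)
  hence "Lp_near p B (cgauss s)" by (rule Lp_near_cgauss_difference[OF p])
  hence "Lp_near p B (\<lambda>x. exp (s\<^sup>2) * cgauss s x)" using p by (intro Lp_near_cmult) simp_all
  moreover have "exp (s\<^sup>2) * cgauss s x = e x" for x
  proof -
    have "exp (s\<^sup>2) * cgauss s x = (exp (s\<^sup>2) * exp (- s\<^sup>2)) * (exp (2 * s * of_real x) * gauss (of_real x))"
      by (simp only: cgauss_eq_exp mult.assoc)
    also have "exp (s\<^sup>2) * exp (- s\<^sup>2) = 1" by (simp flip: exp_add)
    also have "2 * s * of_real x = \<i> * of_real (\<xi> * x)" by (simp add: s_def)
    finally show ?thesis by (simp add: \<xi>)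
  qed
  ultimately show ?thesis by simp
qed

lemma lebesgue_measurable_gauss [measurable]: "(\<lambda>x. gauss (of_real x)) \<in> borel_measurable lebesgue"
  by (rule borel_imp_lebesgue_measurable) measurable

lemma Lp_err_gauss: "p \<ge> 1 \<Longrightarrow> Lp_err p (\<lambda>x. gauss (of_real x)) \<le> ennreal pi"
  using Lp_err_by_sup_L1[OF measurable_gauss norm_gauss_le_1 sup_L1_leD(3)[OF sup_L1_le_gauss], of p] by simp

lemma Lp_near_modulate:
  assumes p: "p \<ge> 1" and "Lp_near p modulated_gauss g"
  shows "Lp_near p modulated_gauss (\<lambda>x. exp (\<i> * of_real (\<xi> * x)) * g x)"
proof (rule Lp_nearI)
  define e where "e x = exp (\<i> * of_real (\<xi> * x))" for x :: real
  have [measurable]: "e \<in> borel_measurable lebesgue"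
    unfolding e_def[abs_def] by (intro borel_imp_lebesgue_measurable borel_measurable_continuous_onI continuous_intros)
  note [measurable] = Lp_near_measurable[OF assms(2)]
  have "(\<lambda>x. e x * g x) \<in> borel_measurable lebesgue" by measurable
  thus "(\<lambda>x. exp (\<i> * of_real (\<xi> * x)) * g x) \<in> borel_measurable lebesgue" by (simp only: e_def)
  fix \<epsilon> :: real assume \<epsilon>: "\<epsilon> > 0"
  obtain v where v: "v \<in> combos modulated_gauss" "v \<in> borel_measurable lebesgue" "Lp_err p (\<lambda>x. g x - v x) \<le> ennreal \<epsilon>"
    using Lp_nearD[OF assms(2) \<epsilon>] by (elim bexE conjE)
  note [measurable] = v(2)
  have "(\<lambda>x. e x * v x) \<in> combos modulated_gauss" using v(1)
  proof (induction v rule: combos.induct)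
    case (step b v c)
    obtain \<eta> where b: "b = (\<lambda>x. exp (\<i> * of_real (\<eta> * x)) * gauss (of_real x))"
      using step.hyps(1) by (auto simp: modulated_gauss_def)
    have "e x * b x = exp (\<i> * of_real ((\<xi> + \<eta>) * x)) * gauss (of_real x)" for x
      unfolding e_def b mult.assoc[symmetric] exp_add[symmetric] by (simp add: algebra_simps)
    hence "(\<lambda>x. e x * b x) = (\<lambda>x. exp (\<i> * of_real ((\<xi> + \<eta>) * x)) * gauss (of_real x))" by (rule ext)
    hence "(\<lambda>x. e x * b x) \<in> modulated_gauss"
      unfolding modulated_gauss_def by (intro CollectI exI[of _ "\<xi> + \<eta>"] conjI TrueI)
    from combos.step[OF this step.IH, of c] show ?case by (simp add: algebra_simps)
  qed (simp add: combos.zero)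
  moreover have "Lp_err p (\<lambda>x. e x * (g x - v x)) \<le> ennreal (1 powr p * \<epsilon>)"
    using p \<epsilon> by (intro Lp_err_mult_bound v) (auto simp: e_def)
  hence "Lp_err p (\<lambda>x. e x * g x - e x * v x) \<le> ennreal \<epsilon>" by (simp add: right_diff_distrib)
  ultimately show "\<exists>v\<in>combos modulated_gauss. v \<in> borel_measurable lebesgue \<and>
      Lp_err p (\<lambda>x. exp (\<i> * of_real (\<xi> * x)) * g x - v x) \<le> ennreal \<epsilon>"
    unfolding e_def[symmetric] by (intro bexI[of _ "\<lambda>x. e x * v x"] conjI) measurable
qed

text \<open>
  The bounded multipliers \<open>h\<close> for which \<open>h * gauss\<close> lies in the closed span of the modulated Gaussians. They
  turn out to be all bounded measurable functions.
\<close>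

definition tame :: "real \<Rightarrow> (real \<Rightarrow> complex) \<Rightarrow> bool" where
  "tame p h \<longleftrightarrow> h \<in> borel_measurable lebesgue \<and> (\<exists>M. \<forall>x. norm (h x) \<le> M) \<and>
     Lp_near p modulated_gauss (\<lambda>x. h x * gauss (of_real x))"

lemma tameD:
  assumes "tame p h"
  shows "h \<in> borel_measurable lebesgue" "\<exists>M. \<forall>x. norm (h x) \<le> M"
    "Lp_near p modulated_gauss (\<lambda>x. h x * gauss (of_real x))"
  using assms unfolding tame_def by blast+

lemma tameI:
  assumes "h \<in> borel_measurable lebesgue" "\<And>x. norm (h x) \<le> M"
    "Lp_near p modulated_gauss (\<lambda>x. h x * gauss (of_real x))"
  shows "tame p h"
  unfolding tame_def using assms by blast

lemma tame_exp: "tame p (\<lambda>x. exp (\<i> * of_real (\<xi> * x)))"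
proof (rule tameI)
  show "(\<lambda>x::real. exp (\<i> * of_real (\<xi> * x))) \<in> borel_measurable lebesgue"
    by (intro borel_imp_lebesgue_measurable borel_measurable_continuous_onI continuous_intros)
  note [measurable] = this
  show "norm (exp (\<i> * of_real (\<xi> * x))) \<le> 1" for x by simp
  show "Lp_near p modulated_gauss (\<lambda>x. exp (\<i> * of_real (\<xi> * x)) * gauss (of_real x))"
  proof (rule Lp_near_combos[OF combos_base])
    show "(\<lambda>x. exp (\<i> * of_real (\<xi> * x)) * gauss (of_real x)) \<in> modulated_gauss"
      unfolding modulated_gauss_def by blast
    show "(\<lambda>x. exp (\<i> * of_real (\<xi> * x)) * gauss (of_real x)) \<in> borel_measurable lebesgue"
      by measurable
  qed
qed

lemma tame_add:
  assumes "p \<ge> 0" "tame p h" "tame p k"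
  shows "tame p (\<lambda>x. h x + k x)"
proof -
  obtain M N where MN: "\<And>x. norm (h x) \<le> M" "\<And>x. norm (k x) \<le> N"
    using tameD(2)[OF assms(2)] tameD(2)[OF assms(3)] by blast
  note [measurable] = tameD(1)[OF assms(2)] tameD(1)[OF assms(3)]
  show ?thesis
  proof (rule tameI)
    show "(\<lambda>x. h x + k x) \<in> borel_measurable lebesgue" by measurable
    show "norm (h x + k x) \<le> M + N" for x by (intro norm_triangle_mono MN)
    show "Lp_near p modulated_gauss (\<lambda>x. (h x + k x) * gauss (of_real x))"
      using Lp_near_add[OF assms(1) tameD(3)[OF assms(2)] tameD(3)[OF assms(3)]] by (simp only: distrib_right)
  qed
qed

lemma tame_cmult:
  assumes "p \<ge> 0" "tame p h"
  shows "tame p (\<lambda>x. c * h x)"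
proof -
  obtain M where M: "\<And>x. norm (h x) \<le> M" using tameD(2)[OF assms(2)] by blast
  note [measurable] = tameD(1)[OF assms(2)]
  show ?thesis
  proof (rule tameI)
    show "(\<lambda>x. c * h x) \<in> borel_measurable lebesgue" by measurable
    show "norm (c * h x) \<le> norm c * M" for x unfolding norm_mult by (intro mult_left_mono M) simp
    show "Lp_near p modulated_gauss (\<lambda>x. (c * h x) * gauss (of_real x))"
      using Lp_near_cmult[OF assms(1) tameD(3)[OF assms(2)], of c] by (simp only: mult.assoc)
  qed
qed

lemma tame_const: "p \<ge> 0 \<Longrightarrow> tame p (\<lambda>x. c)"
  using tame_cmult[OF _ tame_exp[of p 0], of c] by simp

text \<open>
  If \<open>k * gauss\<close> is close to a combination \<open>v\<close> of modulated Gaussians, then \<open>h * k * gauss\<close> is close to \<open>h * v\<close>, which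
  lies in the closure because the closure is invariant under multiplication by \<open>exp (\<i> * \<xi> * x)\<close>.
\<close>

lemma tame_mult:
  assumes p: "p \<ge> 1" and "tame p h" "tame p k"
  shows "tame p (\<lambda>x. h x * k x)"
proof -
  obtain M N where MN: "\<And>x. norm (h x) \<le> M" "\<And>x. norm (k x) \<le> N"
    using tameD(2)[OF assms(2)] tameD(2)[OF assms(3)] by blast
  have M0: "M \<ge> 0" using MN(1)[of 0] norm_ge_zero[of "h 0"] by linarith
  note [measurable] = tameD(1)[OF assms(2)] tameD(1)[OF assms(3)]
  have p0: "p \<ge> 0" using p by simp
  show ?thesis
  proof (rule tameI)
    show "(\<lambda>x. h x * k x) \<in> borel_measurable lebesgue" by measurable
    show "norm (h x * k x) \<le> M * N" for x unfolding norm_mult by (intro mult_mono MN M0) simp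
    show "Lp_near p modulated_gauss (\<lambda>x. (h x * k x) * gauss (of_real x))"
    proof (rule Lp_near_limit[OF p0])
      show "(\<lambda>x. (h x * k x) * gauss (of_real x)) \<in> borel_measurable lebesgue" by measurable
      fix \<epsilon> :: real assume \<epsilon>: "\<epsilon> > 0"
      define \<delta> where "\<delta> = \<epsilon> / (M powr p + 1)"
      have \<delta>: "\<delta> > 0" "M powr p * \<delta> \<le> \<epsilon>" unfolding \<delta>_def by (rule scaled_eps[OF \<epsilon> powr_ge_zero])+
      obtain v where v: "v \<in> combos modulated_gauss" "v \<in> borel_measurable lebesgue"
        "Lp_err p (\<lambda>x. k x * gauss (of_real x) - v x) \<le> ennreal \<delta>"
        using Lp_nearD[OF tameD(3)[OF assms(3)] \<delta>(1)] by (elim bexE conjE)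
      note [measurable] = v(2)
      have "Lp_near p modulated_gauss (\<lambda>x. h x * v x)" using v(1)
      proof (induction v rule: combos.induct)
        case (step b v c)
        obtain \<eta> where b: "b = (\<lambda>x. exp (\<i> * of_real (\<eta> * x)) * gauss (of_real x))"
          using step.hyps(1) by (auto simp: modulated_gauss_def)
        have "Lp_near p modulated_gauss (\<lambda>x. c * (exp (\<i> * of_real (\<eta> * x)) * (h x * gauss (of_real x))))"
          by (intro Lp_near_cmult p0 Lp_near_modulate p tameD(3)[OF assms(2)])
        from Lp_near_add[OF p0 this step.IH] show ?case by (simp add: b algebra_simps)
      qed (simp add: Lp_near_zero)
      moreover have "Lp_err p (\<lambda>x. h x * (k x * gauss (of_real x) - v x)) \<le> ennreal (M powr p * \<delta>)"
        using \<delta>(1) by (intro Lp_err_mult_bound p0 MN v) auto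
      hence "Lp_err p (\<lambda>x. h x * k x * gauss (of_real x) - h x * v x) \<le> ennreal (M powr p * \<delta>)"
        by (simp only: right_diff_distrib mult.assoc)
      hence "Lp_err p (\<lambda>x. h x * k x * gauss (of_real x) - h x * v x) \<le> ennreal \<epsilon>"
        by (rule order_trans[OF _ ennreal_leI[OF \<delta>(2)]])
      ultimately show "\<exists>w. Lp_near p modulated_gauss w \<and> Lp_err p (\<lambda>x. h x * k x * gauss (of_real x) - w x) \<le> ennreal \<epsilon>"
        by (intro exI[of _ "\<lambda>x. h x * v x"] conjI)
    qed
  qed
qed

text \<open>
  Dominated convergence, with dominating function a multiple of the Gaussian.
\<close>

lemma tame_limit:
  assumes p: "p \<ge> 1" and h: "\<And>n. tame p (h n)" and M: "\<And>n x. norm (h n x) \<le> M"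
    and lim: "\<And>x. (\<lambda>n. h n x) \<longlonglongrightarrow> k x"
  shows "tame p k"
proof -
  have Mk: "norm (k x) \<le> M" for x
    by (rule tendsto_upperbound[OF tendsto_norm[OF lim]]) (auto intro!: always_eventually M)
  have M0: "M \<ge> 0" using M[of 0 0] norm_ge_zero[of "h 0 0"] by linarith
  note [measurable] = tameD(1)[OF h]
  have [measurable]: "k \<in> borel_measurable lebesgue"
    by (rule borel_measurable_LIMSEQ_metric[OF tameD(1)[OF h] lim])
  show ?thesis
  proof (rule tameI[OF _ Mk])
    show "Lp_near p modulated_gauss (\<lambda>x. k x * gauss (of_real x))"
    proof (rule Lp_near_limit)
      show "(\<lambda>x. k x * gauss (of_real x)) \<in> borel_measurable lebesgue" by measurable
      fix \<epsilon> :: real assume \<epsilon>: "\<epsilon> > 0"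
      have "(\<lambda>n. \<integral>\<^sup>+x. ennreal (norm (k x * gauss (of_real x) - h n x * gauss (of_real x)) powr p) \<partial>lebesgue)
          \<longlonglongrightarrow> (\<integral>\<^sup>+x. 0 \<partial>(lebesgue :: real measure))"
      proof (rule nn_integral_dominated_convergence)
        show "(\<lambda>x. ennreal (norm (k x * gauss (of_real x) - h n x * gauss (of_real x)) powr p)) \<in> borel_measurable lebesgue" for n
          by measurable
        show "(\<lambda>x. 0 :: ennreal) \<in> borel_measurable (lebesgue :: real measure)" by measurable
        show "(\<lambda>x. ennreal (norm (complex_of_real (2 * M) * gauss (of_real x)) powr p)) \<in> borel_measurable lebesgue"
          by measurable
        have "Lp_err p (\<lambda>x. complex_of_real (2 * M) * gauss (of_real x)) \<le> ennreal ((2 * M) powr p * pi)"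
          using p M0 by (intro Lp_err_mult_bound Lp_err_gauss) auto
        also have "\<dots> < \<infinity>" by simp
        finally show "(\<integral>\<^sup>+x. ennreal (norm (complex_of_real (2 * M) * gauss (of_real x)) powr p) \<partial>lebesgue) < \<infinity>"
          by (simp only: Lp_err_def)
        show "AE x in lebesgue. ennreal (norm (k x * gauss (of_real x) - h n x * gauss (of_real x)) powr p)
           \<le> ennreal (norm (complex_of_real (2 * M) * gauss (of_real x)) powr p)" for n
        proof (intro AE_I2 ennreal_leI powr_mono2)
          fix x :: real
          have "norm (k x - h n x) \<le> M + M"
            by (rule order_trans[OF norm_triangle_ineq4 add_mono[OF Mk M]])
          thus "norm (k x * gauss (of_real x) - h n x * gauss (of_real x)) \<le> norm (complex_of_real (2 * M) * gauss (of_real x))"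
            unfolding left_diff_distrib[symmetric] norm_mult using M0 by (intro mult_right_mono) auto
        qed (use p in auto)
        show "AE x in lebesgue. (\<lambda>n. ennreal (norm (k x * gauss (of_real x) - h n x * gauss (of_real x)) powr p)) \<longlonglongrightarrow> 0"
        proof (intro AE_I2)
          fix x :: real
          have "(\<lambda>n. k x * gauss (of_real x) - h n x * gauss (of_real x)) \<longlonglongrightarrow> k x * gauss (of_real x) - k x * gauss (of_real x)"
            by (intro tendsto_intros lim)
          hence "(\<lambda>n. norm (k x * gauss (of_real x) - h n x * gauss (of_real x))) \<longlonglongrightarrow> 0"
            by (intro tendsto_norm_zero) simp
          hence "(\<lambda>n. norm (k x * gauss (of_real x) - h n x * gauss (of_real x)) powr p) \<longlonglongrightarrow> 0"
            by (rule tendsto_zero_powrI[OF _ tendsto_const]) (use p in auto)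
          from tendsto_ennrealI[OF this] show "(\<lambda>n. ennreal (norm (k x * gauss (of_real x) - h n x * gauss (of_real x)) powr p)) \<longlonglongrightarrow> 0"
            by simp
        qed
      qed
      hence "eventually (\<lambda>n. Lp_err p (\<lambda>x. k x * gauss (of_real x) - h n x * gauss (of_real x)) < ennreal \<epsilon>) sequentially"
        unfolding Lp_err_def by (rule order_tendstoD(2)) (use \<epsilon> in simp)
      then obtain n where "Lp_err p (\<lambda>x. k x * gauss (of_real x) - h n x * gauss (of_real x)) < ennreal \<epsilon>"
        by (auto simp: eventually_sequentially)
      thus "\<exists>w. Lp_near p modulated_gauss w \<and> Lp_err p (\<lambda>x. k x * gauss (of_real x) - w x) \<le> ennreal \<epsilon>"
        using tameD(3)[OF h] by (intro exI[of _ "\<lambda>x. h n x * gauss (of_real x)"] conjI) auto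
    qed (use p in simp)
  qed measurable
qed

lemma tame_sum: "p \<ge> 0 \<Longrightarrow> (\<And>i. i \<in> I \<Longrightarrow> tame p (h i)) \<Longrightarrow> tame p (\<lambda>x. \<Sum>i\<in>I. h i x)"
proof (induction I rule: infinite_finite_induct)
  case (insert i I)
  from tame_add[OF insert.prems(1) insert.prems(2)[of i] insert.IH] insert.hyps insert.prems show ?case by simp
qed (simp_all add: tame_const)

lemma tame_power: "p \<ge> 1 \<Longrightarrow> tame p h \<Longrightarrow> tame p (\<lambda>x. h x ^ n)"
proof (induction n)
  case 0
  thus ?case by (simp add: tame_const)
next
  case (Suc n)
  thus ?case using tame_mult[OF Suc.prems(1) Suc.prems(2) Suc.IH] by simp
qed

lemma tame_sin:
  assumes p: "p \<ge> 0"
  shows "tame p (\<lambda>x. of_real (sin (a * x + b)))"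
proof -
  have "tame p (\<lambda>x. exp (\<i> * of_real b) / (2 * \<i>) * exp (\<i> * of_real (a * x)) + (- exp (- (\<i> * of_real b)) / (2 * \<i>)) * exp (\<i> * of_real ((- a) * x)))"
    by (intro tame_add tame_cmult tame_exp p)
  moreover have "exp (\<i> * of_real b) / (2 * \<i>) * exp (\<i> * of_real (a * x)) + (- exp (- (\<i> * of_real b)) / (2 * \<i>)) * exp (\<i> * of_real ((- a) * x))
    = of_real (sin (a * x + b))" for x
  proof -
    have "complex_of_real (sin (a * x + b)) = sin (of_real (a * x + b))" by (rule sin_of_real[symmetric])
    also have "\<dots> = (exp (\<i> * of_real (a * x + b)) - exp (- (\<i> * of_real (a * x + b)))) / (2 * \<i>)"
      by (rule sin_exp_eq)
    also have "\<i> * of_real (a * x + b) = \<i> * of_real b + \<i> * of_real (a * x)" by (simp add: algebra_simps)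
    also have "- (\<i> * of_real b + \<i> * of_real (a * x)) = - (\<i> * of_real b) + \<i> * of_real ((- a) * x)" by simp
    finally show ?thesis unfolding exp_add by (simp add: field_simps)
  qed
  ultimately show ?thesis by simp
qed

text \<open>
  The indicator of \<open>(0, \<infinity>)\<close> is a bounded pointwise limit of continuous functions, and by Weierstrass of
  polynomials; polynomials in a tame function are tame.
\<close>

lemma tame_positive_part_indicator:
  assumes p: "p \<ge> 1" and u: "tame p (\<lambda>x. of_real (u x))" "\<And>x. \<bar>u x\<bar> \<le> 1"
  shows "tame p (indicator {x. u x > 0})"
proof -
  (* piecewise linear functions that tend to the indicator of t > 0 *)
  define c where "c n t = max 0 (min 1 (real n * t))" for n and t :: real
  have "\<exists>q. (\<forall>t\<in>{-1..1}. \<bar>c n t - q t\<bar> < 1 / real (Suc n)) \<and> real_polynomial_function q" for n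
  proof -
    have 1: "continuous_on {-1..1} (c n)" unfolding c_def by (intro continuous_intros)
    have 2: "(0::real) < 1 / real (Suc n)" by simp
    show ?thesis
      by (rule Stone_Weierstrass_real_polynomial_function[OF compact_Icc 1 2]) blast
  qed
  then obtain q where q: "\<And>n t. t \<in> {-1..1} \<Longrightarrow> \<bar>c n t - q n t\<bar> < 1 / real (Suc n)"
    "\<And>n. real_polynomial_function (q n)" by metis
  have uI: "u x \<in> {-1..1}" for x using u(2)[of x] by (auto simp: abs_le_iff)
  show ?thesis
  proof (rule tame_limit[OF p])
    show "tame p (\<lambda>x. of_real (q n (u x)))" for n
    proof -
      obtain a m where am: "q n = (\<lambda>t. \<Sum>i\<le>m. a i * t ^ i)"
        using q(2)[of n] unfolding real_polynomial_function_iff_sum by blast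
      have "tame p (\<lambda>x. \<Sum>i\<le>m. of_real (a i) * of_real (u x) ^ i)"
        using p by (intro tame_sum tame_cmult tame_power u) auto
      thus ?thesis by (simp add: am)
    qed
    show "norm (complex_of_real (q n (u x))) \<le> 2" for n x
    proof -
      have "\<bar>c n (u x) - q n (u x)\<bar> < 1" 
        by (rule less_le_trans[OF q(1)[OF uI]]) simp
      moreover have "0 \<le> c n (u x)" "c n (u x) \<le> 1" by (auto simp: c_def)
      ultimately show ?thesis by (simp add: abs_if split: if_splits)
    qed
    show "(\<lambda>n. complex_of_real (q n (u x))) \<longlonglongrightarrow> indicator {x. u x > 0} x" for x
    proof -
      define l where "l = (if u x > 0 then 1 else 0 :: real)"
      have c: "eventually (\<lambda>n. c n (u x) = l) sequentially"
      proof (cases "u x > 0")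
        case True
        obtain n0 :: nat where n0: "1 / u x < real n0" using reals_Archimedean2 by blast
        show ?thesis
        proof (rule eventually_sequentiallyI)
          fix n assume "n0 \<le> n"
          hence "1 / u x \<le> real n" using n0 by linarith
          hence "1 \<le> real n * u x" using True by (simp add: pos_divide_le_eq)
          thus "c n (u x) = l" using True by (simp add: c_def l_def)
        qed
      next
        case False
        have "c n (u x) = l" for n
        proof -
          have "real n * u x \<le> 0" using False by (simp add: mult_nonneg_nonpos)
          hence "min 1 (real n * u x) \<le> 0" by (rule order_trans[OF min.cobounded2])
          thus ?thesis using False unfolding c_def l_def by (simp only: max_absorb1 if_False)
        qed
        thus ?thesis by simp
      qed
      have "(\<lambda>n. c n (u x)) \<longlonglongrightarrow> l" by (rule tendsto_eventually[OF c])
      moreover have "(\<lambda>n. c n (u x) - q n (u x)) \<longlonglongrightarrow> 0"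
      proof (rule Lim_null_comparison)
        show "eventually (\<lambda>n. norm (c n (u x) - q n (u x)) \<le> 1 / real (Suc n)) sequentially"
          using q(1)[OF uI] by (intro always_eventually allI) (auto intro: less_imp_le)
        show "(\<lambda>n. 1 / real (Suc n)) \<longlonglongrightarrow> 0" using LIMSEQ_inverse_real_of_nat by (simp add: inverse_eq_divide)
      qed
      ultimately have "(\<lambda>n. c n (u x) - (c n (u x) - q n (u x))) \<longlonglongrightarrow> l - 0" by (rule tendsto_diff)
      hence "(\<lambda>n. complex_of_real (q n (u x))) \<longlonglongrightarrow> of_real l" by (intro tendsto_of_real) simp
      moreover have "complex_of_real l = indicator {x. u x > 0} x" by (simp add: l_def)
      ultimately show ?thesis by simp
    qed
  qed
qed

text \<open>
  The sine with period \<open>2 * pi * (n + 1)\<close> and a zero at \<open>a\<close> has the sign of \<open>x - a\<close> on an interval around \<open>a\<close> that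
  exhausts the line as \<open>n\<close> grows.
\<close>

lemma tame_half_line:
  assumes p: "p \<ge> 1"
  shows "tame p (indicator {a<..})"
proof (rule tame_limit[OF p])
  define u where "u n x = sin (1 / real (Suc n) * x + (- a / real (Suc n)))" for n :: nat and x
  have u: "u n x = sin ((x - a) / real (Suc n))" for n x by (simp add: u_def diff_divide_distrib)
  show "tame p (indicator {x. u n x > 0})" for n
  proof (rule tame_positive_part_indicator[OF p])
    show "tame p (\<lambda>x. complex_of_real (u n x))" unfolding u_def using p by (intro tame_sin) simp
    show "\<bar>u n x\<bar> \<le> 1" for x by (simp add: u_def)
  qed
  show "norm (indicator {x. u n x > 0} x :: complex) \<le> 1" for n x by (simp add: indicator_def)
  show "(\<lambda>n. indicator {x. u n x > 0} x :: complex) \<longlonglongrightarrow> indicator {a<..} x" for x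
  proof (rule tendsto_eventually)
    obtain n0 :: nat where n0: "\<bar>x - a\<bar> / 3 < real n0" using reals_Archimedean2 by blast
    show "\<forall>\<^sub>F n in sequentially. (indicator {x. u n x > 0} x :: complex) = indicator {a<..} x"
    proof (rule eventually_sequentiallyI)
      fix n assume "n0 \<le> n"
      hence "\<bar>x - a\<bar> / 3 < real (Suc n)" using n0 by linarith
      hence "\<bar>x - a\<bar> / real (Suc n) < 3" by (simp add: divide_less_eq mult.commute)
      hence "\<bar>(x - a) / real (Suc n)\<bar> < pi" using pi_gt3 by (simp add: abs_divide)
      moreover have "u n x > 0 \<longleftrightarrow> x > a" if "\<bar>(x - a) / real (Suc n)\<bar> < pi"
      proof (cases "x > a")
        case True
        hence "(x - a) / real (Suc n) > 0" by simp
        thus ?thesis using that True by (simp add: u sin_gt_zero)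
      next
        case False
        hence "0 \<le> (a - x) / real (Suc n)" by simp
        moreover have "(a - x) / real (Suc n) = - ((x - a) / real (Suc n))" by (simp add: minus_divide_left)
        ultimately have "0 \<le> sin (- ((x - a) / real (Suc n)))" by (intro sin_ge_zero order_trans[OF abs_ge_minus_self less_imp_le[OF that]]) simp
        thus ?thesis using False by (simp add: u)
      qed
      ultimately show "(indicator {x. u n x > 0} x :: complex) = indicator {a<..} x"
        by (simp add: indicator_def)
    qed
  qed
qed

text \<open>
  The sets with tame indicator form a sigma-algebra: intersections come from products, countable unions
  from bounded limits.
\<close>

lemma tame_borel_indicator:
  assumes p: "p \<ge> 1" and A: "A \<in> sets (borel :: real measure)"
  shows "tame p (indicator A)"
proof -
  have p0: "p \<ge> 0" using p by simp
  have compl: "tame p (indicator (UNIV - A))" if "tame p (indicator A)" for A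
  proof -
    have "tame p (\<lambda>x. 1 + (- 1) * indicator A x)" by (intro tame_add tame_cmult tame_const p0 that)
    moreover have "(\<lambda>x. 1 + (- 1) * indicator A x :: complex) = indicator (UNIV - A)"
      by (auto simp: fun_eq_iff indicator_def)
    ultimately show ?thesis by (simp only:)
  qed
  have int: "tame p (indicator (A \<inter> B))" if "tame p (indicator A)" "tame p (indicator B)" for A B
    using tame_mult[OF p that] by (simp add: indicator_inter_arith[abs_def])
  have "A \<in> sigma_sets UNIV (range (\<lambda>a::real. {a<..}))"
    using A unfolding borel_Ioi by simp
  thus ?thesis
  proof (induction A rule: sigma_sets.induct)
    case (Basic A)
    thus ?case using tame_half_line[OF p] by auto
  next
    case Empty
    show ?case using tame_const[OF p0, of 0] by (simp add: indicator_def[abs_def])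
  next
    case (Compl A)
    show ?case by (rule compl[OF Compl.IH])
  next
    case (Union A)
    have fin: "tame p (indicator (\<Union>i<n. A i))" for n
    proof (induction n)
      case 0
      show ?case using tame_const[OF p0, of 0] by (simp add: indicator_def[abs_def])
    next
      case (Suc n)
      have "tame p (indicator (UNIV - ((UNIV - (\<Union>i<n. A i)) \<inter> (UNIV - A n))))"
        by (intro compl int Suc Union.IH)
      moreover have "UNIV - ((UNIV - (\<Union>i<n. A i)) \<inter> (UNIV - A n)) = (\<Union>i<Suc n. A i)"
        by (auto simp: less_Suc_eq)
      ultimately show ?case by (simp only:)
    qed
    show ?case
    proof (rule tame_limit[OF p fin])
      show "norm (indicator (\<Union>i<n. A i) x :: complex) \<le> 1" for n x by (simp add: indicator_def)
      show "(\<lambda>n. indicator (\<Union>i<n. A i) x :: complex) \<longlonglongrightarrow> indicator (\<Union>i. A i) x" for x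
        by (rule LIMSEQ_indicator_UN)
    qed
  qed
qed

lemma tame_lebesgue_indicator:
  assumes p: "p \<ge> 1" and A: "A \<in> sets (lebesgue :: real measure)"
  shows "tame p (indicator A)"
proof -
  obtain S N N' where S: "A = S \<union> N" "N \<subseteq> N'" "N' \<in> null_sets lborel" "S \<in> sets lborel"
    using A by (rule sets_completionE)
  have tS: "tame p (indicator S)" using tame_borel_indicator[OF p, of S] S(4) by simp
  have nul: "N' \<in> null_sets lebesgue" using S(3) by (rule null_sets_completionI)
  have mA: "(indicator A :: real \<Rightarrow> complex) \<in> borel_measurable lebesgue" using A by (rule borel_measurable_indicator)
  note [measurable] = mA tameD(1)[OF tS]
  show ?thesis
  proof (rule tameI[OF mA])
    show "norm (indicator A x :: complex) \<le> 1" for x by (simp add: indicator_def)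
    show "Lp_near p modulated_gauss (\<lambda>x. indicator A x * gauss (of_real x))"
    proof (rule Lp_near_limit)
      show "(\<lambda>x. indicator A x * gauss (of_real x)) \<in> borel_measurable lebesgue" by measurable
      fix \<epsilon> :: real assume "\<epsilon> > 0"
      have "Lp_err p (\<lambda>x. indicator A x * gauss (of_real x) - indicator S x * gauss (of_real x)) = (\<integral>\<^sup>+x. 0 \<partial>(lebesgue :: real measure))"
        unfolding Lp_err_def
      proof (rule nn_integral_cong_AE)
        have "AE x in lebesgue. x \<notin> N'" using nul by (rule AE_not_in)
        thus "AE x in lebesgue. ennreal (norm (indicator A x * gauss (of_real x) - indicator S x * gauss (of_real x)) powr p) = 0"
        proof (rule AE_mp, intro AE_I2 impI)
          fix x assume "x \<notin> N'"
          hence "(indicator A x :: complex) = indicator S x" using S(1,2) by (auto simp: indicator_def)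
          thus "ennreal (norm (indicator A x * gauss (of_real x) - indicator S x * gauss (of_real x)) powr p) = 0" by simp
        qed
      qed
      thus "\<exists>k. Lp_near p modulated_gauss k \<and> Lp_err p (\<lambda>x. indicator A x * gauss (of_real x) - k x) \<le> ennreal \<epsilon>"
        using tameD(3)[OF tS] by (intro exI[of _ "\<lambda>x. indicator S x * gauss (of_real x)"] conjI) auto
    qed (use p in simp)
  qed
qed

lemma tame_bounded_measurable:
  assumes p: "p \<ge> 1" and h: "h \<in> borel_measurable lebesgue" "\<And>x. norm (h x) \<le> M"
  shows "tame p h"
proof -
  obtain F where F: "\<And>i. simple_function lebesgue (F i)" "\<And>x. x \<in> space lebesgue \<Longrightarrow> (\<lambda>i. F i x) \<longlonglongrightarrow> h x"
    "\<And>i x. x \<in> space lebesgue \<Longrightarrow> dist (F i x) 0 \<le> 2 * dist (h x) 0"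
    using borel_measurable_implies_sequence_metric[OF h(1), of 0] by blast
  show ?thesis
  proof (rule tame_limit[OF p])
    show "tame p (F i)" for i
    proof -
      have fin: "finite (range (F i))" using simple_functionD(1)[OF F(1)[of i]] by simp
      have "tame p (\<lambda>x. \<Sum>y\<in>range (F i). y * indicator (F i -` {y}) x)"
      proof (intro tame_sum tame_cmult tame_lebesgue_indicator p)
        fix y
        show "F i -` {y} \<in> sets lebesgue" using simple_functionD(2)[OF F(1)[of i], of "{y}"] by simp
      qed (use p in auto)
      moreover have "(\<Sum>y\<in>range (F i). y * indicator (F i -` {y}) x) = F i x" for x
      proof -
        have "(\<Sum>y\<in>range (F i). y * indicator (F i -` {y}) x) = (\<Sum>y\<in>range (F i). if y = F i x then y else 0)"
          by (intro sum.cong) (auto simp: indicator_def)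
        thus ?thesis using fin by (simp add: sum.delta)
      qed
      ultimately show ?thesis by simp
    qed
    show "norm (F i x) \<le> 2 * M" for i x
      using F(3)[of x i] h(2)[of x] by simp
    show "(\<lambda>i. F i x) \<longlonglongrightarrow> h x" for x using F(2) by simp
  qed
qed

text \<open>
  On the set where \<open>\<bar>g\<bar> \<le> n * gauss\<close> the quotient \<open>g / gauss\<close> is bounded, hence tame; these sets exhaust the line.
\<close>

lemma Lp_near_modulated_gauss_all:
  assumes p: "p \<ge> 1" and [measurable]: "g \<in> borel_measurable lebesgue" and fin: "Lp_err p g < \<infinity>"
  shows "Lp_near p modulated_gauss g"
proof (rule Lp_near_limit)
  fix \<epsilon> :: real assume \<epsilon>: "\<epsilon> > 0"
  define S where "S n = {x. norm (g x) \<le> real n * exp (- x\<^sup>2)}" for n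
  have mS [measurable]: "S n \<in> sets lebesgue" for n
  proof -
    have [measurable]: "(\<lambda>x::real. real n * exp (- x\<^sup>2)) \<in> borel_measurable lebesgue"
      by (rule measurable_completion) (simp add: borel_measurable_continuous_onI continuous_intros)
    have "{x \<in> space lebesgue. norm (g x) \<le> real n * exp (- x\<^sup>2)} \<in> sets lebesgue" by measurable
    thus ?thesis by (simp add: S_def)
  qed
  define k where "k n x = indicator (S n) x * g x" for n x
  have kn: "Lp_near p modulated_gauss (k n)" for n
  proof -
    define h where "h x = k n x / gauss (of_real x)" for x
    have ne: "gauss (of_real x) \<noteq> 0" for x :: real by (simp add: gauss_def)
    have "tame p h"
    proof (rule tame_bounded_measurable[OF p])
      show "h \<in> borel_measurable lebesgue" unfolding h_def[abs_def] k_def by measurable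
      show "norm (h x) \<le> real n" for x
      proof (cases "x \<in> S n")
        case True
        hence "norm (g x) \<le> real n * exp (- x\<^sup>2)" by (simp add: S_def)
        thus ?thesis using True by (simp add: h_def k_def norm_divide norm_gauss pos_divide_le_eq)
      qed (simp add: h_def k_def)
    qed
    from tameD(3)[OF this] show ?thesis using ne by (simp add: h_def)
  qed
  have "(\<lambda>n. \<integral>\<^sup>+x. ennreal (norm (g x - k n x) powr p) \<partial>lebesgue) \<longlonglongrightarrow> (\<integral>\<^sup>+x. 0 \<partial>(lebesgue :: real measure))"
  proof (rule nn_integral_dominated_convergence)
    show "(\<lambda>x. ennreal (norm (g x - k n x) powr p)) \<in> borel_measurable lebesgue" for n
      unfolding k_def by measurable
    show "(\<lambda>x. 0 :: ennreal) \<in> borel_measurable (lebesgue :: real measure)" by measurable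
    show "(\<lambda>x. ennreal (norm (g x) powr p)) \<in> borel_measurable lebesgue" by measurable
    show "(\<integral>\<^sup>+x. ennreal (norm (g x) powr p) \<partial>lebesgue) < \<infinity>" using fin by (simp only: Lp_err_def)
    show "AE x in lebesgue. ennreal (norm (g x - k n x) powr p) \<le> ennreal (norm (g x) powr p)" for n
      by (intro AE_I2 ennreal_leI powr_mono2) (use p in \<open>auto simp: k_def indicator_def\<close>)
    show "AE x in lebesgue. (\<lambda>n. ennreal (norm (g x - k n x) powr p)) \<longlonglongrightarrow> 0"
    proof (intro AE_I2 tendsto_eventually)
      fix x :: real
      obtain n0 :: nat where n0: "norm (g x) / exp (- x\<^sup>2) < real n0" using reals_Archimedean2 by blast
      show "\<forall>\<^sub>F n in sequentially. ennreal (norm (g x - k n x) powr p) = 0"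
      proof (rule eventually_sequentiallyI)
        fix n assume "n0 \<le> n"
        hence "norm (g x) / exp (- x\<^sup>2) \<le> real n" using n0 by linarith
        hence "norm (g x) \<le> real n * exp (- x\<^sup>2)" by (simp only: pos_divide_le_eq exp_gt_zero)
        hence "x \<in> S n" by (simp add: S_def)
        thus "ennreal (norm (g x - k n x) powr p) = 0" by (simp add: k_def)
      qed
    qed
  qed
  hence "eventually (\<lambda>n. Lp_err p (\<lambda>x. g x - k n x) < ennreal \<epsilon>) sequentially"
    unfolding Lp_err_def by (rule order_tendstoD(2)) (use \<epsilon> in simp)
  then obtain n where "Lp_err p (\<lambda>x. g x - k n x) < ennreal \<epsilon>"
    by (auto simp: eventually_sequentially)
  thus "\<exists>k. Lp_near p modulated_gauss k \<and> Lp_err p (\<lambda>x. g x - k x) \<le> ennreal \<epsilon>"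
    using kn by (intro exI[of _ "k n"] conjI) auto
qed (use p in auto)

lemma combos_finite_sum:
  fixes b :: "nat \<Rightarrow> real \<Rightarrow> complex"
  assumes "v \<in> combos {b n | n. N < n}"
  shows "\<exists>F c. finite F \<and> F \<subseteq> {N<..} \<and> v = (\<lambda>x. \<Sum>n\<in>F. c n * b n x)"
  using assms
proof (induction v rule: combos.induct)
  case zero
  show ?case by (intro exI[of _ "{}"]) simp
next
  case (step u v a)
  obtain m where m: "u = b m" "N < m" using step.hyps(1) by blast
  obtain F c where F: "finite F" "F \<subseteq> {N<..}" "v = (\<lambda>x. \<Sum>n\<in>F. c n * b n x)" using step.IH by blast
  define c' where "c' n = (if n \<in> F then c n else 0) + (if n = m then a else 0)" for n
  have "(\<Sum>n\<in>insert m F. c' n * b n x) = a * u x + v x" for x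
  proof -
    have "(\<Sum>n\<in>insert m F. c' n * b n x) = (\<Sum>n\<in>insert m F. (if n \<in> F then c n * b n x else 0)) + (\<Sum>n\<in>insert m F. (if n = m then a * b n x else 0))"
      unfolding sum.distrib[symmetric] by (intro sum.cong) (auto simp: c'_def algebra_simps)
    also have "(\<Sum>n\<in>insert m F. (if n = m then a * b n x else 0)) = a * u x"
      using F(1) by (simp add: m(1) sum.delta)
    also have "(\<Sum>n\<in>insert m F. (if n \<in> F then c n * b n x else 0)) = (\<Sum>n\<in>F. c n * b n x)"
      using F(1) by (intro sum.mono_neutral_cong_right) auto
    finally show ?thesis by (simp add: F(3))
  qed
  thus ?case using F(1,2) m(2) by (intro exI[of _ "insert m F"] exI[of _ c']) (auto simp: fun_eq_iff)
qed

lemma Lp_norm_less: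
  assumes p: "p > 0" and [measurable]: "h \<in> borel_measurable lebesgue"
    and "Lp_err p h \<le> ennreal \<delta>" "\<delta> \<ge> 0" "\<delta> < \<epsilon> powr p" "\<epsilon> > 0"
  shows "Lp_norm lebesgue p h < \<epsilon>"
proof -
  have "(\<integral>x. norm (h x) powr p \<partial>lebesgue) = enn2real (Lp_err p h)"
    unfolding Lp_err_def by (rule integral_eq_nn_integral) auto
  also have "\<dots> \<le> \<delta>" using assms(3,4) by (rule enn2real_leI[rotated])
  finally have "Lp_norm lebesgue p h \<le> \<delta> powr (1 / p)"
    unfolding Lp_norm_def using p by (intro powr_mono2) (auto intro: integral_nonneg_AE)
  also have "\<dots> < (\<epsilon> powr p) powr (1 / p)" using p assms by (intro powr_less_mono2) auto
  also have "\<dots> = \<epsilon>" using p assms(6) by (simp add: powr_powr)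
  finally show ?thesis .
qed

lemma generator_in_Lp:
  assumes "p \<ge> 1"
  shows "(\<lambda>x. generator (of_real (x - t))) \<in> Lp_space lebesgue p"
proof -
  have cont: "continuous_on UNIV (\<lambda>x::real. generator (of_real x))"
    by (rule continuous_on_compose2[OF holomorphic_on_imp_continuous_on[OF generator_holomorphic]])
       (auto intro!: continuous_intros)
  obtain C where C: "\<And>\<zeta>. \<bar>Im \<zeta>\<bar> \<le> 1 \<Longrightarrow> (1 + \<bar>Re \<zeta>\<bar>) ^ 2 * norm (generator \<zeta>) \<le> C"
    using generator_decay[of 2] by blast
  have C0: "C \<ge> 0" using C[of 0] by (auto intro: order_trans[OF norm_ge_zero])
  have b: "norm (generator (of_real x)) \<le> C * cauchy_weight x" for x :: real
  proof -
    have "(1 + x\<^sup>2) * norm (generator (of_real x)) \<le> (1 + \<bar>x\<bar>)\<^sup>2 * norm (generator (of_real x))"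
      by (intro mult_right_mono) (auto simp: power2_sum)
    also have "\<dots> \<le> C" using C[of "of_real x"] by simp
    finally show ?thesis by (simp add: cauchy_weight_def le_divide_eq mult.commute)
  qed
  have s: "sup_L1_le (\<lambda>x. generator (of_real (x - t))) (pi * C)"
    by (rule sup_L1_le_translate[OF sup_L1_le_by_cauchy_weight[OF borel_measurable_continuous_onI[OF cont] b C0]])
  have m [measurable]: "(\<lambda>x. generator (of_real (x - t))) \<in> borel_measurable lebesgue"
    by (rule borel_imp_lebesgue_measurable[OF sup_L1_leD(1)[OF s]])
  have "Lp_err p (\<lambda>x. generator (of_real (x - t))) \<le> ennreal ((pi * C) powr (p - 1) * (pi * C))"
    using sup_L1_leD[OF s] assms C0 by (intro Lp_err_by_sup_L1) auto
  also have "\<dots> < \<infinity>" by simp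
  finally have fin: "Lp_err p (\<lambda>x. generator (of_real (x - t))) < \<infinity>" .
  have "integrable lebesgue (\<lambda>x. norm (generator (of_real (x - t))) powr p)"
  proof (rule integrableI_nonneg)
    show "(\<lambda>x. norm (generator (of_real (x - t))) powr p) \<in> borel_measurable lebesgue" by measurable
    show "AE x in lebesgue. 0 \<le> norm (generator (of_real (x - t))) powr p" by (intro AE_I2 powr_ge_zero)
    show "(\<integral>\<^sup>+x. ennreal (norm (generator (of_real (x - t))) powr p) \<partial>lebesgue) < \<infinity>"
      using fin by (simp only: Lp_err_def)
  qed
  thus ?thesis using m unfolding Lp_space_def mem_Collect_eq by (intro conjI)
qed

theorem theorem1p1:
  "\<exists>(l :: nat \<Rightarrow> real) (f :: real \<Rightarrow> complex).
     (\<lambda>n. l n - real n) \<in> o(\<lambda>_. 1) \<and>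
     f \<in> schwartz_space \<and>
     (\<forall>N>0. \<forall>p>1. complete_in_Lp lebesgue p {N<..} (\<lambda>n x. f (x - l n)))"
proof -
  obtain l where l: "(\<lambda>n. l n - real n) \<longlonglongrightarrow> 0"
    "\<forall>k N. nearby {\<lambda>x. generator (of_real (x - l n)) | n. N < n} (shift_poly diff6 (gauss_moment k))"
    using translation_sequence by (elim exE conjE)
  have "complete_in_Lp lebesgue p {N<..} (\<lambda>n x. generator (of_real (x - l n)))" if p: "p > 1" for N p
    unfolding complete_in_Lp_def
  proof (intro conjI ballI allI impI)
    let ?B = "{\<lambda>x. generator (of_real (x - l n)) | n. N < n}"
    show gen: "(\<lambda>x. generator (of_real (x - l n))) \<in> Lp_space lebesgue p" for n
      using p by (intro generator_in_Lp) simp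
    fix g :: "real \<Rightarrow> complex" and \<epsilon> :: real
    assume g: "g \<in> Lp_space lebesgue p" and \<epsilon>: "\<epsilon> > 0"
    have g': "g \<in> borel_measurable lebesgue \<and> integrable lebesgue (\<lambda>x. norm (g x) powr p)"
      using g unfolding Lp_space_def mem_Collect_eq .
    have m [measurable]: "g \<in> borel_measurable lebesgue" by (rule conjunct1[OF g'])
    have "Lp_err p g = ennreal (\<integral>x. norm (g x) powr p \<partial>lebesgue)"
      unfolding Lp_err_def by (rule nn_integral_eq_integral[OF conjunct2[OF g']]) simp
    hence "Lp_err p g < \<infinity>" by (simp only: ennreal_less_top infinity_ennreal_def)
    hence near: "Lp_near p modulated_gauss g" using p by (intro Lp_near_modulated_gauss_all m) auto
    have nearB: "Lp_near p ?B g"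
    proof (rule Lp_near_trans[OF _ near])
      fix e assume e: "e \<in> modulated_gauss"
      have cont: "continuous_on UNIV (\<lambda>x::real. generator (of_real (x - l n)))" for n
        by (rule continuous_on_compose2[OF holomorphic_on_imp_continuous_on[OF generator_holomorphic]])
           (auto intro!: continuous_intros)
      show "Lp_near p ?B e"
      proof (rule Lp_near_modulated_gauss[OF p _ _ e])
        show "nearby ?B (shift_poly diff6 (gauss_moment k))" for k using l(2) by blast
        fix b assume "b \<in> ?B"
        then obtain n where "b = (\<lambda>x. generator (of_real (x - l n)))" by blast
        thus "b \<in> borel_measurable borel" using borel_measurable_continuous_onI[OF cont[of n]] by (simp only:)
      qed
    qed (use p in simp)
    have e2: "\<epsilon> powr p / 2 > 0" using \<epsilon> by simp
    obtain v where v: "v \<in> combos ?B" "v \<in> borel_measurable lebesgue" "Lp_err p (\<lambda>x. g x - v x) \<le> ennreal (\<epsilon> powr p / 2)"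
      using Lp_nearD[OF nearB e2] by (elim bexE conjE)
    note [measurable] = v(2)
    have "Lp_norm lebesgue p (\<lambda>x. g x - v x) < \<epsilon>"
      by (rule Lp_norm_less[OF _ _ v(3)]) (use p \<epsilon> in auto)
    moreover obtain F c where F: "finite F" "F \<subseteq> {N<..}" "v = (\<lambda>x. \<Sum>n\<in>F. c n * generator (of_real (x - l n)))"
      using combos_finite_sum[OF v(1)] by (elim exE conjE)
    ultimately show "\<exists>F c. finite F \<and> F \<subseteq> {N<..} \<and>
        Lp_norm lebesgue p (\<lambda>x. g x - (\<Sum>n\<in>F. c n * generator (of_real (x - l n)))) < \<epsilon>"
      by (intro exI[of _ F] exI[of _ c]) simp
  qed
  moreover have "(\<lambda>n. l n - real n) \<in> o(\<lambda>_. 1)"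
    using l(1) by (intro smalloI_tendsto) auto
  ultimately show ?thesis using generator_schwartz
    by (intro exI[of _ l] exI[of _ "\<lambda>x. generator (of_real x)"]) auto
qed

end
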